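(* Let $\mathcal{A}=(\mathcal{A}_L,\mathcal{A}_R,S)$ be any Hopf algebroid over a commutative ring $k$, with $\mathcal{A}_L=(A,L,s_L,t_L,\gamma_L,\pi_L)$ and $\mathcal{A}_R=(A,R,s_R,t_R,\gamma_R,\pi_R)$. The following assertions are equivalent: 1.a) Both maps $s_R:R\to A$ and $t_R:R^{op}\to A$ are Frobenius extensions of $k$-algebras. 1.b) Both maps $s_L:L\to A$ and $t_L:L^{op}\to A$ are Frobenius extensions of $k$-algebras. 2.a) The module $A^R$ is finitely generated and projective and there exists $\lambda^*\in\mathcal{L}(\mathcal{A}^* )$ such that the map $\mathcal{F}:A\to\mathcal{A}^*$, $a\mapsto\lambda^*(a\,-)$, is bijective. 2.b) $S$ is bijective, the module ${}^RA$ is finitely generated and projective and there exists ${}^*\lambda\in\mathcal{L}({}^*\mathcal{A})$ such that the map $A\to{}^*\mathcal{A}$, $a\mapsto{}^*\lambda(a\,-)$, is bijective. 2.c) The module ${}_LA$ is finitely generated and projective and there exists ${}_*\rho\in\mathcal{R}({}_*\mathcal{A})$ such that the map $A\to{}_*\mathcal{A}$, $a\mapsto{}_*\rho(-\,a)$, is bijective. 2.d) $S$ is bijective, the module $A_L$ is finitely generated and projective and there exists $\rho_*\in\mathcal{R}(\mathcal{A}_* )$ such that the map $A\to\mathcal{A}_*$, $a\mapsto\rho_*(-\,a)$, is bijective. 3.a) There exists a non-degenerate left integral, i.e. an element $\ell\in\mathcal{L}(\mathcal{A})$ such that both maps $\mathcal{F}^*:\mathcal{A}^*\to A$, $\phi^*\mapsto\ell^{(2)}\,t_R(\phi^*(\ell^{(1)}))$,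 and ${}^*\mathcal{F}:{}^*\mathcal{A}\to A$, ${}^*\phi\mapsto\ell^{(1)}\,s_R({}^*\phi(\ell^{(2)}))$, are bijective. 3.b) There exists a non-degenerate right integral, i.e. an element $\wp\in\mathcal{R}(\mathcal{A})$ such that both maps ${}_*\mathcal{A}\to A$, ${}_*\phi\mapsto t_L({}_*\phi(\wp_{(2)}))\,\wp_{(1)}$, and $\mathcal{A}_*\to A$, $\phi_*\mapsto s_L(\phi_*(\wp_{(1)}))\,\wp_{(2)}$, are bijective.
   Context: Algebras are associative unital algebras over a commutative ring $k$. **Left bialgebroid.** A left bialgebroid $(A,L,s,t,\gamma,\pi)$ consists of $k$-algebras $A$ (total) and $L$ (base), algebra homomorphisms $s:L\to A$ and $t:L^{op}\to A$ with commuting ranges, and an $L$-coring structure (coassociative coproduct $\gamma:A\to A\otimes_L A$ and counit $\pi:A\to L$, both $L$-$L$ bimodule maps) on the $L$-$L$ bimodule $A$ with actions $l\cdot a\cdot l'=s(l)t(l')a$. Writing $\gamma(a)=a_{(1)}\otimes a_{(2)}$, it is required that $a_{(1)}t(l)\otimes a_{(2)}=a_{(1)}\otimes a_{(2)}s(l)$, $\gamma(1)=1\otimes 1$, $\gamma(aa')=\gamma(a)\gamma(a')$, $\pi(1)=1$, $\pi(a\,s(\pi(a')))=\pi(aa')=\pi(a\,t(\pi(a')))$. **Right bialgebroid.** $(A,R,s,t,\gamma,\pi)$ is a right bialgebroid if $(A^{op},R,t,s,\gamma,\pi)$ is a left bialgebroid. Explicitly: $s:R\to A$, $t:R^{op}\to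 A$ are algebra maps with commuting ranges; $(A,\gamma,\pi)$ is an $R$-coring for the bimodule $r\cdot a\cdot r'=a\,s(r')t(r)$; and, with $\gamma(a)=a^{(1)}\otimes a^{(2)}$: $s(r)a^{(1)}\otimes a^{(2)}=a^{(1)}\otimes t(r)a^{(2)}$, $\gamma(1)=1\otimes1$, $\gamma(aa')=\gamma(a)\gamma(a')$, $\pi(1)=1$, $\pi(s(\pi(a))a')=\pi(aa')=\pi(t(\pi(a))a')$. **Module notation.** For $B\in\{L,R\}$ with $s=s_B,t=t_B$: ${}_BA$ is $A$ with left action $b\cdot a=s(b)a$; $A_B$ has right action $a\cdot b=t(b)a$; $A^B$ has right action $a\cdot b=a\,s(b)$; ${}^BA$ has left action $b\cdot a=a\,t(b)$. In a tensor product the displayed module structures are the ones balanced over $B$ (or $B^{op}$), e.g. $A_L\otimes{}_LA$ has $t_L(l)a\otimes b=a\otimes s_L(l)b$, $A^R\otimes{}^RA$ has $as_R(r)\otimes b=a\otimes bt_R(r)$. **Hopf algebroid.** $\mathcal{A}=(\mathcal{A}_L,\mathcal{A}_R,S)$ consists of a left bialgebroid $\mathcal{A}_L=(A,L,s_L,t_L,\gamma_L,\pi_L)$ and a right bialgebroid $\mathcal{A}_R=(A,R,s_R,t_R,\gamma_R,\pi_R)$ on the same total algebra $A$ and a $k$-linear map $S:A\to A$ (antipode, not assumed bijective) such that (i) $s_L\pi_Lt_R=t_R$, $t_L\pi_Ls_R=s_R$, $s_R\pi_Rt_L=t_L$, $t_R\pi_Rs_L=s_L$; (ii) $(\gamma_L\otimes{}^RA)\gamma_R=(A_L\otimes\gamma_R)\gamma_L$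 as maps $A\to A_L\otimes{}_LA^R\otimes{}^RA$, and $(\gamma_R\otimes{}_LA)\gamma_L=(A^R\otimes\gamma_L)\gamma_R$ as maps $A\to A^R\otimes{}^RA_L\otimes{}_LA$; (iii) $S(t_L(l')\,a\,t_L(l))=s_L(l)S(a)s_L(l')$ and $S(t_R(r')\,a\,t_R(r))=s_R(r)S(a)s_R(r')$; (iv) $S(a_{(1)})a_{(2)}=s_R\pi_R(a)$ and $a^{(1)}S(a^{(2)})=s_L\pi_L(a)$, where $\gamma_L(a)=a_{(1)}\otimes a_{(2)}$ and $\gamma_R(a)=a^{(1)}\otimes a^{(2)}$. **Duals.** ${}_*\mathcal{A}={}_L\mathrm{Hom}({}_LA,L)$, $\mathcal{A}_*=\mathrm{Hom}_L(A_L,L)$, $\mathcal{A}^*=\mathrm{Hom}_R(A^R,R)$, ${}^*\mathcal{A}={}_R\mathrm{Hom}({}^RA,R)$. The notation $\phi(a\,-)$ means $b\mapsto\phi(ab)$, and $\phi(-\,a)$ means $b\mapsto\phi(ba)$. **Integrals in $\mathcal{A}$.** $\mathcal{L}(\mathcal{A})=\{\ell\in A\mid a\ell=s_L(\pi_L(a))\,\ell\ \ \forall a\in A\}$; $\mathcal{R}(\mathcal{A})=\{\wp\in A\mid \wp a=\wp\,s_R(\pi_R(a))\ \ \forall a\in A\}$. **Integrals on $\mathcal{A}$.** $\mathcal{R}({}_*\mathcal{A})=\{{}_*\rho\in{}_*\mathcal{A}\mid t_L({}_*\rho(a_{(2)}))a_{(1)}=s_L({}_*\rho(a))\ \forall a\}$;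 $\mathcal{R}(\mathcal{A}_* )=\{\rho_*\in\mathcal{A}_*\mid s_L(\rho_*(a_{(1)}))a_{(2)}=t_L(\rho_*(a))\ \forall a\}$; $\mathcal{L}(\mathcal{A}^* )=\{\lambda^*\in\mathcal{A}^*\mid a^{(2)}t_R(\lambda^*(a^{(1)}))=s_R(\lambda^*(a))\ \forall a\}$; $\mathcal{L}({}^*\mathcal{A})=\{{}^*\lambda\in{}^*\mathcal{A}\mid a^{(1)}s_R({}^*\lambda(a^{(2)}))=t_R({}^*\lambda(a))\ \forall a\}$. **Frobenius extension.** A monomorphism of $k$-algebras $s:B\to A$ is a Frobenius extension if $A$ is finitely generated and projective as a left $B$-module and the bimodules ${}_AA_B$ and ${}_A[{}_B\mathrm{Hom}(A,B)]_B$ (with $a\cdot\phi\cdot b=\phi(-\,a)b$) are isomorphic. Equivalently, there is a Frobenius system $(\psi,\sum_iu_i\otimes v_i)$ consisting of a $B$-$B$ bimodule map $\psi:A\to B$ and an element $\sum_iu_i\otimes v_i\in A\otimes_BA$ with $\sum_i s(\psi(au_i))v_i=a=\sum_iu_i\,s(\psi(v_ia))$ for all $a\in A$. *)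

theory Defs
  imports Complex_Main "HOL-Library.Poly_Mapping" "HOL-Library.Set_Algebras"
begin

section \<open>Algebras\<close>

text \<open>The class \<open>ring_1\<close> of the library excludes the zero ring; these classes admit it.\<close>

class unital_ring = ring + monoid_mult

class comm_unital_ring = comm_ring + comm_monoid_mult

subclass (in comm_unital_ring) unital_ring ..

locale k_algebra =
  fixes scale :: "'k::comm_unital_ring \<Rightarrow> 'a::unital_ring \<Rightarrow> 'a"
  assumes scale_right_distrib: "scale c (x + y) = scale c x + scale c y"
    and scale_left_distrib: "scale (c + d) x = scale c x + scale d x"
    and scale_scale: "scale c (scale d x) = scale (c * d) x"
    and scale_one: "scale 1 x = x"
    and scale_mult_left: "scale c (x * y) = scale c x * y"
    and scale_mult_right: "scale c (x * y) = x * scale c y"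

definition algebra_hom ::
  "('k::comm_unital_ring \<Rightarrow> 'b::unital_ring \<Rightarrow> 'b) \<Rightarrow> ('k \<Rightarrow> 'a::unital_ring \<Rightarrow> 'a) \<Rightarrow> ('b \<Rightarrow> 'a) \<Rightarrow> bool"
  where "algebra_hom scB scA f \<longleftrightarrow>
    Modules.additive f \<and> f 1 = 1 \<and> (\<forall>x y. f (x * y) = f x * f y) \<and> (\<forall>c x. f (scB c x) = scA c (f x))"

datatype 'a opp = Opp (unopp: 'a)

instantiation opp :: (unital_ring) unital_ring
begin

definition "0 = Opp 0"
definition "1 = Opp 1"
definition "x + y = Opp (unopp x + unopp y)"
definition "x - y = Opp (unopp x - unopp y)"
definition "- x = Opp (- unopp x)"
definition "x * y = Opp (unopp y * unopp x)"

instance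
  by standard
    (simp_all add: zero_opp_def one_opp_def plus_opp_def minus_opp_def uminus_opp_def
      times_opp_def algebra_simps)

end

definition opp_scale :: "('k \<Rightarrow> 'b \<Rightarrow> 'b) \<Rightarrow> 'k \<Rightarrow> 'b opp \<Rightarrow> 'b opp"
  where "opp_scale sc c x = Opp (sc c (unopp x))"


section \<open>Modules and Frobenius extensions\<close>

text \<open>A one-sided module is given by its action \<open>act b m\<close>. A right \<open>B\<close>-module is read as a left module
  over the ring \<open>'b opp\<close> wherever the multiplication of \<open>B\<close> matters.\<close>

definition action_hom ::
  "('b \<Rightarrow> 'm::ab_group_add \<Rightarrow> 'm) \<Rightarrow> ('b \<Rightarrow> 'n::ab_group_add \<Rightarrow> 'n) \<Rightarrow> ('m \<Rightarrow> 'n) \<Rightarrow> bool"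
  where "action_hom act act' f \<longleftrightarrow> Modules.additive f \<and> (\<forall>b m. f (act b m) = act' b (f m))"

definition finitely_generated :: "('b::unital_ring \<Rightarrow> 'm::ab_group_add \<Rightarrow> 'm) \<Rightarrow> bool"
  where "finitely_generated act \<longleftrightarrow> (\<exists>X. finite X \<and> (\<forall>m. \<exists>c. m = (\<Sum>x\<in>X. act (c x) x)))"

text \<open>The free left module on the index set \<open>'i\<close> is \<open>'i \<Rightarrow>\<^sub>0 'b\<close>.\<close>

definition free_action :: "'b::unital_ring \<Rightarrow> ('i \<Rightarrow>\<^sub>0 'b) \<Rightarrow> ('i \<Rightarrow>\<^sub>0 'b)"
  where "free_action b = Poly_Mapping.map (\<lambda>x. b * x)"

text \<open>Projective means: direct summand of a free module. The basis may be indexed by the module itself,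
  because a projective module is a direct summand of every free module that maps onto it.\<close>

definition projective :: "('b::unital_ring \<Rightarrow> 'm::ab_group_add \<Rightarrow> 'm) \<Rightarrow> bool"
  where "projective act \<longleftrightarrow>
    (\<exists>(i :: 'm \<Rightarrow> ('m \<Rightarrow>\<^sub>0 'b)) (p :: ('m \<Rightarrow>\<^sub>0 'b) \<Rightarrow> 'm).
      action_hom act free_action i \<and> action_hom free_action act p \<and> (\<forall>m. p (i m) = m))"

definition frobenius_extension ::
  "('k::comm_unital_ring \<Rightarrow> 'b::unital_ring \<Rightarrow> 'b) \<Rightarrow> ('k \<Rightarrow> 'a::unital_ring \<Rightarrow> 'a) \<Rightarrow> ('b \<Rightarrow> 'a) \<Rightarrow> bool"
  where "frobenius_extension scB scA s \<longleftrightarrow>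
    algebra_hom scB scA s \<and> inj s \<and>
    finitely_generated (\<lambda>b a. s b * a) \<and> projective (\<lambda>b a. s b * a) \<and>
    (\<exists>\<theta>. bij_betw \<theta> UNIV {\<phi>. action_hom (\<lambda>b a. s b * a) (*) \<phi>} \<and>
      (\<forall>a a'. \<theta> (a + a') = (\<lambda>x. \<theta> a x + \<theta> a' x)) \<and>
      (\<forall>c a b. \<theta> (c * a * s b) = (\<lambda>x. \<theta> a (x * c) * b)))"


section \<open>Tensor products\<close>

text \<open>\<open>A \<otimes>\<^sub>B A\<close> is the quotient of the free abelian group on \<open>A \<times> A\<close> by the following subgroup; its
  elements are cosets. Here \<open>\<rho> b\<close> is the (right) action of \<open>b\<close> on the first factor, \<open>\<mu> b\<close> the (left)
  action on the second.\<close>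

definition tensor_null ::
  "('b \<Rightarrow> 'a::ab_group_add \<Rightarrow> 'a) \<Rightarrow> ('b \<Rightarrow> 'a \<Rightarrow> 'a) \<Rightarrow> ('a \<times> 'a \<Rightarrow>\<^sub>0 int) set"
  where "tensor_null \<rho> \<mu> = module.span frag_cmul
    ({frag_of (x + x', y) - frag_of (x, y) - frag_of (x', y) | x x' y. True} \<union>
     {frag_of (x, y + y') - frag_of (x, y) - frag_of (x, y') | x y y'. True} \<union>
     {frag_of (\<rho> b x, y) - frag_of (x, \<mu> b y) | b x y. True})"

text \<open>Threefold tensor product \<open>A \<otimes>\<^sub>B A \<otimes>\<^sub>C A\<close>, balanced by \<open>\<rho>, \<mu>\<close> over \<open>B\<close> and by \<open>\<rho>', \<mu>'\<close> over \<open>C\<close>.\<close>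

definition tensor_null3 ::
  "('b \<Rightarrow> 'a::ab_group_add \<Rightarrow> 'a) \<Rightarrow> ('b \<Rightarrow> 'a \<Rightarrow> 'a) \<Rightarrow>
   ('c \<Rightarrow> 'a \<Rightarrow> 'a) \<Rightarrow> ('c \<Rightarrow> 'a \<Rightarrow> 'a) \<Rightarrow> ('a \<times> 'a \<times> 'a \<Rightarrow>\<^sub>0 int) set"
  where "tensor_null3 \<rho> \<mu> \<rho>' \<mu>' = module.span frag_cmul
    ({frag_of (x + x', y, z) - frag_of (x, y, z) - frag_of (x', y, z) | x x' y z. True} \<union>
     {frag_of (x, y + y', z) - frag_of (x, y, z) - frag_of (x, y', z) | x y y' z. True} \<union>
     {frag_of (x, y, z + z') - frag_of (x, y, z) - frag_of (x, y, z') | x y z z'. True} \<union>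
     {frag_of (\<rho> b x, y, z) - frag_of (x, \<mu> b y, z) | b x y z. True} \<union>
     {frag_of (x, \<rho>' c y, z) - frag_of (x, y, \<mu>' c z) | c x y z. True})"

text \<open>A representing formal sum \<open>\<Sum> n\<^sub>i (x\<^sub>i, y\<^sub>i)\<close> of a tensor. All maps out of a tensor product below are
  written in terms of it; wherever they are used they respect the relations of the tensor product, so
  that the choice is immaterial (as in Sweedler notation).\<close>

definition rep :: "('x \<Rightarrow>\<^sub>0 int) set \<Rightarrow> ('x \<Rightarrow>\<^sub>0 int)"
  where "rep X = (SOME x. x \<in> X)"

definition int_times :: "int \<Rightarrow> 'b::ab_group_add \<Rightarrow> 'b"
  where "int_times n x = (\<Sum>i<nat n. x) - (\<Sum>i<nat (- n). x)"

text \<open>\<open>sweedler X f\<close> is \<open>\<Sum> f x\<^sub>i y\<^sub>i\<close> for \<open>X = \<Sum> x\<^sub>i \<otimes> y\<^sub>i\<close>.\<close>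

definition sweedler :: "('a \<times> 'a \<Rightarrow>\<^sub>0 int) set \<Rightarrow> ('a \<Rightarrow> 'a \<Rightarrow> 'b::ab_group_add) \<Rightarrow> 'b"
  where "sweedler X f =
    (\<Sum>p\<in>Poly_Mapping.keys (rep X). int_times (Poly_Mapping.lookup (rep X) p) (f (fst p) (snd p)))"

text \<open>The following operations yield formal sums, to be read modulo a suitable subgroup.\<close>

definition tensor_map ::
  "('a \<Rightarrow> 'a) \<Rightarrow> ('a \<Rightarrow> 'a) \<Rightarrow> ('a \<times> 'a \<Rightarrow>\<^sub>0 int) set \<Rightarrow> ('a \<times> 'a \<Rightarrow>\<^sub>0 int)"
  where "tensor_map f g X = frag_extend (\<lambda>(x, y). frag_of (f x, g y)) (rep X)"

definition tensor_mult ::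
  "('a::times \<times> 'a \<Rightarrow>\<^sub>0 int) set \<Rightarrow> ('a \<times> 'a \<Rightarrow>\<^sub>0 int) set \<Rightarrow> ('a \<times> 'a \<Rightarrow>\<^sub>0 int)"
  where "tensor_mult X Y =
    frag_extend (\<lambda>(x, y). frag_extend (\<lambda>(x', y'). frag_of (x * x', y * y')) (rep Y)) (rep X)"

text \<open>\<open>(\<gamma> \<otimes> A) X\<close> and \<open>(A \<otimes> \<gamma>) X\<close>.\<close>

definition apply_first ::
  "('a \<Rightarrow> ('a \<times> 'a \<Rightarrow>\<^sub>0 int) set) \<Rightarrow> ('a \<times> 'a \<Rightarrow>\<^sub>0 int) set \<Rightarrow> ('a \<times> 'a \<times> 'a \<Rightarrow>\<^sub>0 int)"
  where "apply_first \<gamma> X =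
    frag_extend (\<lambda>(x, y). frag_extend (\<lambda>(x1, x2). frag_of (x1, x2, y)) (rep (\<gamma> x))) (rep X)"

definition apply_second ::
  "('a \<Rightarrow> ('a \<times> 'a \<Rightarrow>\<^sub>0 int) set) \<Rightarrow> ('a \<times> 'a \<Rightarrow>\<^sub>0 int) set \<Rightarrow> ('a \<times> 'a \<times> 'a \<Rightarrow>\<^sub>0 int)"
  where "apply_second \<gamma> X =
    frag_extend (\<lambda>(x, y). frag_extend (\<lambda>(y1, y2). frag_of (x, y1, y2)) (rep (\<gamma> y))) (rep X)"


section \<open>Bialgebroids and Hopf algebroids\<close>

text \<open>Source, target, coproduct and counit. The target map is a plain map \<open>B \<rightarrow> A\<close> that reverses products.\<close>

record ('a, 'b) bialgebroid =
  src :: "'b \<Rightarrow> 'a"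
  tgt :: "'b \<Rightarrow> 'a"
  cop :: "'a \<Rightarrow> ('a \<times> 'a \<Rightarrow>\<^sub>0 int) set"
  cou :: "'a \<Rightarrow> 'b"

text \<open>The relations of \<open>A\<^sub>L \<otimes> \<^sub>LA\<close>, \<open>A\<^sup>R \<otimes> \<^sup>RA\<close> and of the threefold tensor products built from them.\<close>

definition null_L :: "('a::unital_ring, 'l) bialgebroid \<Rightarrow> ('a \<times> 'a \<Rightarrow>\<^sub>0 int) set"
  where "null_L B = tensor_null (\<lambda>l a. tgt B l * a) (\<lambda>l a. src B l * a)"

definition null_R :: "('a::unital_ring, 'r) bialgebroid \<Rightarrow> ('a \<times> 'a \<Rightarrow>\<^sub>0 int) set"
  where "null_R B = tensor_null (\<lambda>r a. a * src B r) (\<lambda>r a. a * tgt B r)"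

definition null_LL :: "('a::unital_ring, 'l) bialgebroid \<Rightarrow> ('a \<times> 'a \<times> 'a \<Rightarrow>\<^sub>0 int) set"
  where "null_LL B = tensor_null3 (\<lambda>l a. tgt B l * a) (\<lambda>l a. src B l * a)
    (\<lambda>l a. tgt B l * a) (\<lambda>l a. src B l * a)"

definition null_RR :: "('a::unital_ring, 'r) bialgebroid \<Rightarrow> ('a \<times> 'a \<times> 'a \<Rightarrow>\<^sub>0 int) set"
  where "null_RR B = tensor_null3 (\<lambda>r a. a * src B r) (\<lambda>r a. a * tgt B r)
    (\<lambda>r a. a * src B r) (\<lambda>r a. a * tgt B r)"

definition null_LR ::
  "('a::unital_ring, 'l) bialgebroid \<Rightarrow> ('a, 'r) bialgebroid \<Rightarrow> ('a \<times> 'a \<times> 'a \<Rightarrow>\<^sub>0 int) set"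
  where "null_LR BL BR = tensor_null3 (\<lambda>l a. tgt BL l * a) (\<lambda>l a. src BL l * a)
    (\<lambda>r a. a * src BR r) (\<lambda>r a. a * tgt BR r)"

definition null_RL ::
  "('a::unital_ring, 'l) bialgebroid \<Rightarrow> ('a, 'r) bialgebroid \<Rightarrow> ('a \<times> 'a \<times> 'a \<Rightarrow>\<^sub>0 int) set"
  where "null_RL BL BR = tensor_null3 (\<lambda>r a. a * src BR r) (\<lambda>r a. a * tgt BR r)
    (\<lambda>l a. tgt BL l * a) (\<lambda>l a. src BL l * a)"

text \<open>In both locales, the sum of cosets in the axiom \<open>cop_add\<close> is the Minkowski sum, i.e. the addition of \<open>A \<otimes>\<^sub>B A\<close>.\<close>

locale left_bialgebroid = A: k_algebra scA + L: k_algebra scL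
  for scA :: "'k::comm_unital_ring \<Rightarrow> 'a::unital_ring \<Rightarrow> 'a"
    and scL :: "'k \<Rightarrow> 'l::unital_ring \<Rightarrow> 'l" +
  fixes BL :: "('a, 'l) bialgebroid"
  assumes src_hom: "algebra_hom scL scA (src BL)"
    and tgt_hom: "algebra_hom (opp_scale scL) scA (tgt BL \<circ> unopp)"
    and src_tgt_commute: "src BL l * tgt BL l' = tgt BL l' * src BL l"
    and cop_tensor: "cop BL a \<in> range (\<lambda>x. x +o null_L BL)"
    and cop_add: "cop BL (a + a') = cop BL a + cop BL a'"
    and cop_bimodule: "cop BL (src BL l * tgt BL l' * a) =
      tensor_map (\<lambda>x. src BL l * x) (\<lambda>y. tgt BL l' * y) (cop BL a) +o null_L BL"
    and coassoc: "apply_first (cop BL) (cop BL a) +o null_LL BL =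
      apply_second (cop BL) (cop BL a) +o null_LL BL"
    and cou_add: "cou BL (a + a') = cou BL a + cou BL a'"
    and cou_bimodule: "cou BL (src BL l * tgt BL l' * a) = l * cou BL a * l'"
    and counit_left: "sweedler (cop BL a) (\<lambda>x y. src BL (cou BL x) * y) = a"
    and counit_right: "sweedler (cop BL a) (\<lambda>x y. tgt BL (cou BL y) * x) = a"
    and takeuchi: "tensor_map (\<lambda>x. x * tgt BL l) (\<lambda>y. y) (cop BL a) +o null_L BL =
      tensor_map (\<lambda>x. x) (\<lambda>y. y * src BL l) (cop BL a) +o null_L BL"
    and cop_one: "cop BL 1 = frag_of (1, 1) +o null_L BL"
    and cop_mult: "cop BL (a * a') = tensor_mult (cop BL a) (cop BL a') +o null_L BL"
    and cou_one: "cou BL 1 = 1"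
    and cou_src: "cou BL (a * src BL (cou BL a')) = cou BL (a * a')"
    and cou_tgt: "cou BL (a * tgt BL (cou BL a')) = cou BL (a * a')"

locale right_bialgebroid = A: k_algebra scA + R: k_algebra scR
  for scA :: "'k::comm_unital_ring \<Rightarrow> 'a::unital_ring \<Rightarrow> 'a"
    and scR :: "'k \<Rightarrow> 'r::unital_ring \<Rightarrow> 'r" +
  fixes BR :: "('a, 'r) bialgebroid"
  assumes src_hom: "algebra_hom scR scA (src BR)"
    and tgt_hom: "algebra_hom (opp_scale scR) scA (tgt BR \<circ> unopp)"
    and src_tgt_commute: "src BR r * tgt BR r' = tgt BR r' * src BR r"
    and cop_tensor: "cop BR a \<in> range (\<lambda>x. x +o null_R BR)"
    and cop_add: "cop BR (a + a') = cop BR a + cop BR a'"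
    and cop_bimodule: "cop BR (a * src BR r' * tgt BR r) =
      tensor_map (\<lambda>x. x * tgt BR r) (\<lambda>y. y * src BR r') (cop BR a) +o null_R BR"
    and coassoc: "apply_first (cop BR) (cop BR a) +o null_RR BR =
      apply_second (cop BR) (cop BR a) +o null_RR BR"
    and cou_add: "cou BR (a + a') = cou BR a + cou BR a'"
    and cou_bimodule: "cou BR (a * src BR r' * tgt BR r) = r * cou BR a * r'"
    and counit_left: "sweedler (cop BR a) (\<lambda>x y. y * tgt BR (cou BR x)) = a"
    and counit_right: "sweedler (cop BR a) (\<lambda>x y. x * src BR (cou BR y)) = a"
    and takeuchi: "tensor_map (\<lambda>x. src BR r * x) (\<lambda>y. y) (cop BR a) +o null_R BR =
      tensor_map (\<lambda>x. x) (\<lambda>y. tgt BR r * y) (cop BR a) +o null_R BR"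
    and cop_one: "cop BR 1 = frag_of (1, 1) +o null_R BR"
    and cop_mult: "cop BR (a * a') = tensor_mult (cop BR a) (cop BR a') +o null_R BR"
    and cou_one: "cou BR 1 = 1"
    and cou_src: "cou BR (src BR (cou BR a) * a') = cou BR (a * a')"
    and cou_tgt: "cou BR (tgt BR (cou BR a) * a') = cou BR (a * a')"

locale hopf_algebroid =
  left: left_bialgebroid scA scL BL + right: right_bialgebroid scA scR BR
  for scA :: "'k::comm_unital_ring \<Rightarrow> 'a::unital_ring \<Rightarrow> 'a"
    and scL :: "'k \<Rightarrow> 'l::unital_ring \<Rightarrow> 'l"
    and scR :: "'k \<Rightarrow> 'r::unital_ring \<Rightarrow> 'r"
    and BL :: "('a, 'l) bialgebroid"
    and BR :: "('a, 'r) bialgebroid" +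
  fixes S :: "'a \<Rightarrow> 'a"
  assumes S_add: "S (a + a') = S a + S a'"
    and S_scale: "S (scA c a) = scA c (S a)"
    and sL_piL_tR: "src BL (cou BL (tgt BR r)) = tgt BR r"
    and tL_piL_sR: "tgt BL (cou BL (src BR r)) = src BR r"
    and sR_piR_tL: "src BR (cou BR (tgt BL l)) = tgt BL l"
    and tR_piR_sL: "tgt BR (cou BR (src BL l)) = src BL l"
    and cop_LR: "apply_first (cop BL) (cop BR a) +o null_LR BL BR =
      apply_second (cop BR) (cop BL a) +o null_LR BL BR"
    and cop_RL: "apply_first (cop BR) (cop BL a) +o null_RL BL BR =
      apply_second (cop BL) (cop BR a) +o null_RL BL BR"
    and S_bimodule_L: "S (tgt BL l' * a * tgt BL l) = src BL l * S a * src BL l'"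
    and S_bimodule_R: "S (tgt BR r' * a * tgt BR r) = src BR r * S a * src BR r'"
    and antipode_left: "sweedler (cop BL a) (\<lambda>x y. S x * y) = src BR (cou BR a)"
    and antipode_right: "sweedler (cop BR a) (\<lambda>x y. x * S y) = src BL (cou BL a)"


section \<open>Duals and integrals\<close>

text \<open>The four duals \<open>\<^sub>*\<A>\<close>, \<open>\<A>\<^sub>*\<close> (for \<open>\<A>\<^sub>L\<close>) and \<open>\<A>\<^sup>*\<close>, \<open>\<^sup>*\<A>\<close> (for \<open>\<A>\<^sub>R\<close>), in this order.\<close>

definition left_L_dual :: "('a::unital_ring, 'l::unital_ring) bialgebroid \<Rightarrow> ('a \<Rightarrow> 'l) set"
  where "left_L_dual BL = {\<phi>. action_hom (\<lambda>l a. src BL l * a) (\<lambda>l x. l * x) \<phi>}"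

definition right_L_dual :: "('a::unital_ring, 'l::unital_ring) bialgebroid \<Rightarrow> ('a \<Rightarrow> 'l) set"
  where "right_L_dual BL = {\<phi>. action_hom (\<lambda>l a. tgt BL l * a) (\<lambda>l x. x * l) \<phi>}"

definition right_R_dual :: "('a::unital_ring, 'r::unital_ring) bialgebroid \<Rightarrow> ('a \<Rightarrow> 'r) set"
  where "right_R_dual BR = {\<phi>. action_hom (\<lambda>r a. a * src BR r) (\<lambda>r x. x * r) \<phi>}"

definition left_R_dual :: "('a::unital_ring, 'r::unital_ring) bialgebroid \<Rightarrow> ('a \<Rightarrow> 'r) set"
  where "left_R_dual BR = {\<phi>. action_hom (\<lambda>r a. a * tgt BR r) (\<lambda>r x. r * x) \<phi>}"

definition left_integrals :: "('a::unital_ring, 'l) bialgebroid \<Rightarrow> 'a set"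
  where "left_integrals BL = {l. \<forall>a. a * l = src BL (cou BL a) * l}"

definition right_integrals :: "('a::unital_ring, 'r) bialgebroid \<Rightarrow> 'a set"
  where "right_integrals BR = {p. \<forall>a. p * a = p * src BR (cou BR a)}"

text \<open>The convolutions of a functional with an element that occur in the definitions of the integrals on
  \<open>\<A>\<close> and of the maps from the duals to \<open>A\<close>.\<close>

definition left_L_conv :: "('a::unital_ring, 'l) bialgebroid \<Rightarrow> ('a \<Rightarrow> 'l) \<Rightarrow> 'a \<Rightarrow> 'a"
  where "left_L_conv BL \<phi> a = sweedler (cop BL a) (\<lambda>x y. tgt BL (\<phi> y) * x)"

definition right_L_conv :: "('a::unital_ring, 'l) bialgebroid \<Rightarrow> ('a \<Rightarrow> 'l) \<Rightarrow> 'a \<Rightarrow> 'a"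
  where "right_L_conv BL \<phi> a = sweedler (cop BL a) (\<lambda>x y. src BL (\<phi> x) * y)"

definition right_R_conv :: "('a::unital_ring, 'r) bialgebroid \<Rightarrow> ('a \<Rightarrow> 'r) \<Rightarrow> 'a \<Rightarrow> 'a"
  where "right_R_conv BR \<phi> a = sweedler (cop BR a) (\<lambda>x y. y * tgt BR (\<phi> x))"

definition left_R_conv :: "('a::unital_ring, 'r) bialgebroid \<Rightarrow> ('a \<Rightarrow> 'r) \<Rightarrow> 'a \<Rightarrow> 'a"
  where "left_R_conv BR \<phi> a = sweedler (cop BR a) (\<lambda>x y. x * src BR (\<phi> y))"

definition left_L_dual_integrals :: "('a::unital_ring, 'l::unital_ring) bialgebroid \<Rightarrow> ('a \<Rightarrow> 'l) set"
  where "left_L_dual_integrals BL = {\<rho> \<in> left_L_dual BL. \<forall>a. left_L_conv BL \<rho> a = src BL (\<rho> a)}"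

definition right_L_dual_integrals :: "('a::unital_ring, 'l::unital_ring) bialgebroid \<Rightarrow> ('a \<Rightarrow> 'l) set"
  where "right_L_dual_integrals BL = {\<rho> \<in> right_L_dual BL. \<forall>a. right_L_conv BL \<rho> a = tgt BL (\<rho> a)}"

definition right_R_dual_integrals :: "('a::unital_ring, 'r::unital_ring) bialgebroid \<Rightarrow> ('a \<Rightarrow> 'r) set"
  where "right_R_dual_integrals BR = {\<psi> \<in> right_R_dual BR. \<forall>a. right_R_conv BR \<psi> a = src BR (\<psi> a)}"

definition left_R_dual_integrals :: "('a::unital_ring, 'r::unital_ring) bialgebroid \<Rightarrow> ('a \<Rightarrow> 'r) set"
  where "left_R_dual_integrals BR = {\<psi> \<in> left_R_dual BR. \<forall>a. left_R_conv BR \<psi> a = tgt BR (\<psi> a)}"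

definition all_equivalent :: "bool list \<Rightarrow> bool"
  where "all_equivalent Ps \<longleftrightarrow> (\<forall>P\<in>set Ps. \<forall>Q\<in>set Ps. P \<longleftrightarrow> Q)"

end

theory Submission
  imports Defs
begin

text \<open>
  The images \<open>B = s\<^sub>R(R) = t\<^sub>L(L)\<close> and \<open>C = t\<^sub>R(R) = s\<^sub>L(L)\<close> of the base algebras are commuting subrings of \<open>A\<close>, and
  every map of the statement can be read as a map between \<open>A\<close>, \<open>B\<close> and \<open>C\<close>. In this form the notion of Hopf
  algebroid is invariant under reversing the product of \<open>A\<close> and flipping both coproducts, which exchanges \<open>B\<close>
  with \<open>C\<close>, 2.a with 2.c, 2.b with 2.d and 3.a with 3.b and leaves 1.a and 1.b alone, these being equal.

  All conditions are compared with the existence of an integral \<open>\<lambda> \<in> \<L>(\<A>\<^sup>*)\<close> that is the functional of a Frobenius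
  system over \<open>B\<close>. Such a \<open>\<lambda>\<close> determines a left integral \<open>\<ell>\<close> with \<open>\<lambda>(a \<ell>) = t\<^sub>L \<pi>\<^sub>L(a)\<close>, and the identities
  \<open>\<lambda>(a \<ell>\<^sup>(\<^sup>1\<^sup>)) S(\<ell>\<^sup>(\<^sup>2\<^sup>)) = a\<close> and \<open>\<ell>\<^sup>(\<^sup>2\<^sup>) t\<^sub>R \<lambda>(S(a) \<ell>\<^sup>(\<^sup>1\<^sup>)) = a\<close> (the identification of \<open>R\<close> with \<open>B\<close> being suppressed) show that
  \<open>S\<close> is bijective and give the inverses of all the other maps.

  Conversely, let \<open>\<psi>\<close> be a Frobenius functional over \<open>B\<close>, and \<open>\<ell>\<close> the left integral with \<open>\<psi>(a \<ell>) = t\<^sub>L \<pi>\<^sub>L(a)\<close>. The Hopf module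
  structure of \<open>\<A>\<^sup>*\<close> writes \<open>\<psi>\<close> as a sum of \<open>\<lambda>\<^sub>k(S(a\<^sub>k) -)\<close> with \<open>\<lambda>\<^sub>k \<in> \<L>(\<A>\<^sup>*)\<close>; evaluation at \<open>\<ell>\<close> produces \<open>\<lambda> \<in> \<L>(\<A>\<^sup>*)\<close>
  with \<open>\<lambda>(\<ell>) = 1\<close>. The element \<open>c = \<ell>\<^sup>(\<^sup>1\<^sup>) \<lambda>(S(\<ell>\<^sup>(\<^sup>2\<^sup>)))\<close> of \<open>C\<close> satisfies \<open>\<lambda>(a c) = \<lambda>(a)\<close>, whence \<open>\<ell> (1 - c) = 0\<close>, and the
  Frobenius property over \<open>C\<close> forces \<open>c = 1\<close>. So \<open>\<ell>\<^sup>(\<^sup>1\<^sup>) \<otimes> S(\<ell>\<^sup>(\<^sup>2\<^sup>))\<close> completes \<open>\<lambda>\<close> to a Frobenius system.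
\<close>



section \<open>Hopf algebroids without base algebras\<close>

text \<open>A tensor is represented by a list of pairs, and \<open>sw\<close> is the Sweedler sum over it. Equality of tensors is only
  used in the form: equal sums for all balanced \<open>f\<close> with values in \<open>A\<close>.\<close>

definition sw :: "('x \<times> 'y) list \<Rightarrow> ('x \<Rightarrow> 'y \<Rightarrow> 'b::comm_monoid_add) \<Rightarrow> 'b"
  where "sw xs f = (\<Sum>p\<leftarrow>xs. f (fst p) (snd p))"

lemma sw_Nil [simp]: "sw [] f = 0"
  and sw_Cons [simp]: "sw (p # xs) f = f (fst p) (snd p) + sw xs f"
  by (simp_all add: sw_def)

lemma sw_append [simp]: "sw (xs @ ys) f = sw xs f + sw ys f"
  by (simp add: sw_def)

lemma sw_add: "sw xs (\<lambda>x y. f x y + g x y) = sw xs f + sw xs g"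
  by (induction xs) (simp_all add: add_ac)

lemma sw_cong:
  assumes "\<And>x y. (x, y) \<in> set xs \<Longrightarrow> f x y = g x y"
  shows "sw xs f = sw xs g"
  using assms by (simp add: sw_def cong: map_cong)

lemma sw_zero [simp]: "sw xs (\<lambda>x y. 0) = 0"
  by (induction xs) simp_all

lemma sw_swap: "sw xs (\<lambda>x y. sw ys (\<lambda>u v. f x y u v)) = sw ys (\<lambda>u v. sw xs (\<lambda>x y. f x y u v))"
  by (induction xs) (simp_all add: sw_add)

lemma sw_hom:
  fixes h :: "'b::ab_group_add \<Rightarrow> 'c::ab_group_add"
  assumes "\<And>x y. h (x + y) = h x + h y"
  shows "h (sw xs f) = sw xs (\<lambda>x y. h (f x y))"
proof -
  have "h 0 = 0"
    using assms[of 0 0] by simp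
  then show ?thesis
    by (induction xs) (simp_all add: assms)
qed

lemma additive_0:
  fixes h :: "'b::ab_group_add \<Rightarrow> 'c::ab_group_add"
  assumes "\<And>x y. h (x + y) = h x + h y"
  shows "h 0 = 0"
  using assms[of 0 0] by simp

lemma additive_diff:
  fixes h :: "'b::ab_group_add \<Rightarrow> 'c::ab_group_add"
  assumes "\<And>x y. h (x + y) = h x + h y"
  shows "h (x - y) = h x - h y"
  using assms[of "x - y" y] by (simp add: algebra_simps)

text \<open>The scalars range over a set \<open>D\<close>, so that a subring of \<open>A\<close> and
  the full type of a base algebra can both serve as scalars.\<close>

definition balanced ::
  "('b \<Rightarrow> 'a::ab_group_add \<Rightarrow> 'a) \<Rightarrow> ('b \<Rightarrow> 'a \<Rightarrow> 'a) \<Rightarrow> 'b set \<Rightarrow> ('a \<Rightarrow> 'a \<Rightarrow> 'c::ab_group_add) \<Rightarrow> bool"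
  where "balanced \<rho> \<mu> D f \<longleftrightarrow>
    (\<forall>x x' y. f (x + x') y = f x y + f x' y) \<and> (\<forall>x y y'. f x (y + y') = f x y + f x y') \<and>
    (\<forall>b\<in>D. \<forall>x y. f (\<rho> b x) y = f x (\<mu> b y))"

text \<open>The product is a parameter, and not the one of a type class, so that the opposite ring lives on the same type.\<close>

locale base_ring =
  fixes mul :: "'a::ab_group_add \<Rightarrow> 'a \<Rightarrow> 'a"  (infixl \<open>\<cdot>\<close> 70)
    and one :: 'a  (\<open>\<one>\<close>)
    and B :: "'a set"
  assumes mul_assoc: "(x \<cdot> y) \<cdot> z = x \<cdot> (y \<cdot> z)"
    and one_mul [simp]: "\<one> \<cdot> x = x" and mul_one [simp]: "x \<cdot> \<one> = x"
    and add_mul: "(x + y) \<cdot> z = x \<cdot> z + y \<cdot> z" and mul_add: "x \<cdot> (y + z) = x \<cdot> y + x \<cdot> z"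
    and B_one: "\<one> \<in> B"
    and B_diff: "x \<in> B \<Longrightarrow> y \<in> B \<Longrightarrow> x - y \<in> B"
    and B_mul: "x \<in> B \<Longrightarrow> y \<in> B \<Longrightarrow> x \<cdot> y \<in> B"
begin

lemma B_zero: "0 \<in> B"
  using B_diff[OF B_one B_one] by simp

lemma B_minus: "x \<in> B \<Longrightarrow> - x \<in> B"
  using B_diff[OF B_zero] by simp

lemma B_add: "x \<in> B \<Longrightarrow> y \<in> B \<Longrightarrow> x + y \<in> B"
  using B_diff[OF _ B_minus, of x y] by simp

lemma B_sw: "(\<And>x y. f x y \<in> B) \<Longrightarrow> sw xs f \<in> B"
  by (induction xs) (auto intro: B_zero B_add)

lemma mul_diff: "x \<cdot> (y - z) = x \<cdot> y - x \<cdot> z" and diff_mul: "(x - y) \<cdot> z = x \<cdot> z - y \<cdot> z"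
  and mul_zero [simp]: "x \<cdot> 0 = 0" and zero_mul [simp]: "0 \<cdot> x = 0"
  by (rule additive_diff[where h = "\<lambda>y. x \<cdot> y"], rule mul_add)
     (rule additive_diff[where h = "\<lambda>x. x \<cdot> z"], rule add_mul,
      rule additive_0[where h = "\<lambda>y. x \<cdot> y"], rule mul_add,
      rule additive_0[where h = "\<lambda>y. y \<cdot> x"], rule add_mul)

lemma mul_sw: "x \<cdot> sw xs f = sw xs (\<lambda>u v. x \<cdot> f u v)"
  and sw_mul: "sw xs f \<cdot> x = sw xs (\<lambda>u v. f u v \<cdot> x)"
  by (rule sw_hom, rule mul_add) (rule sw_hom, rule add_mul)

end

text \<open>Here \<open>\<kappa>\<close> and \<open>P\<close> stand for \<open>t\<^sub>R \<pi>\<^sub>R\<close> and \<open>s\<^sub>R \<pi>\<^sub>R\<close>; on \<open>B\<close> the former is the anti-isomorphism \<open>s\<^sub>R(r) \<mapsto> t\<^sub>R(r)\<close>.\<close>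

locale internal_right_bialgebroid = base_ring mul one B
  for mul :: "'a::ab_group_add \<Rightarrow> 'a \<Rightarrow> 'a"  (infixl \<open>\<cdot>\<close> 70) and one :: 'a  (\<open>\<one>\<close>) and B :: "'a set" +
  fixes C :: "'a set" and \<kappa> :: "'a \<Rightarrow> 'a" and cop :: "'a \<Rightarrow> ('a \<times> 'a) list" and P :: "'a \<Rightarrow> 'a"
  assumes BC_comm: "b \<in> B \<Longrightarrow> c \<in> C \<Longrightarrow> b \<cdot> c = c \<cdot> b"
    and \<kappa>_add: "\<kappa> (x + y) = \<kappa> x + \<kappa> y" and P_add: "P (x + y) = P x + P y"
    and \<kappa>_in: "\<kappa> x \<in> C" and P_in: "P x \<in> B"
    and \<kappa>_id: "c \<in> C \<Longrightarrow> \<kappa> c = c" and P_id: "b \<in> B \<Longrightarrow> P b = b"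
    and \<kappa>_P: "\<kappa> (P x) = \<kappa> x"
    and P_mulB: "b \<in> B \<Longrightarrow> P (x \<cdot> b) = P x \<cdot> b"
    and P_mul\<kappa>: "b \<in> B \<Longrightarrow> P (x \<cdot> \<kappa> b) = b \<cdot> P x"
    and \<kappa>_mulB: "b \<in> B \<Longrightarrow> \<kappa> (x \<cdot> b) = \<kappa> b \<cdot> \<kappa> x"
    and \<kappa>_mulC: "c \<in> C \<Longrightarrow> \<kappa> (x \<cdot> c) = \<kappa> x \<cdot> c"
    and P_P_mul: "P (P x \<cdot> y) = P (x \<cdot> y)"
    and P_\<kappa>_mul: "P (\<kappa> x \<cdot> y) = P (x \<cdot> y)"
    and cop_add: "balanced (\<lambda>b x. x \<cdot> b) (\<lambda>b x. x \<cdot> \<kappa> b) B (f :: 'a \<Rightarrow> 'a \<Rightarrow> 'a) \<Longrightarrow>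
      sw (cop (x + y)) f = sw (cop x) f + sw (cop y) f"
    and cop_mulB: "balanced (\<lambda>b x. x \<cdot> b) (\<lambda>b x. x \<cdot> \<kappa> b) B (f :: 'a \<Rightarrow> 'a \<Rightarrow> 'a) \<Longrightarrow> b \<in> B \<Longrightarrow>
      sw (cop (x \<cdot> b)) f = sw (cop x) (\<lambda>x1 x2. f x1 (x2 \<cdot> b))"
    and cop_mul\<kappa>: "balanced (\<lambda>b x. x \<cdot> b) (\<lambda>b x. x \<cdot> \<kappa> b) B (f :: 'a \<Rightarrow> 'a \<Rightarrow> 'a) \<Longrightarrow> b \<in> B \<Longrightarrow>
      sw (cop (x \<cdot> \<kappa> b)) f = sw (cop x) (\<lambda>x1 x2. f (x1 \<cdot> \<kappa> b) x2)"
    and takeuchi: "balanced (\<lambda>b x. x \<cdot> b) (\<lambda>b x. x \<cdot> \<kappa> b) B (f :: 'a \<Rightarrow> 'a \<Rightarrow> 'a) \<Longrightarrow> b \<in> B \<Longrightarrow>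
      sw (cop x) (\<lambda>x1 x2. f (b \<cdot> x1) x2) = sw (cop x) (\<lambda>x1 x2. f x1 (\<kappa> b \<cdot> x2))"
    and cop_one: "balanced (\<lambda>b x. x \<cdot> b) (\<lambda>b x. x \<cdot> \<kappa> b) B (f :: 'a \<Rightarrow> 'a \<Rightarrow> 'a) \<Longrightarrow>
      sw (cop \<one>) f = f \<one> \<one>"
    and cop_mult: "balanced (\<lambda>b x. x \<cdot> b) (\<lambda>b x. x \<cdot> \<kappa> b) B (f :: 'a \<Rightarrow> 'a \<Rightarrow> 'a) \<Longrightarrow>
      sw (cop (x \<cdot> y)) f = sw (cop x) (\<lambda>x1 x2. sw (cop y) (\<lambda>y1 y2. f (x1 \<cdot> y1) (x2 \<cdot> y2)))"
    and coassoc: "(\<And>z. balanced (\<lambda>b x. x \<cdot> b) (\<lambda>b x. x \<cdot> \<kappa> b) B (\<lambda>x y. F x y z)) \<Longrightarrow>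
      (\<And>x. balanced (\<lambda>b x. x \<cdot> b) (\<lambda>b x. x \<cdot> \<kappa> b) B (F x :: 'a \<Rightarrow> 'a \<Rightarrow> 'a)) \<Longrightarrow>
      sw (cop a) (\<lambda>p z. sw (cop p) (\<lambda>x y. F x y z)) = sw (cop a) (\<lambda>x q. sw (cop q) (F x))"
    and counit1: "sw (cop a) (\<lambda>x y. y \<cdot> \<kappa> x) = a"
    and counit2: "sw (cop a) (\<lambda>x y. x \<cdot> P y) = a"
begin

abbreviation bal :: "('a \<Rightarrow> 'a \<Rightarrow> 'a) \<Rightarrow> bool"
  where "bal \<equiv> balanced (\<lambda>b x. x \<cdot> b) (\<lambda>b x. x \<cdot> \<kappa> b) B"

lemma balI:
  assumes "\<And>x x' y. f (x + x') y = f x y + f x' y" "\<And>x y y'. f x (y + y') = f x y + f x y'"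
    "\<And>b x y. b \<in> B \<Longrightarrow> f (x \<cdot> b) y = f x (y \<cdot> \<kappa> b)"
  shows "bal f"
  using assms by (simp add: balanced_def)

lemma bal_add1: "bal f \<Longrightarrow> f (x + x') y = f x y + f x' y"
  and bal_add2: "bal f \<Longrightarrow> f x (y + y') = f x y + f x y'"
  and balD: "bal f \<Longrightarrow> b \<in> B \<Longrightarrow> f (x \<cdot> b) y = f x (y \<cdot> \<kappa> b)"
  by (auto simp: balanced_def)

lemma P_one [simp]: "P \<one> = \<one>"
  by (rule P_id) (rule B_one)

text \<open>The counit identity \<open>counit1\<close> for the unit, whose coproduct is
  \<open>\<one> \<otimes> \<one>\<close>.\<close>

lemma \<kappa>_one [simp]: "\<kappa> \<one> = \<one>"
  using counit1[of \<one>]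
    cop_one[of "\<lambda>x y. y \<cdot> \<kappa> x"]
  by (simp add: balanced_def \<kappa>_add mul_add add_mul \<kappa>_mulB mul_assoc)

lemma P_\<kappa>: "P (\<kappa> x) = P x"
  using P_\<kappa>_mul[of x \<one>] by simp

text \<open>Multiplying a tensor into the coproduct of \<open>a\<close> from the left is well
  defined thanks to the Takeuchi condition, which carries \<open>b\<close> to the other leg as
  \<open>\<kappa> b\<close>.\<close>

lemma bal_cop_mult:
  assumes "bal f"
  shows "bal (\<lambda>x y. sw (cop a) (\<lambda>x' y'. f (x \<cdot> x') (y \<cdot> y')))"
proof (rule balI)
  fix b x y assume b: "b \<in> B"
  have "bal (\<lambda>x' y'. f (x \<cdot> x') (y \<cdot> y'))"
    by (rule balI) (simp_all add: mul_add bal_add1[OF assms] bal_add2[OF assms] balD[OF assms]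
        flip: mul_assoc)
  from takeuchi[OF this b] show
    "sw (cop a) (\<lambda>x' y'. f (x \<cdot> b \<cdot> x') (y \<cdot> y')) = sw (cop a) (\<lambda>x' y'. f (x \<cdot> x') (y \<cdot> \<kappa> b \<cdot> y'))"
    by (simp add: mul_assoc)
qed (simp_all add: add_mul bal_add1[OF assms] bal_add2[OF assms] sw_add)

text \<open>The axioms describe coproducts of right multiples. Writing \<open>b\<close> as
  \<open>\<one> \<cdot> b\<close> and using multiplicativity yields the left multiples too;
  \<open>cop_\<kappa>_mul\<close> is obtained in the same way.\<close>

lemma cop_B_mul:
  assumes f: "bal f" and b: "b \<in> B"
  shows "sw (cop (b \<cdot> a)) f = sw (cop a) (\<lambda>x y. f x (b \<cdot> y))"
proof -
  note g = bal_cop_mult[OF f, of a]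
  have "sw (cop (b \<cdot> a)) f = sw (cop (\<one> \<cdot> b)) (\<lambda>x y. sw (cop a) (\<lambda>x' y'. f (x \<cdot> x') (y \<cdot> y')))"
    using cop_mult[OF f, of b a] by simp
  also have "\<dots> = sw (cop \<one>) (\<lambda>x y. sw (cop a) (\<lambda>x' y'. f (x \<cdot> x') (y \<cdot> b \<cdot> y')))"
    by (rule cop_mulB[OF g b])
  also have "\<dots> = sw (cop a) (\<lambda>x' y'. f (\<one> \<cdot> x') (\<one> \<cdot> b \<cdot> y'))"
  proof (rule cop_one, rule balI)
    fix b' x y assume b': "b' \<in> B"
    have "b \<cdot> \<kappa> b' = \<kappa> b' \<cdot> b"
      by (rule BC_comm[OF b \<kappa>_in])
    then show "sw (cop a) (\<lambda>x' y'. f (x \<cdot> b' \<cdot> x') (y \<cdot> b \<cdot> y')) =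
        sw (cop a) (\<lambda>x' y'. f (x \<cdot> x') (y \<cdot> \<kappa> b' \<cdot> b \<cdot> y'))"
      using balD[OF g b', of x "y \<cdot> b"] by (simp add: mul_assoc)
  qed (use bal_add1[OF g] bal_add2[OF g] in \<open>simp_all add: add_mul\<close>)
  finally show ?thesis by simp
qed

lemma cop_\<kappa>_mul:
  assumes f: "bal f" and b: "b \<in> B"
  shows "sw (cop (\<kappa> b \<cdot> a)) f = sw (cop a) (\<lambda>x y. f (\<kappa> b \<cdot> x) y)"
proof -
  note g = bal_cop_mult[OF f, of a]
  have "sw (cop (\<kappa> b \<cdot> a)) f = sw (cop (\<one> \<cdot> \<kappa> b)) (\<lambda>x y. sw (cop a) (\<lambda>x' y'. f (x \<cdot> x') (y \<cdot> y')))"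
    using cop_mult[OF f, of "\<kappa> b" a] by simp
  also have "\<dots> = sw (cop \<one>) (\<lambda>x y. sw (cop a) (\<lambda>x' y'. f (x \<cdot> \<kappa> b \<cdot> x') (y \<cdot> y')))"
    by (rule cop_mul\<kappa>[OF g b])
  also have "\<dots> = sw (cop a) (\<lambda>x' y'. f (\<one> \<cdot> \<kappa> b \<cdot> x') (\<one> \<cdot> y'))"
  proof (rule cop_one, rule balI)
    fix b' x y assume b': "b' \<in> B"
    have "b' \<cdot> \<kappa> b = \<kappa> b \<cdot> b'"
      by (rule BC_comm[OF b' \<kappa>_in])
    then show "sw (cop a) (\<lambda>x' y'. f (x \<cdot> b' \<cdot> \<kappa> b \<cdot> x') (y \<cdot> y')) =
        sw (cop a) (\<lambda>x' y'. f (x \<cdot> \<kappa> b \<cdot> x') (y \<cdot> \<kappa> b' \<cdot> y'))"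
      using balD[OF g b', of "x \<cdot> \<kappa> b" "y"] by (simp add: mul_assoc)
  qed (use bal_add1[OF g] bal_add2[OF g] in \<open>simp_all add: add_mul\<close>)
  finally show ?thesis by simp
qed

lemma cop_sw: "bal f \<Longrightarrow> sw (cop (sw xs g)) f = sw xs (\<lambda>x y. sw (cop (g x y)) f)"
  by (rule sw_hom[where h = "\<lambda>a. sw (cop a) f"]) (rule cop_add)

end


text \<open>The left bialgebroid is read as a right one for the opposite product, with \<open>\<tau> = t\<^sub>L \<pi>\<^sub>L\<close> and \<open>Q = s\<^sub>L \<pi>\<^sub>L\<close>. To match,
  the pairs in \<open>cL a\<close> are \<open>(a\<^sub>(\<^sub>2\<^sub>), a\<^sub>(\<^sub>1\<^sub>))\<close>, in this order.\<close>

locale internal_hopf_algebroid = R: internal_right_bialgebroid mul one B C \<kappa> cR P + L: internal_right_bialgebroid "\<lambda>x y. mul y x" one C B \<tau> cL Q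
  for mul :: "'a::ab_group_add \<Rightarrow> 'a \<Rightarrow> 'a"  (infixl \<open>\<cdot>\<close> 70)
    and one :: 'a  (\<open>\<one>\<close>)
    and B C :: "'a set" and \<kappa> \<tau> :: "'a \<Rightarrow> 'a" and cR cL :: "'a \<Rightarrow> ('a \<times> 'a) list" and P Q :: "'a \<Rightarrow> 'a" +
  fixes S :: "'a \<Rightarrow> 'a"
  assumes S_add: "S (x + y) = S x + S y"
    and S_B: "b \<in> B \<Longrightarrow> S b \<in> C" and S_C: "c \<in> C \<Longrightarrow> S c \<in> B"
    and S_B_mul: "b \<in> B \<Longrightarrow> S (b \<cdot> x) = S x \<cdot> S b" and S_mul_B: "b \<in> B \<Longrightarrow> S (x \<cdot> b) = S b \<cdot> S x"
    and S_C_mul: "c \<in> C \<Longrightarrow> S (c \<cdot> x) = S x \<cdot> S c" and S_mul_C: "c \<in> C \<Longrightarrow> S (x \<cdot> c) = S c \<cdot> S x"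
    and S_\<kappa>: "b \<in> B \<Longrightarrow> S (\<kappa> b) = b" and \<kappa>_S: "c \<in> C \<Longrightarrow> \<kappa> (S c) = c"
    and S_\<tau>: "c \<in> C \<Longrightarrow> S (\<tau> c) = c" and \<tau>_S: "b \<in> B \<Longrightarrow> \<tau> (S b) = b"
    and antipode_L: "sw (cL a) (\<lambda>y x. S x \<cdot> y) = P a"
    and antipode_R: "sw (cR a) (\<lambda>x y. x \<cdot> S y) = Q a"
    and LR: "(\<And>z. L.bal (\<lambda>y x. F x y z)) \<Longrightarrow> (\<And>x. R.bal (F x)) \<Longrightarrow>
      sw (cR a) (\<lambda>p z. sw (cL p) (\<lambda>y x. F x y z)) = sw (cL a) (\<lambda>q x. sw (cR q) (F x))"
    and RL: "(\<And>z. R.bal (\<lambda>x y. F x y z)) \<Longrightarrow> (\<And>x. L.bal (\<lambda>z y. F x y z)) \<Longrightarrow>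
      sw (cL a) (\<lambda>z p. sw (cR p) (\<lambda>x y. F x y z)) = sw (cR a) (\<lambda>x q. sw (cL q) (\<lambda>z y. F x y z))"
begin

text \<open>The axioms of the two bialgebroids trade places. Each of the mixed laws
  \<open>LR\<close> and \<open>RL\<close> becomes itself, with the three tensor factors read
  backwards and the two sides exchanged.\<close>

lemma dual: "internal_hopf_algebroid (\<lambda>x y. y \<cdot> x) \<one> C B \<tau> \<kappa> cL cR Q P S"
proof unfold_locales
  show "sw (cL a) (\<lambda>p z. sw (cR p) (\<lambda>y x. F x y z)) = sw (cR a) (\<lambda>q x. sw (cL q) (F x))"
    if "\<And>z. R.bal (\<lambda>y x. F x y z)" "\<And>x. L.bal (F x)" for F a
    using LR[of "\<lambda>x y z. F z y x" a] that by simp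
  show "sw (cR a) (\<lambda>z p. sw (cL p) (\<lambda>x y. F x y z)) = sw (cL a) (\<lambda>x q. sw (cR q) (\<lambda>z y. F x y z))"
    if "\<And>z. L.bal (\<lambda>x y. F x y z)" "\<And>x. R.bal (\<lambda>z y. F x y z)" for F a
    using RL[of "\<lambda>x y z. F z y x" a] that by simp
qed (simp_all add: R.mul_assoc R.add_mul R.mul_add R.B_one R.B_diff R.B_mul R.BC_comm 
  R.\<kappa>_add R.P_add R.\<kappa>_in R.P_in R.\<kappa>_id R.P_id R.\<kappa>_P R.P_mulB R.P_mul\<kappa> R.\<kappa>_mulB R.\<kappa>_mulC R.P_P_mul R.P_\<kappa>_mul
  R.cop_add R.cop_mulB R.cop_mul\<kappa> R.takeuchi R.cop_one R.cop_mult R.coassoc R.counit1 R.counit2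
  S_add S_B S_C S_B_mul S_mul_B S_C_mul S_mul_C S_\<kappa> \<kappa>_S S_\<tau> \<tau>_S antipode_L antipode_R)

lemma C_image_\<kappa>: "c \<in> C \<Longrightarrow> \<exists>b\<in>B. c = \<kappa> b"
  using \<kappa>_S S_C by metis

lemma S_\<kappa>': "S (\<kappa> x) = P x"
  using S_\<kappa>[OF R.P_in, of x] by (simp add: R.\<kappa>_P)

lemma antipode_L_mul: "sw (cL a) (\<lambda>y x. S x \<cdot> (y \<cdot> w)) = P a \<cdot> w"
  and antipode_R_mul: "sw (cR a) (\<lambda>x y. x \<cdot> (S y \<cdot> w)) = Q a \<cdot> w"
  by (simp_all add: R.sw_mul R.mul_assoc flip: antipode_L antipode_R)

lemma S_sw: "S (sw xs f) = sw xs (\<lambda>x y. S (f x y))"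
  by (rule sw_hom) (rule S_add)

lemma bal_P_S: "R.bal (\<lambda>x y. P x \<cdot> S y)"
  by (rule R.balI) (simp_all add: R.mul_add R.add_mul R.P_add S_add S_mul_C R.\<kappa>_in S_\<kappa> R.P_mulB R.mul_assoc)

text \<open>This is \<open>S\<close> applied to the counit identity \<open>counit1\<close>, so it is
  available before \<open>S\<close> is known to reverse arbitrary products.\<close>

lemma P_S_sum: "sw (cR b) (\<lambda>x y. P x \<cdot> S y) = S b"
  using arg_cong[OF R.counit1[of b], of S] by (simp add: S_sw S_mul_C R.\<kappa>_in S_\<kappa>')

text \<open>Under \<open>P\<close> the factor \<open>b\<close> may be replaced by
  \<open>\<kappa> b\<close>, which belongs to the argument of the coproduct; then
  \<open>P_S_sum\<close> applies.\<close>

lemma P_mul_S_sum: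
  assumes "b \<in> B" shows "sw (cR a) (\<lambda>x y. P (b \<cdot> x) \<cdot> S y) = S a \<cdot> b"
proof -
  have "P (b \<cdot> x) = P (\<kappa> b \<cdot> x)" for x
    using R.P_\<kappa>_mul[of b x] by simp
  then have "sw (cR a) (\<lambda>x y. P (b \<cdot> x) \<cdot> S y) = sw (cR (\<kappa> b \<cdot> a)) (\<lambda>x y. P x \<cdot> S y)"
    by (simp add: R.cop_\<kappa>_mul[OF bal_P_S assms])
  then show ?thesis
    by (simp add: P_S_sum S_C_mul R.\<kappa>_in S_\<kappa> assms)
qed

end

section \<open>The antipode reverses products\<close>

context internal_hopf_algebroid
begin

interpretation D: internal_hopf_algebroid "\<lambda>x y. y \<cdot> x" \<one> C B \<tau> \<kappa> cL cR Q P S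
  by (rule dual)

text \<open>The sum of \<open>S(a\<^sup>(\<^sup>1\<^sup>)\<^sub>(\<^sub>1\<^sub>) b\<^sup>(\<^sup>1\<^sup>)\<^sub>(\<^sub>1\<^sub>)) a\<^sup>(\<^sup>1\<^sup>)\<^sub>(\<^sub>2\<^sub>) b\<^sup>(\<^sup>1\<^sup>)\<^sub>(\<^sub>2\<^sub>) S(b\<^sup>(\<^sup>2\<^sup>)) S(a\<^sup>(\<^sup>2\<^sup>))\<close>, evaluated in two ways.\<close>

lemma S_mul: "S (a \<cdot> b) = S b \<cdot> S a"
proof -
  let ?Z = "sw (cR a) (\<lambda>a1 a2. sw (cR b) (\<lambda>b1 b2. P (a1 \<cdot> b1) \<cdot> S b2 \<cdot> S a2))"
  have "?Z = sw (cR a) (\<lambda>a1 a2. sw (cR b) (\<lambda>b1 b2. P (P a1 \<cdot> b1) \<cdot> S b2) \<cdot> S a2)"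
    by (simp add: R.sw_mul R.P_P_mul)
  also have "\<dots> = S b \<cdot> sw (cR a) (\<lambda>a1 a2. P a1 \<cdot> S a2)"
    by (simp add: P_mul_S_sum R.P_in R.mul_sw R.mul_assoc)
  finally have 1: "?Z = S b \<cdot> S a"
    by (simp add: P_S_sum)
  have bal1: "L.bal (\<lambda>y x. S x \<cdot> y)"
    by (rule L.balI) (simp_all add: R.mul_add R.add_mul S_add S_B_mul L.\<kappa>_in S_\<tau> R.mul_assoc)
  \<comment> \<open>The antipode axiom for the product \<open>a1 \<cdot> b1\<close> reopens
    \<open>P\<close>; the second evaluation of the sum starts here.\<close>
  have P: "P (a1 \<cdot> b1) = sw (cL b1) (\<lambda>d2 d1. sw (cL a1) (\<lambda>c2 c1. S (c1 \<cdot> d1) \<cdot> (c2 \<cdot> d2)))" for a1 b1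
    using L.cop_mult[OF bal1, of a1 b1] by (simp add: antipode_L)
  \<comment> \<open>Mixed coassociativity in \<open>b\<close> regroups the legs so that
    \<open>antipode_R\<close> contracts two of them to \<open>Q q\<close>.\<close>
  have "sw (cR b) (\<lambda>b1 b2. P (a1 \<cdot> b1) \<cdot> S b2 \<cdot> S a2) =
    sw (cL b) (\<lambda>q x. sw (cL a1) (\<lambda>c2 c1. S (c1 \<cdot> x) \<cdot> c2 \<cdot> Q q \<cdot> S a2))" for a1 a2
  proof -
    let ?F = "\<lambda>x y z. sw (cL a1) (\<lambda>c2 c1. S (c1 \<cdot> x) \<cdot> (c2 \<cdot> y)) \<cdot> S z \<cdot> S a2"
    have "L.bal (\<lambda>y x. ?F x y z)" for z
      using L.bal_cop_mult[OF bal1, of a1] by (auto simp: balanced_def R.add_mul)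
    moreover have "R.bal (?F x)" for x
      by (rule R.balI) (simp_all add: R.mul_add R.add_mul S_add S_mul_C R.\<kappa>_in S_\<kappa> R.mul_assoc sw_add R.sw_mul)
    ultimately have "sw (cR b) (\<lambda>p z. sw (cL p) (\<lambda>y x. ?F x y z)) = sw (cL b) (\<lambda>q x. sw (cR q) (?F x))"
      by (rule LR)
    moreover have "sw (cR q) (?F x) = sw (cL a1) (\<lambda>c2 c1. S (c1 \<cdot> x) \<cdot> c2 \<cdot> Q q \<cdot> S a2)" for q x
      unfolding R.sw_mul
      by (subst sw_swap) (simp add: R.mul_assoc antipode_R_mul flip: R.mul_sw)
    ultimately show ?thesis
      by (simp add: P R.sw_mul R.mul_assoc)
  qed
  then have "?Z = sw (cL b) (\<lambda>q x. sw (cR a) (\<lambda>a1 a2. sw (cL a1) (\<lambda>c2 c1. S (c1 \<cdot> x) \<cdot> c2 \<cdot> Q q \<cdot> S a2)))"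
    by (simp add: sw_swap[of "cL b"])
  \<comment> \<open>The same regrouping in \<open>a\<close>. The factor \<open>Q q\<close> in
    between is harmless, since it lies in \<open>C\<close> and commutes with
    \<open>B\<close>.\<close>
  also have "\<dots> = sw (cL b) (\<lambda>q x. sw (cL a) (\<lambda>r c1. sw (cR r) (\<lambda>c2 a2. S (c1 \<cdot> x) \<cdot> c2 \<cdot> Q q \<cdot> S a2)))"
  proof -
    have "L.bal (\<lambda>y x'. S (x' \<cdot> x) \<cdot> y \<cdot> Q q \<cdot> S z)" for x q z
      by (rule L.balI) (simp_all add: R.mul_add R.add_mul S_add S_B_mul L.\<kappa>_in S_\<tau> R.mul_assoc)
    moreover have "R.bal (\<lambda>y z. S (x' \<cdot> x) \<cdot> y \<cdot> Q q \<cdot> S z)" for x' x q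
    proof (rule R.balI)
      fix b y z assume b: "b \<in> B"
      then have "b \<cdot> (Q q \<cdot> S z) = Q q \<cdot> (b \<cdot> S z)"
        using R.BC_comm[OF b L.P_in, of q] by (simp flip: R.mul_assoc)
      then show "S (x' \<cdot> x) \<cdot> (y \<cdot> b) \<cdot> Q q \<cdot> S z = S (x' \<cdot> x) \<cdot> y \<cdot> Q q \<cdot> S (z \<cdot> \<kappa> b)"
        by (simp add: S_mul_C R.\<kappa>_in S_\<kappa> b R.mul_assoc)
    qed (simp_all add: R.mul_add R.add_mul S_add)
    ultimately show ?thesis
      by (simp add: LR[where F = "\<lambda>x' y z. S (x' \<cdot> _) \<cdot> y \<cdot> Q _ \<cdot> S z"])
  qed
  also have "\<dots> = sw (cL b) (\<lambda>q x. sw (cL a) (\<lambda>r c1. S (c1 \<cdot> x) \<cdot> Q (r \<cdot> q)))"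
  proof -
    \<comment> \<open>\<open>Q q\<close> is \<open>\<kappa> b'\<close> for some \<open>b'\<close> in
      \<open>B\<close>, so it can be pulled into the argument of \<open>cR\<close>, where
      \<open>antipode_R\<close> applies.\<close>
    have "sw (cR r) (\<lambda>c2 a2. c2 \<cdot> Q q \<cdot> S a2) = Q (r \<cdot> q)" for r q
    proof -
      obtain b' where b': "b' \<in> B" "Q q = \<kappa> b'"
        using C_image_\<kappa>[OF L.P_in] by blast
      have "R.bal (\<lambda>x y. x \<cdot> S y)"
        by (rule R.balI) (simp_all add: R.mul_add R.add_mul S_add S_mul_C R.\<kappa>_in S_\<kappa> R.mul_assoc)
      from R.cop_mul\<kappa>[OF this b'(1), of r] have "sw (cR r) (\<lambda>c2 a2. c2 \<cdot> Q q \<cdot> S a2) = Q (r \<cdot> Q q)"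
        by (simp add: b'(2) antipode_R)
      then show ?thesis
        by (simp add: L.P_P_mul)
    qed
    then show ?thesis
      by (simp add: R.mul_assoc flip: R.mul_sw)
  qed
  also have "\<dots> = sw (cL (a \<cdot> b)) (\<lambda>y x. S x \<cdot> Q y)"
    by (subst L.cop_mult) (rule D.bal_P_S, rule refl)
  also have "\<dots> = S (a \<cdot> b)"
    by (rule D.P_S_sum)
  finally show ?thesis using 1 by simp
qed


lemma S_mul_\<kappa>: "b \<in> B \<Longrightarrow> S (x \<cdot> \<kappa> b) = b \<cdot> S x"
  by (simp add: S_mul S_\<kappa>)

lemma \<kappa>_eq_S\<tau>: "\<kappa> x \<cdot> S y = S (y \<cdot> \<tau> (\<kappa> x))"
  by (simp add: S_mul S_\<tau> R.\<kappa>_in)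

end

section \<open>The antipode reverses coproducts\<close>

locale balanced_hopf_algebroid = internal_hopf_algebroid +
  fixes g :: "'a::ab_group_add \<Rightarrow> 'a \<Rightarrow> 'a"
  assumes g: "R.bal g"
begin

lemmas g_add1 = R.bal_add1[OF g] and g_add2 = R.bal_add2[OF g] and g_B = R.balD[OF g]

lemma g_C: "c \<in> C \<Longrightarrow> g (x \<cdot> S c) y = g x (y \<cdot> c)"
  using g_B[OF S_C] by (simp add: \<kappa>_S)

text \<open>The value of \<open>g\<close> on \<open>p \<otimes> q\<close> times the flipped image of
  the left coproduct of \<open>x\<close> under \<open>S \<otimes> S\<close>. Testing with a fixed
  \<open>g\<close> replaces computations in the tensor product.\<close>

definition G :: "'a \<Rightarrow> 'a \<Rightarrow> 'a \<Rightarrow> 'a"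
  where "G p q x = sw (cL x) (\<lambda>x2 x1. g (p \<cdot> S x2) (q \<cdot> S x1))"

lemma bal_gS: "L.bal (\<lambda>x2 x1. g (p \<cdot> S x2) (q \<cdot> S x1))"
  by (rule L.balI)
    (simp_all add: R.mul_add R.add_mul S_add S_mul S_\<tau> g_add1 g_add2 g_C flip: R.mul_assoc)

lemma G_add1: "G (p + p') q x = G p q x + G p' q x" and G_add2: "G p (q + q') x = G p q x + G p q' x"
  by (simp_all add: G_def R.add_mul g_add1 g_add2 sw_add)

lemma G_add3: "G p q (x + x') = G p q x + G p q x'"
  unfolding G_def by (rule L.cop_add[OF bal_gS])

text \<open>The Takeuchi condition for \<open>cL\<close>, carried over by \<open>S\<close>.\<close>

lemma bal_G12: "R.bal (\<lambda>p q. G p q x)"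
proof (rule R.balI)
  fix b p q assume b: "b \<in> B"
  show "G (p \<cdot> b) q x = G p (q \<cdot> \<kappa> b) x"
    using L.takeuchi[OF bal_gS R.\<kappa>_in, of x p b q]
    by (simp add: G_def S_mul_\<kappa> b \<kappa>_eq_S\<tau> R.mul_assoc)
qed (fact G_add1 G_add2)+

lemma G_mul_B: "b \<in> B \<Longrightarrow> G p (q \<cdot> b) x = G p q (x \<cdot> \<kappa> b)"
  using L.cop_B_mul[OF bal_gS R.\<kappa>_in, of x b p q] by (simp add: G_def S_mul_\<kappa> R.mul_assoc)

lemma bal_G23: "R.bal (G p)"
  by (rule R.balI) (simp_all add: G_add2 G_add3 G_mul_B)

text \<open>\<open>RL\<close> regroups the legs so that \<open>x1 \<cdot> S y\<close> contracts to
  \<open>Q q\<close>. As an element of \<open>C\<close> this crosses to the first leg, where the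
  counit joins it with \<open>z\<close>.\<close>

lemma G_collapse: "sw (cR x) (\<lambda>x1 x2. G p (s \<cdot> x1) x2) = g (p \<cdot> S x) s"
proof -
  let ?F = "\<lambda>x1 y z. g (p \<cdot> S z) (s \<cdot> (x1 \<cdot> S y))"
  have "sw (cR x) (\<lambda>x1 x2. G p (s \<cdot> x1) x2) = sw (cR x) (\<lambda>x1 q. sw (cL q) (\<lambda>z y. ?F x1 y z))"
    by (simp add: G_def R.mul_assoc)
  also have "\<dots> = sw (cL x) (\<lambda>z q. sw (cR q) (\<lambda>x1 y. ?F x1 y z))"
  proof (rule RL[symmetric])
    show "R.bal (\<lambda>x y. ?F x y z)" for z
      by (rule R.balI) (simp_all add: R.mul_add R.add_mul S_add g_add2 S_mul_\<kappa> R.mul_assoc)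
    show "L.bal (\<lambda>z y. ?F x1 y z)" for x1
      using bal_gS[of p "s \<cdot> x1"] by (simp add: R.mul_assoc)
  qed
  also have "\<dots> = sw (cL x) (\<lambda>z q. g (p \<cdot> S (Q q \<cdot> z)) s)"
  proof -
    have "sw (cR q) (\<lambda>x1 y. g u (s \<cdot> (x1 \<cdot> S y))) = g u (s \<cdot> Q q)" for u q
      by (subst antipode_R[symmetric])
        (simp add: sw_hom[where h = "\<lambda>y. g u (s \<cdot> y)"] R.mul_add g_add2)
    then show ?thesis
      by (simp add: S_mul g_C L.P_in flip: R.mul_assoc)
  qed
  also have "\<dots> = g (p \<cdot> S (sw (cL x) (\<lambda>z q. Q q \<cdot> z))) s"
    by (rule sw_hom[where h = "\<lambda>y. g (p \<cdot> S y) s", symmetric])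
      (simp add: R.mul_add S_add g_add1)
  finally show ?thesis
    by (simp add: L.counit2)
qed

end

context internal_hopf_algebroid
begin

interpretation D: internal_hopf_algebroid "\<lambda>x y. y \<cdot> x" \<one> C B \<tau> \<kappa> cL cR Q P S
  by (rule dual)

text \<open>Both sides arise from \<open>\<gamma>\<^sub>R(S(a\<^sub>(\<^sub>1\<^sub>)) a\<^sub>(\<^sub>2\<^sub>)\<^sup>(\<^sup>1\<^sup>))\<close> times the flipped \<open>S \<otimes> S\<close> of \<open>\<gamma>\<^sub>L(a\<^sub>(\<^sub>2\<^sub>)\<^sup>(\<^sup>2\<^sup>))\<close>; the left factor of this product
  may be moved across the tensor only because the flipped \<open>S \<otimes> S\<close> satisfies the Takeuchi condition (\<open>bal_G12\<close>).\<close>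

lemma cop_S:
  assumes g: "R.bal g"
  shows "sw (cR (S a)) g = sw (cL a) (\<lambda>y x. g (S y) (S x))"
proof -
  interpret balanced_hopf_algebroid mul one B C \<kappa> \<tau> cR cL P Q S g
    by unfold_locales (rule g)
  \<comment> \<open>The value of \<open>g\<close> on the right coproduct of
    \<open>S u \<cdot> p\<close> times the tensor encoded by \<open>G\<close>. The two groupings of
    its legs under \<open>LR\<close> give the two sides of the claim.\<close>
  define K where "K u p x = sw (cR (S u \<cdot> p)) (\<lambda>s t. G s t x)" for u p x
  have "sw (cR a) (\<lambda>p z. sw (cL p) (\<lambda>y x. K x y z)) = sw (cL a) (\<lambda>q x. sw (cR q) (K x))"
  proof (rule LR)
    show "L.bal (\<lambda>y x. K x y z)" for z
      by (rule L.balI)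
        (simp_all add: K_def R.mul_add R.add_mul S_add R.cop_add[OF bal_G12] S_mul S_\<tau> R.mul_assoc)
    show "R.bal (K x)" for x
    proof (rule R.balI)
      show "K x (y \<cdot> b) z = K x y (z \<cdot> \<kappa> b)" if "b \<in> B" for b y z
        using R.cop_mulB[OF bal_G12 that, of "S x \<cdot> y" z] by (simp add: K_def G_mul_B that R.mul_assoc)
    qed (simp_all add: K_def R.mul_add R.cop_add[OF bal_G12] G_add3 sw_add)
  qed
  \<comment> \<open>In this grouping the antipode contracts \<open>S x \<cdot> y\<close> to
    \<open>P p\<close>, an element of \<open>B\<close>; its coproduct is explicit, and the counit
    restores \<open>a\<close>.\<close>
  also have "sw (cR a) (\<lambda>p z. sw (cL p) (\<lambda>y x. K x y z)) = sw (cL a) (\<lambda>y x. g (S y) (S x))"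
  proof -
    have "sw (cL p) (\<lambda>y x. K x y z) = G \<one> \<one> (z \<cdot> \<kappa> p)" for p z
    proof -
      have "sw (cL p) (\<lambda>y x. K x y z) = sw (cR (P p)) (\<lambda>s t. G s t z)"
        by (simp add: K_def antipode_L flip: R.cop_sw[OF bal_G12])
      also have "\<dots> = sw (cR \<one>) (\<lambda>s t. G s t (z \<cdot> \<kappa> (P p)))"
        using R.cop_mulB[OF bal_G12 R.P_in, of \<one> p z] by (simp add: G_mul_B R.P_in)
      also have "\<dots> = G \<one> \<one> (z \<cdot> \<kappa> p)"
        by (simp add: R.cop_one[OF bal_G12] R.\<kappa>_P)
      finally show ?thesis .
    qed
    moreover have "sw (cR a) (\<lambda>p z. G \<one> \<one> (z \<cdot> \<kappa> p)) = G \<one> \<one> a"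
      by (subst (2) R.counit1[symmetric]) (simp add: sw_hom[where h = "G \<one> \<one>"] G_add3)
    ultimately show ?thesis
      by (simp add: G_def)
  qed
  \<comment> \<open>In the other grouping, coassociativity and \<open>G_collapse\<close> remove
    \<open>G\<close> and leave the coproduct of \<open>S x \<cdot> Q q\<close>; these products sum
    to \<open>S a\<close>.\<close>
  also have "sw (cL a) (\<lambda>q x. sw (cR q) (K x)) = sw (cR (S a)) g"
  proof -
    have "sw (cR q) (K x) = sw (cR (S x \<cdot> Q q)) g" for q x
    proof -
      have "sw (cR q) (\<lambda>p z. sw (cR p) (\<lambda>y1 y2. G (s1 \<cdot> y1) (s2 \<cdot> y2) z)) = g (s1 \<cdot> Q q) s2" for s1 s2
      proof -
        have "sw (cR q) (\<lambda>p z. sw (cR p) (\<lambda>y1 y2. G (s1 \<cdot> y1) (s2 \<cdot> y2) z)) =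
          sw (cR q) (\<lambda>y1 p. sw (cR p) (\<lambda>y2 z. G (s1 \<cdot> y1) (s2 \<cdot> y2) z))"
        proof (rule R.coassoc)
          show "R.bal (\<lambda>x y. G (s1 \<cdot> x) (s2 \<cdot> y) z)" for z
            using bal_G12[of z] by (auto simp: balanced_def R.mul_add simp flip: R.mul_assoc)
          show "R.bal (\<lambda>y z. G (s1 \<cdot> x) (s2 \<cdot> y) z)" for x
            using bal_G23[of "s1 \<cdot> x"] by (auto simp: balanced_def R.mul_add simp flip: R.mul_assoc)
        qed
        also have "\<dots> = sw (cR q) (\<lambda>x y. g (s1 \<cdot> (x \<cdot> S y)) s2)"
          by (simp add: G_collapse R.mul_assoc)
        also have "\<dots> = g (s1 \<cdot> Q q) s2"
          by (subst antipode_R[symmetric])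
            (simp add: sw_hom[where h = "\<lambda>y. g (s1 \<cdot> y) s2"] R.mul_add g_add1)
        finally show ?thesis .
      qed
      then have "sw (cR q) (K x) = sw (cR (S x)) (\<lambda>s1 s2. g (s1 \<cdot> Q q) s2)"
        by (simp add: K_def[abs_def] R.cop_mult[OF bal_G12] sw_swap[of "cR q"])
      also have "\<dots> = sw (cR (S x \<cdot> Q q)) g"
        using R.cop_mul\<kappa>[OF g S_C[OF L.P_in], of "S x" q] by (simp add: \<kappa>_S L.P_in)
      finally show ?thesis .
    qed
    then show ?thesis
      by (simp add: D.P_S_sum flip: R.cop_sw[OF g])
  qed
  finally show ?thesis by simp
qed

end


section \<open>Frobenius systems and integrals\<close>

context base_ring
begin

definition right_linear :: "('a \<Rightarrow> 'a) \<Rightarrow> bool"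
  where "right_linear f \<longleftrightarrow> (\<forall>x y. f (x + y) = f x + f y) \<and> (\<forall>x. f x \<in> B) \<and>
    (\<forall>b\<in>B. \<forall>x. f (x \<cdot> b) = f x \<cdot> b)"

definition left_linear :: "('a \<Rightarrow> 'a) \<Rightarrow> bool"
  where "left_linear f \<longleftrightarrow> (\<forall>x y. f (x + y) = f x + f y) \<and> (\<forall>x. f x \<in> B) \<and>
    (\<forall>b\<in>B. \<forall>x. f (b \<cdot> x) = b \<cdot> f x)"

definition frobenius_system :: "('a \<Rightarrow> 'a) \<Rightarrow> ('a \<times> 'a) list \<Rightarrow> bool"
  where "frobenius_system \<psi> uv \<longleftrightarrow> right_linear \<psi> \<and> left_linear \<psi> \<and>
    (\<forall>a. sw uv (\<lambda>u v. \<psi> (a \<cdot> u) \<cdot> v) = a) \<and> (\<forall>a. sw uv (\<lambda>u v. u \<cdot> \<psi> (v \<cdot> a)) = a)"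

definition frobenius :: bool
  where "frobenius \<longleftrightarrow> (\<exists>\<psi> uv. frobenius_system \<psi> uv)"

definition right_dual_basis :: "('a \<times> ('a \<Rightarrow> 'a)) list \<Rightarrow> bool"
  where "right_dual_basis xg \<longleftrightarrow> (\<forall>p\<in>set xg. right_linear (snd p)) \<and> (\<forall>a. sw xg (\<lambda>x g. x \<cdot> g a) = a)"

definition left_dual_basis :: "('a \<times> ('a \<Rightarrow> 'a)) list \<Rightarrow> bool"
  where "left_dual_basis xg \<longleftrightarrow> (\<forall>p\<in>set xg. left_linear (snd p)) \<and> (\<forall>a. sw xg (\<lambda>x g. g a \<cdot> x) = a)"

lemma right_linearD:
  assumes "right_linear f"
  shows "f (x + y) = f x + f y" "f x \<in> B" "b \<in> B \<Longrightarrow> f (x \<cdot> b) = f x \<cdot> b"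
    "f 0 = 0" "f (x - y) = f x - f y" "f (sw xs g) = sw xs (\<lambda>u v. f (g u v))"
proof -
  show add: "f (x + y) = f x + f y" for x y
    using assms by (simp add: right_linear_def)
  show "f 0 = 0" "f (x - y) = f x - f y" "f (sw xs g) = sw xs (\<lambda>u v. f (g u v))"
    by (rule additive_0[of f] additive_diff[of f] sw_hom[of f], rule add)+
qed (use assms in \<open>auto simp: right_linear_def\<close>)

lemma left_linearD:
  assumes "left_linear f"
  shows "f (x + y) = f x + f y" "f x \<in> B" "b \<in> B \<Longrightarrow> f (b \<cdot> x) = b \<cdot> f x"
    "f 0 = 0" "f (x - y) = f x - f y" "f (sw xs g) = sw xs (\<lambda>u v. f (g u v))"
proof -
  show add: "f (x + y) = f x + f y" for x y
    using assms by (simp add: left_linear_def)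
  show "f 0 = 0" "f (x - y) = f x - f y" "f (sw xs g) = sw xs (\<lambda>u v. f (g u v))"
    by (rule additive_0[of f] additive_diff[of f] sw_hom[of f], rule add)+
qed (use assms in \<open>auto simp: left_linear_def\<close>)

lemma flip: "base_ring (\<lambda>x y. y \<cdot> x) \<one> B"
  by unfold_locales (simp_all add: mul_assoc add_mul mul_add B_one B_diff B_mul)

lemma frobenius_systemD:
  assumes "frobenius_system \<psi> uv"
  shows "right_linear \<psi>" "left_linear \<psi>"
    "sw uv (\<lambda>u v. \<psi> (a \<cdot> u) \<cdot> v) = a" "sw uv (\<lambda>u v. u \<cdot> \<psi> (v \<cdot> a)) = a"
  using assms by (auto simp: frobenius_system_def)

lemma frobenius_right_nondegenerate:
  assumes "frobenius_system \<psi> uv" and "\<And>a. \<psi> (a \<cdot> x) = \<psi> (a \<cdot> y)"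
  shows "x = y"
proof -
  have "x = sw uv (\<lambda>u v. u \<cdot> \<psi> (v \<cdot> x))"
    by (rule frobenius_systemD(4)[OF assms(1), symmetric])
  also have "\<dots> = sw uv (\<lambda>u v. u \<cdot> \<psi> (v \<cdot> y))"
    by (simp only: assms(2))
  also have "\<dots> = y"
    by (rule frobenius_systemD(4)[OF assms(1)])
  finally show ?thesis .
qed

lemma frobenius_left_nondegenerate:
  assumes "frobenius_system \<psi> uv" and "\<And>a. \<psi> (x \<cdot> a) = \<psi> (y \<cdot> a)"
  shows "x = y"
proof -
  have "x = sw uv (\<lambda>u v. \<psi> (x \<cdot> u) \<cdot> v)"
    by (rule frobenius_systemD(3)[OF assms(1), symmetric])
  also have "\<dots> = sw uv (\<lambda>u v. \<psi> (y \<cdot> u) \<cdot> v)"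
    by (simp only: assms(2))
  also have "\<dots> = y"
    by (rule frobenius_systemD(3)[OF assms(1)])
  finally show ?thesis .
qed

text \<open>The first expansion of the system gives injectivity. By the second, a right linear
  \<open>f\<close> is represented by the sum of \<open>f u \<cdot> v\<close>.\<close>

lemma frobenius_bij:
  assumes "frobenius_system \<psi> uv"
  shows "bij_betw (\<lambda>a b. \<psi> (a \<cdot> b)) UNIV {f. right_linear f}"
proof (rule bij_betwI')
  note \<psi> = frobenius_systemD[OF assms]
  show "((\<lambda>b. \<psi> (x \<cdot> b)) = (\<lambda>b. \<psi> (y \<cdot> b))) = (x = y)" for x y
    using frobenius_left_nondegenerate[OF assms] by (auto dest: fun_cong)
  show "(\<lambda>b. \<psi> (x \<cdot> b)) \<in> {f. right_linear f}" for x
    using right_linearD[OF \<psi>(1)] by (simp add: right_linear_def mul_add flip: mul_assoc)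
  show "\<exists>x\<in>UNIV. f = (\<lambda>b. \<psi> (x \<cdot> b))" if "f \<in> {f. right_linear f}" for f
  proof -
    have f: "right_linear f" using that by simp
    have "f b = \<psi> (sw uv (\<lambda>u v. f u \<cdot> v) \<cdot> b)" for b
    proof -
      have "f b = f (sw uv (\<lambda>u v. u \<cdot> \<psi> (v \<cdot> b)))"
        by (simp add: \<psi>(4))
      then show ?thesis
        by (simp add: right_linearD[OF f] right_linearD[OF \<psi>(1)] left_linearD[OF \<psi>(2)] sw_mul mul_assoc)
    qed
    then show ?thesis by blast
  qed
qed

text \<open>The functionals of the dual basis have representatives \<open>w g\<close>, and these
  become the second legs. The other expansion follows by testing both sides with
  \<open>\<psi> (- \<cdot> z)\<close>.\<close>

lemma frobenius_systemI:
  assumes r: "right_linear \<psi>" and l: "left_linear \<psi>"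
    and bij: "bij_betw (\<lambda>a b. \<psi> (a \<cdot> b)) UNIV {f. right_linear f}"
    and xg: "right_dual_basis xg"
  shows "\<exists>uv. frobenius_system \<psi> uv"
proof -
  define w where "w = inv_into UNIV (\<lambda>a b. \<psi> (a \<cdot> b))"
  have w: "\<psi> (w g \<cdot> b) = g b" if "right_linear g" for g b
    using bij_betw_inv_into_right[OF bij, of g] that by (auto simp: w_def dest: fun_cong)
  define uv where "uv = map (\<lambda>(x, g). (x, w g)) xg"
  have sw_uv: "sw uv h = sw xg (\<lambda>x g. h x (w g))" for h :: "'a \<Rightarrow> 'a \<Rightarrow> 'a"
    by (simp add: uv_def sw_def comp_def split_def)
  have 1: "sw uv (\<lambda>u v. u \<cdot> \<psi> (v \<cdot> a)) = a" for a
  proof -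
    have "sw uv (\<lambda>u v. u \<cdot> \<psi> (v \<cdot> a)) = sw xg (\<lambda>x g. x \<cdot> g a)"
      unfolding sw_uv using xg w by (intro sw_cong) (auto simp: right_dual_basis_def)
    then show ?thesis using xg by (simp add: right_dual_basis_def)
  qed
  have 2: "sw uv (\<lambda>u v. \<psi> (a \<cdot> u) \<cdot> v) = a" for a
  proof -
    have "\<psi> (sw uv (\<lambda>u v. \<psi> (a \<cdot> u) \<cdot> v) \<cdot> z) = \<psi> (a \<cdot> z)" for z
    proof -
      have "\<psi> (a \<cdot> (u \<cdot> \<psi> v)) = \<psi> (a \<cdot> u) \<cdot> \<psi> v" for u v
        using right_linearD(2,3)[OF r] by (simp flip: mul_assoc)
      then have "\<psi> (sw uv (\<lambda>u v. \<psi> (a \<cdot> u) \<cdot> v) \<cdot> z) = \<psi> (a \<cdot> sw uv (\<lambda>u v. u \<cdot> \<psi> (v \<cdot> z)))"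
        by (simp add: right_linearD[OF r] left_linearD[OF l] sw_mul mul_sw mul_assoc)
      then show ?thesis by (simp add: 1)
    qed
    then show ?thesis
      by (intro injD[OF bij_betw_imp_inj_on[OF bij]]) (simp add: fun_eq_iff)
  qed
  show ?thesis
    using r l 1 2 by (auto simp: frobenius_system_def)
qed

lemma frobenius_dual_basis:
  assumes "frobenius_system \<psi> uv"
  shows "\<exists>xg. right_dual_basis xg"
proof
  note \<psi> = frobenius_systemD[OF assms]
  show "right_dual_basis (map (\<lambda>(u, v). (u, \<lambda>a. \<psi> (v \<cdot> a))) uv)"
    unfolding right_dual_basis_def
  proof (intro conjI ballI allI)
    show "right_linear (snd p)" if p: "p \<in> set (map (\<lambda>(u, v). (u, \<lambda>a. \<psi> (v \<cdot> a))) uv)" for p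
      using p right_linearD[OF \<psi>(1)] by (auto simp: right_linear_def mul_add simp flip: mul_assoc)
    show "sw (map (\<lambda>(u, v). (u, \<lambda>a. \<psi> (v \<cdot> a))) uv) (\<lambda>x g. x \<cdot> g a) = a" for a
      using \<psi>(4)[of a] by (simp add: sw_def comp_def split_def)
  qed
qed

text \<open>Mirror image of the surjectivity in \<open>frobenius_bij\<close>; the representing
  element is the sum of \<open>u \<cdot> q v\<close>.\<close>

lemma frobenius_represents:
  assumes \<psi>: "frobenius_system \<psi> uv" and q: "left_linear q"
  shows "\<exists>l. \<forall>a. \<psi> (a \<cdot> l) = q a"
proof (intro exI allI)
  note \<psi>' = frobenius_systemD[OF \<psi>]
  show "\<psi> (a \<cdot> sw uv (\<lambda>u v. u \<cdot> q v)) = q a" for a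
  proof -
    have "\<psi> (a \<cdot> sw uv (\<lambda>u v. u \<cdot> q v)) = q (sw uv (\<lambda>u v. \<psi> (a \<cdot> u) \<cdot> v))"
      by (simp add: mul_sw right_linearD[OF \<psi>'(1)] left_linearD[OF q] flip: mul_assoc)
    then show ?thesis by (simp add: \<psi>')
  qed
qed

lemma frobenius_system_flip:
  "base_ring.frobenius_system (\<lambda>x y. y \<cdot> x) B \<psi> (map prod.swap uv) = frobenius_system \<psi> uv"
proof -
  interpret F: base_ring "\<lambda>x y. y \<cdot> x" \<one> B
    by (rule flip)
  have "F.right_linear = left_linear" "F.left_linear = right_linear"
    by (simp_all add: fun_eq_iff F.right_linear_def F.left_linear_def right_linear_def left_linear_def)
  moreover have "sw (map prod.swap uv) f = sw uv (\<lambda>u v. f v u)" for f :: "'a \<Rightarrow> 'a \<Rightarrow> 'a"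
    by (simp add: sw_def comp_def)
  ultimately show ?thesis
    by (auto simp: F.frobenius_system_def frobenius_system_def)
qed

lemma frobenius_flip: "base_ring.frobenius (\<lambda>x y. y \<cdot> x) B = frobenius"
proof -
  interpret F: base_ring "\<lambda>x y. y \<cdot> x" \<one> B
    by (rule flip)
  show ?thesis
    unfolding F.frobenius_def frobenius_def
    using frobenius_system_flip F.frobenius_system_flip by blast
qed

end

section \<open>Integrals, convolutions and the antipode\<close>

context internal_hopf_algebroid
begin

interpretation D: internal_hopf_algebroid "\<lambda>x y. y \<cdot> x" \<one> C B \<tau> \<kappa> cL cR Q P S
  by (rule dual)

definition left_integral :: "'a \<Rightarrow> bool"
  where "left_integral l \<longleftrightarrow> (\<forall>a. a \<cdot> l = Q a \<cdot> l)"

text \<open>The duals \<open>\<A>\<^sup>*\<close>, \<open>\<^sup>*\<A>\<close>, \<open>\<^sub>*\<A>\<close> and \<open>\<A>\<^sub>*\<close>, composed with the embeddings of the base algebras, are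
  \<open>R.right_linear\<close>, \<open>L.left_linear\<close>, \<open>L.right_linear\<close> and \<open>R.left_linear\<close>.\<close>

definition right_conv :: "('a \<Rightarrow> 'a) \<Rightarrow> 'a \<Rightarrow> 'a"
  where "right_conv f a = sw (cR a) (\<lambda>x y. y \<cdot> \<kappa> (f x))"

text \<open>On \<open>C\<close> the antipode is \<open>t\<^sub>R(r) \<mapsto> s\<^sub>R(r)\<close>,
  so \<open>S (\<chi> y)\<close> is the value of the functional embedded by \<open>s\<^sub>R\<close>
  instead of \<open>t\<^sub>R\<close>.\<close>

definition left_conv :: "('a \<Rightarrow> 'a) \<Rightarrow> 'a \<Rightarrow> 'a"
  where "left_conv \<chi> a = sw (cR a) (\<lambda>x y. x \<cdot> S (\<chi> y))"

definition right_dual_integral :: "('a \<Rightarrow> 'a) \<Rightarrow> bool"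
  where "right_dual_integral f \<longleftrightarrow> R.right_linear f \<and> (\<forall>a. right_conv f a = f a)"

definition left_dual_integral :: "('a \<Rightarrow> 'a) \<Rightarrow> bool"
  where "left_dual_integral \<chi> \<longleftrightarrow> L.left_linear \<chi> \<and> (\<forall>a. left_conv \<chi> a = \<chi> a)"

lemma \<tau>_mul_integral: "left_integral l \<Longrightarrow> \<tau> a \<cdot> l = a \<cdot> l"
  unfolding left_integral_def by (metis L.P_\<kappa>)

lemma bal_right_conv: "R.right_linear f \<Longrightarrow> R.bal (\<lambda>x y. y \<cdot> \<kappa> (f x))"
  by (rule R.balI) (simp_all add: R.add_mul R.mul_add R.right_linearD R.\<kappa>_add R.\<kappa>_mulB R.mul_assoc)

lemma bal_left_conv: "L.left_linear \<chi> \<Longrightarrow> R.bal (\<lambda>x y. x \<cdot> S (\<chi> y))"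
  by (rule R.balI) (simp_all add: R.add_mul R.mul_add L.left_linearD R.\<kappa>_in S_add S_mul S_\<kappa> R.mul_assoc)

lemma right_conv_add: "R.right_linear f \<Longrightarrow> right_conv f (a + a') = right_conv f a + right_conv f a'"
  unfolding right_conv_def by (rule R.cop_add) (rule bal_right_conv)

lemma right_conv_B: "R.right_linear f \<Longrightarrow> b \<in> B \<Longrightarrow> right_conv f (a \<cdot> b) = right_conv f a \<cdot> b"
  unfolding right_conv_def
  by (simp add: R.cop_mulB[OF bal_right_conv] R.sw_mul R.mul_assoc R.BC_comm[OF _ R.\<kappa>_in])

lemma right_conv_B_mul: "R.right_linear f \<Longrightarrow> b \<in> B \<Longrightarrow> right_conv f (b \<cdot> a) = b \<cdot> right_conv f a"
  unfolding right_conv_def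
  by (simp add: R.cop_B_mul[OF bal_right_conv] R.mul_sw R.mul_assoc)

text \<open>\<open>LR\<close> regroups the legs so that \<open>S x \<cdot> y\<close> contracts to
  \<open>P p\<close>. The Takeuchi condition carries this to the second leg as
  \<open>\<kappa> p\<close>, where the counit restores \<open>a\<close>.\<close>

lemma cop_right_mul:
  assumes f: "R.bal f"
  shows "sw (cR b) (\<lambda>x y. f x (a \<cdot> y)) = sw (cL a) (\<lambda>q x. sw (cR (q \<cdot> b)) (\<lambda>u v. f (S x \<cdot> u) v))"
proof -
  let ?K = "\<lambda>x y z. sw (cR b) (\<lambda>b1 b2. f (S x \<cdot> (y \<cdot> b1)) (z \<cdot> b2))"
  note f' = R.bal_add1[OF f] R.bal_add2[OF f] R.balD[OF f]
  have bal: "R.bal (\<lambda>u v. f (S x \<cdot> u) v)" for x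
    by (rule R.balI) (simp_all add: R.mul_add f' flip: R.mul_assoc)
  have "sw (cR a) (\<lambda>p z. sw (cL p) (\<lambda>y x. ?K x y z)) = sw (cL a) (\<lambda>q x. sw (cR q) (?K x))"
  proof (rule LR)
    show "L.bal (\<lambda>y x. ?K x y z)" for z
      by (rule L.balI) (simp_all add: R.mul_add R.add_mul f' sw_add S_add S_mul S_\<tau> R.mul_assoc)
    show "R.bal (?K x)" for x
      by (rule R.bal_cop_mult[OF bal])
  qed
  moreover have "sw (cL p) (\<lambda>y x. ?K x y z) = sw (cR b) (\<lambda>b1 b2. f b1 (z \<cdot> \<kappa> p \<cdot> b2))" for p z
  proof -
    have "sw (cL p) (\<lambda>y x. f (S x \<cdot> (y \<cdot> b1)) w) = f (P p \<cdot> b1) w" for b1 w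
      by (simp add: antipode_L_mul f' flip: sw_hom[where h = "\<lambda>u. f u w"])
    moreover have "R.bal (\<lambda>u v. f u (z \<cdot> v))"
      by (rule R.balI) (simp_all add: R.mul_add f' flip: R.mul_assoc)
    from R.takeuchi[OF this R.P_in, of b p]
    have "sw (cR b) (\<lambda>b1 b2. f (P p \<cdot> b1) (z \<cdot> b2)) = sw (cR b) (\<lambda>b1 b2. f b1 (z \<cdot> \<kappa> p \<cdot> b2))"
      by (simp add: R.\<kappa>_P R.mul_assoc)
    ultimately show ?thesis
      by (simp add: sw_swap[of "cL p"])
  qed
  moreover have "sw (cR a) (\<lambda>p z. sw (cR b) (\<lambda>b1 b2. f b1 (z \<cdot> \<kappa> p \<cdot> b2))) = sw (cR b) (\<lambda>x y. f x (a \<cdot> y))"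
  proof -
    have "sw (cR b) (\<lambda>x y. f x (sw (cR a) (\<lambda>p z. z \<cdot> \<kappa> p) \<cdot> y)) =
      sw (cR a) (\<lambda>p z. sw (cR b) (\<lambda>b1 b2. f b1 (z \<cdot> \<kappa> p \<cdot> b2)))"
      by (simp add: R.sw_mul sw_hom[where h = "f _"] f' sw_swap[of "cR b" "cR a"])
    then show ?thesis
      by (simp add: R.counit1)
  qed
  ultimately show ?thesis
    by (simp add: R.cop_mult[OF bal])
qed

text \<open>Mirror image of \<open>cop_right_mul\<close>, with \<open>RL\<close> in place of
  \<open>LR\<close>. Since \<open>S\<close> is applied to the second leg, the test functions are
  balanced for \<open>A \<otimes>\<^sub>B A\<close>.\<close>

lemma cop_left_mul:
  assumes f: "balanced (\<lambda>b x. x \<cdot> b) (\<lambda>b x. b \<cdot> x) B (f :: 'a \<Rightarrow> 'a \<Rightarrow> 'a)"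
  shows "sw (cR b) (\<lambda>x y. f (a \<cdot> x) (S y)) = sw (cL a) (\<lambda>z p. sw (cR (p \<cdot> b)) (\<lambda>u v. f u (S v \<cdot> z)))"
proof -
  let ?K = "\<lambda>x y z. sw (cR b) (\<lambda>b1 b2. f (x \<cdot> b1) (S (y \<cdot> b2) \<cdot> z))"
  have f': "f (x + x') y = f x y + f x' y" "f x (y + y') = f x y + f x y'" "b \<in> B \<Longrightarrow> f (x \<cdot> b) y = f x (b \<cdot> y)"
    for b x x' y y' using f by (auto simp: balanced_def)
  have bal: "R.bal (\<lambda>u v. f u (S v \<cdot> z))" for z
    by (rule R.balI) (simp_all add: R.add_mul f' S_add S_mul_\<kappa> R.mul_assoc)
  have "sw (cL a) (\<lambda>z p. sw (cR p) (\<lambda>x y. ?K x y z)) = sw (cR a) (\<lambda>x q. sw (cL q) (\<lambda>z y. ?K x y z))"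
  proof (rule RL)
    show "R.bal (\<lambda>x y. ?K x y z)" for z
      by (rule R.bal_cop_mult[OF bal])
    show "L.bal (\<lambda>z y. ?K x y z)" for x
      by (rule L.balI) (simp_all add: R.mul_add R.add_mul f' sw_add S_add S_mul S_\<tau> R.mul_assoc)
  qed
  moreover have "sw (cL q) (\<lambda>z y. ?K x y z) = sw (cR b) (\<lambda>b1 b2. f (x \<cdot> P q \<cdot> b1) (S b2))" for q x
  proof -
    have "sw (cL q) (\<lambda>z y. f w (S (y \<cdot> b2) \<cdot> z)) = f w (S (\<kappa> q \<cdot> b2))" for w b2
      using sw_hom[where h = "\<lambda>u. f w (S b2 \<cdot> u)" and f = "\<lambda>z y. S y \<cdot> z", of "cL q", symmetric]
      by (simp add: antipode_L S_mul S_\<kappa>' f' R.mul_add R.mul_assoc)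
    moreover have "R.bal (\<lambda>u v. f (x \<cdot> u) (S v))"
      using bal[of \<one>] by (auto simp: balanced_def R.mul_add simp flip: R.mul_assoc)
    from R.takeuchi[OF this R.P_in, of b q]
    have "sw (cR b) (\<lambda>b1 b2. f (x \<cdot> b1) (S (\<kappa> q \<cdot> b2))) = sw (cR b) (\<lambda>b1 b2. f (x \<cdot> P q \<cdot> b1) (S b2))"
      by (simp add: R.\<kappa>_P R.mul_assoc)
    ultimately show ?thesis
      by (simp add: sw_swap[of "cL q"])
  qed
  moreover have "sw (cR a) (\<lambda>x q. sw (cR b) (\<lambda>b1 b2. f (x \<cdot> P q \<cdot> b1) (S b2))) = sw (cR b) (\<lambda>x y. f (a \<cdot> x) (S y))"
  proof -
    have "sw (cR b) (\<lambda>x y. f (sw (cR a) (\<lambda>x q. x \<cdot> P q) \<cdot> x) (S y)) =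
      sw (cR a) (\<lambda>x q. sw (cR b) (\<lambda>b1 b2. f (x \<cdot> P q \<cdot> b1) (S b2)))"
      by (simp add: R.sw_mul sw_hom[where h = "\<lambda>x. f x _"] f' sw_swap[of "cR b" "cR a"])
    then show ?thesis
      by (simp add: R.counit2)
  qed
  ultimately show ?thesis
    by (simp add: R.cop_mult[OF bal])
qed

text \<open>For an integral, \<open>q \<cdot> l\<close> in \<open>cop_right_mul\<close> equals
  \<open>Q q \<cdot> l\<close>, and the factor from \<open>C\<close> leaves the coproduct; the
  remaining sum of \<open>S x \<cdot> Q q\<close> is \<open>S a\<close>.\<close>

lemma cop_integral_right:
  assumes l: "left_integral l" and f: "R.bal f"
  shows "sw (cR l) (\<lambda>x y. f x (a \<cdot> y)) = sw (cR l) (\<lambda>x y. f (S a \<cdot> x) y)"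
proof -
  note f' = R.bal_add1[OF f] R.bal_add2[OF f] R.balD[OF f]
  have bal: "R.bal (\<lambda>u v. f (S x \<cdot> u) v)" for x
    by (rule R.balI) (simp_all add: R.mul_add f' flip: R.mul_assoc)
  have "sw (cR (q \<cdot> l)) (\<lambda>u v. f (S x \<cdot> u) v) = sw (cR l) (\<lambda>u v. f (S x \<cdot> Q q \<cdot> u) v)" for q x
  proof -
    have "q \<cdot> l = \<kappa> (S (Q q)) \<cdot> l"
      using l by (simp add: left_integral_def \<kappa>_S L.P_in)
    then show ?thesis
      by (simp add: R.cop_\<kappa>_mul[OF bal] S_C L.P_in) (simp add: \<kappa>_S L.P_in R.mul_assoc)
  qed
  then have "sw (cR l) (\<lambda>x y. f x (a \<cdot> y)) = sw (cR l) (\<lambda>u v. f (sw (cL a) (\<lambda>q x. S x \<cdot> Q q) \<cdot> u) v)"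
    unfolding cop_right_mul[OF f] by (simp add: sw_swap[of "cL a"] R.sw_mul sw_hom[where h = "\<lambda>x. f x _"] f')
  then show ?thesis
    by (simp add: D.P_S_sum)
qed

text \<open>In \<open>cop_left_mul\<close> the product \<open>p \<cdot> l\<close> equals
  \<open>\<tau> p \<cdot> l\<close>; the factor from \<open>B\<close> enters the second leg and
  becomes \<open>Q p\<close> under \<open>S\<close>. Thus the legs \<open>x\<close> and
  \<open>S y\<close> form a Casimir element of \<open>A \<otimes>\<^sub>B A\<close>.\<close>

lemma cop_integral_left:
  assumes l: "left_integral l" and f: "balanced (\<lambda>b x. x \<cdot> b) (\<lambda>b x. b \<cdot> x) B (f :: 'a \<Rightarrow> 'a \<Rightarrow> 'a)"
  shows "sw (cR l) (\<lambda>x y. f (a \<cdot> x) (S y)) = sw (cR l) (\<lambda>x y. f x (S y \<cdot> a))"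
proof -
  have f': "f (x + x') y = f x y + f x' y" "f x (y + y') = f x y + f x y'" "b \<in> B \<Longrightarrow> f (x \<cdot> b) y = f x (b \<cdot> y)"
    for b x x' y y' using f by (auto simp: balanced_def)
  have bal: "R.bal (\<lambda>u v. f u (S v \<cdot> z))" for z
    by (rule R.balI) (simp_all add: R.add_mul f' S_add S_mul_\<kappa> R.mul_assoc)
  have "sw (cR (p \<cdot> l)) (\<lambda>u v. f u (S v \<cdot> z)) = sw (cR l) (\<lambda>u v. f u (S v \<cdot> (Q p \<cdot> z)))" for p z
    using R.cop_B_mul[OF bal L.\<kappa>_in, of p l]
    by (simp add: \<tau>_mul_integral[OF l] S_mul D.S_\<kappa>' R.mul_assoc)
  then have "sw (cR l) (\<lambda>x y. f (a \<cdot> x) (S y)) = sw (cR l) (\<lambda>u v. f u (S v \<cdot> sw (cL a) (\<lambda>z p. Q p \<cdot> z)))"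
    unfolding cop_left_mul[OF f] by (simp add: sw_swap[of "cL a"] R.mul_sw sw_hom[where h = "f _"] f')
  then show ?thesis
    by (simp add: L.counit2)
qed

text \<open>Left linearity holds because convolution with \<open>f\<close> commutes with left
  multiplication by \<open>B\<close>, and an integral agrees with its own convolution.\<close>

lemma right_dual_integralD:
  assumes "right_dual_integral f"
  shows "R.right_linear f" "R.left_linear f" "right_conv f a = f a"
proof -
  show f: "R.right_linear f" and c: "right_conv f a = f a" for a
    using assms by (auto simp: right_dual_integral_def)
  show "R.left_linear f"
    using right_conv_B_mul[OF f] by (simp add: R.left_linear_def c R.right_linearD[OF f])
qed

lemma balanced_mul_left:
  assumes "R.right_linear f"
  shows "balanced (\<lambda>b x. x \<cdot> b) (\<lambda>b x. b \<cdot> x) B (\<lambda>x y. f x \<cdot> y)"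
  by (simp add: balanced_def R.right_linearD[OF assms] R.add_mul R.mul_add R.mul_assoc)

text \<open>\<open>S\<close> applied to the integral property of \<open>f\<close> turns the
  right-hand side into the sum that \<open>cop_left_mul\<close> produces.\<close>

lemma dual_integral_transfer:
  assumes f: "right_dual_integral f"
  shows "sw (cR b) (\<lambda>x y. f (a \<cdot> x) \<cdot> S y) = sw (cL a) (\<lambda>y x. S (f (x \<cdot> b)) \<cdot> y)"
proof -
  note f' = right_dual_integralD[OF f]
  have "S (f p) \<cdot> z = sw (cR p) (\<lambda>u v. f u \<cdot> (S v \<cdot> z))" for p z
    by (subst f'(3)[symmetric])
      (simp add: right_conv_def S_sw S_mul S_\<kappa> R.right_linearD[OF f'(1)] R.sw_mul R.mul_assoc)
  then show ?thesis
    unfolding cop_left_mul[OF balanced_mul_left[OF f'(1)]] by simp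
qed

text \<open>The integral property is inserted into the left counit identity, and \<open>RL\<close>
  regroups the legs so that the convolution can be undone inside. Hence an integral of
  \<open>\<A>\<^sup>*\<close> is also an integral of \<open>\<A>\<^sub>*\<close> when read over the
  left bialgebroid.\<close>

lemma dual_integral_left_cop:
  assumes f: "right_dual_integral f"
  shows "sw (cL b) (\<lambda>y x. S (f x) \<cdot> y) = f b"
proof -
  note f' = right_dual_integralD[OF f]
  note fl = R.right_linearD[OF f'(1)]
  let ?g = "\<lambda>z p. Q p \<cdot> z"
  have g: "L.bal ?g"
    by (rule L.balI) (simp_all add: R.add_mul R.mul_add L.P_add L.P_mul\<kappa> R.mul_assoc)
  have "f b = sw (cL (sw (cR b) (\<lambda>x y. y \<cdot> \<kappa> (f x)))) ?g"
    by (simp add: L.counit2 f'(3) flip: right_conv_def)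
  also have "\<dots> = sw (cR b) (\<lambda>x q. sw (cL q) (\<lambda>z y. ?g z (y \<cdot> \<kappa> (f x))))"
    by (simp add: L.cop_sw[OF g] L.cop_B_mul[OF g] R.\<kappa>_in)
  also have "\<dots> = sw (cL b) (\<lambda>z p. sw (cR p) (\<lambda>x y. ?g z (y \<cdot> \<kappa> (f x))))"
  proof (rule RL[symmetric])
    show "R.bal (\<lambda>x y. ?g z (y \<cdot> \<kappa> (f x)))" for z
      by (rule R.balI) (simp_all add: R.add_mul R.mul_add L.P_add fl R.\<kappa>_add R.\<kappa>_mulB R.mul_assoc)
    show "L.bal (\<lambda>z y. ?g z (y \<cdot> \<kappa> (f x)))" for x
      by (rule L.balI)
        (simp_all add: R.add_mul R.mul_add L.P_add L.P_mul\<kappa> R.mul_assoc)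
  qed
  also have "\<dots> = sw (cL b) (\<lambda>z p. Q (right_conv f p) \<cdot> z)"
    by (simp add: right_conv_def sw_hom[where h = Q] L.P_add R.sw_mul)
  also have "\<dots> = sw (cL b) (\<lambda>y x. S (f x) \<cdot> y)"
    by (simp add: f'(3) L.\<kappa>_id fl flip: D.S_\<kappa>')
  finally show ?thesis by simp
qed

text \<open>Applying \<open>S\<close> to the integral property and using \<open>cop_S\<close> for
  the dual, one arrives at \<open>dual_integral_left_cop\<close> for \<open>S a\<close>; injectivity
  of \<open>S\<close> leads back.\<close>

lemma left_dual_integral_S:
  assumes f: "right_dual_integral f" and inj: "inj S"
  shows "left_dual_integral (\<lambda>a. \<kappa> (f (S a)))"
  unfolding left_dual_integral_def
proof (intro conjI allI)
  note f' = right_dual_integralD[OF f]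
  note fl = R.right_linearD[OF f'(1)] R.left_linearD[OF f'(2)]
  show lin: "L.left_linear (\<lambda>a. \<kappa> (f (S a)))"
    by (simp add: L.left_linear_def S_add fl R.\<kappa>_add R.\<kappa>_in S_mul S_C R.\<kappa>_mulB R.\<kappa>_mulC
        R.\<kappa>_mulB[OF fl(2)] \<kappa>_S)
  have bal: "L.bal (\<lambda>y x. S (f x) \<cdot> y)"
    by (rule L.balI) (simp_all add: R.add_mul R.mul_add S_add fl S_mul S_\<tau> L.\<kappa>_in R.mul_assoc)
  show "left_conv (\<lambda>a. \<kappa> (f (S a))) a = \<kappa> (f (S a))" for a
  proof -
    have "S (left_conv (\<lambda>a. \<kappa> (f (S a))) a) = sw (cR a) (\<lambda>x y. S (f (S y)) \<cdot> S x)"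
      by (simp add: left_conv_def S_sw S_mul S_\<kappa> fl)
    also have "\<dots> = f (S a)"
      using D.cop_S[OF bal, of a] by (simp add: dual_integral_left_cop[OF f])
    also have "\<dots> = S (\<kappa> (f (S a)))"
      by (simp add: S_\<kappa> fl)
    finally show ?thesis
      using inj by (auto dest: injD)
  qed
qed

text \<open>The normalisation gives \<open>f (x \<cdot> l) = \<tau> x\<close>, which turns the
  transferred sum into the left counit identity for \<open>a\<close>.\<close>

lemma integral_pair_1:
  assumes f: "right_dual_integral f" and l: "left_integral l" and fl: "f l = \<one>"
  shows "sw (cR l) (\<lambda>x y. f (a \<cdot> x) \<cdot> S y) = a"
proof -
  have "f (x \<cdot> l) = \<tau> x" for x
  proof -
    have "f (x \<cdot> l) = f (\<tau> x \<cdot> l)"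
      by (simp only: \<tau>_mul_integral[OF l])
    also have "\<dots> = \<tau> x \<cdot> f l"
      by (rule R.left_linearD(3)[OF right_dual_integralD(2)[OF f] L.\<kappa>_in])
    finally show ?thesis
      by (simp only: fl R.mul_one)
  qed
  then have "S (f (x \<cdot> l)) = Q x" for x
    by (simp add: D.S_\<kappa>')
  then have "sw (cL a) (\<lambda>y x. S (f (x \<cdot> l)) \<cdot> y) = a"
    by (simp add: L.counit2)
  then show ?thesis
    by (rule trans[OF dual_integral_transfer[OF f]])
qed

text \<open>\<open>cop_integral_right\<close> trades \<open>S a\<close> on the first leg for
  \<open>a\<close> on the second, from where it factors out.\<close>

lemma integral_pair_2:
  assumes f: "R.right_linear f" and l: "left_integral l" and fl: "right_conv f l = \<one>"
  shows "right_conv (\<lambda>x. f (S a \<cdot> x)) l = a"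
  using cop_integral_right[OF l bal_right_conv[OF f], of a] fl
  by (simp add: right_conv_def R.mul_assoc flip: R.mul_sw)

lemma S_surj:
  assumes f: "right_dual_integral f" and l: "left_integral l" and fl: "f l = \<one>"
  shows "S (right_conv (\<lambda>x. f (a \<cdot> x)) l) = a"
  using integral_pair_1[OF assms, of a]
  by (simp add: right_conv_def S_sw S_mul S_\<kappa> R.right_linearD(2)[OF right_dual_integralD(1)[OF f]])

text \<open>\<open>S_surj\<close> provides a right inverse of \<open>S\<close>, and
  \<open>integral_pair_2\<close> recovers every element from its image under
  \<open>S\<close>.\<close>

lemma bij_S:
  assumes "right_dual_integral f" and "left_integral l" and "f l = \<one>"
  shows "bij S"
proof (rule bijI)
  have "right_conv f l = \<one>"
    using right_dual_integralD(3)[OF assms(1)] assms(3) by simp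
  note pair = integral_pair_2[OF right_dual_integralD(1)[OF assms(1)] assms(2) this]
  show "inj S"
  proof (rule injI)
    fix x y assume S: "S x = S y"
    have "x = right_conv (\<lambda>u. f (S x \<cdot> u)) l"
      by (rule pair[symmetric])
    also have "\<dots> = y"
      unfolding S by (rule pair)
    finally show "x = y" .
  qed
  show "surj S"
    using S_surj[OF assms] by (rule surjI)
qed

end


section \<open>The conditions in internal form and the inverses of the maps in them\<close>

context internal_hopf_algebroid
begin

interpretation D: internal_hopf_algebroid "\<lambda>x y. y \<cdot> x" \<one> C B \<tau> \<kappa> cL cR Q P S
  by (rule dual)

text \<open>\<open>C\<close> with the given product. As \<open>L\<close> carries the opposite
  product, left and right linear maps are exchanged between the two.\<close>

interpretation C: base_ring mul one C
  using L.flip by simp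

lemma C_linear: "C.right_linear = L.left_linear" "C.left_linear = L.right_linear"
  by (simp_all add: fun_eq_iff C.right_linear_def C.left_linear_def L.right_linear_def L.left_linear_def)

lemma C_right_dual_basis: "C.right_dual_basis = L.left_dual_basis"
  by (simp add: fun_eq_iff C.right_dual_basis_def L.left_dual_basis_def C_linear)

lemma C_frobenius: "C.frobenius = L.frobenius"
  using L.frobenius_flip by simp

text \<open>The next four are 1.a (and 1.b), 2.a, 2.b and 3.a of the theorem; 2.c, 2.d and 3.b are 2.a, 2.b and 3.a of the
  dual.\<close>

definition cond_extension :: bool
  where "cond_extension \<longleftrightarrow> R.frobenius \<and> L.frobenius"

definition cond_right_dual :: bool
  where "cond_right_dual \<longleftrightarrow> (\<exists>xg. R.right_dual_basis xg) \<and>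
    (\<exists>f. right_dual_integral f \<and> bij_betw (\<lambda>a b. f (a \<cdot> b)) UNIV {f. R.right_linear f})"

definition cond_left_dual :: bool
  where "cond_left_dual \<longleftrightarrow> bij S \<and> (\<exists>xg. L.left_dual_basis xg) \<and>
    (\<exists>\<chi>. left_dual_integral \<chi> \<and> bij_betw (\<lambda>a b. \<chi> (a \<cdot> b)) UNIV {\<chi>. L.left_linear \<chi>})"

definition cond_integral :: bool
  where "cond_integral \<longleftrightarrow> (\<exists>l. left_integral l \<and>
    bij_betw (\<lambda>f. right_conv f l) {f. R.right_linear f} UNIV \<and>
    bij_betw (\<lambda>\<chi>. left_conv \<chi> l) {\<chi>. L.left_linear \<chi>} UNIV)"

definition frobenius_integral :: "('a \<Rightarrow> 'a) \<Rightarrow> bool"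
  where "frobenius_integral f \<longleftrightarrow> right_dual_integral f \<and> (\<exists>uv. R.frobenius_system f uv)"

lemma frobenius_integral_iff: "(\<exists>f. frobenius_integral f) \<longleftrightarrow> cond_right_dual"
proof
  assume "\<exists>f. frobenius_integral f"
  then show cond_right_dual
    unfolding cond_right_dual_def frobenius_integral_def
    using R.frobenius_dual_basis R.frobenius_bij by blast
next
  assume cond_right_dual
  then obtain xg f where "R.right_dual_basis xg" "right_dual_integral f"
    "bij_betw (\<lambda>a b. f (a \<cdot> b)) UNIV {f. R.right_linear f}"
    unfolding cond_right_dual_def by blast
  then show "\<exists>f. frobenius_integral f"
    unfolding frobenius_integral_def
    using R.frobenius_systemI[OF right_dual_integralD(1,2)] by blast
qed

lemma \<tau>_left_linear: "R.left_linear \<tau>"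
  by (simp add: R.left_linear_def L.\<kappa>_add L.\<kappa>_in L.\<kappa>_mulC)

lemma Q_left_linear: "C.left_linear Q"
  by (simp add: C.left_linear_def L.P_add L.P_in L.P_mulB)

text \<open>The element representing \<open>\<tau>\<close> is an integral because
  \<open>\<tau> (x \<cdot> a) = \<tau> (x \<cdot> Q a)\<close> and \<open>\<psi>\<close> is
  nondegenerate. Over \<open>C\<close>, \<open>Q\<close> takes the place of
  \<open>\<tau>\<close>.\<close>

lemma frobenius_left_integral_B:
  assumes \<psi>: "R.frobenius_system \<psi> uv"
  obtains l where "left_integral l" "\<And>a. \<psi> (a \<cdot> l) = \<tau> a"
proof -
  obtain l where l: "\<And>a. \<psi> (a \<cdot> l) = \<tau> a"
    using R.frobenius_represents[OF \<psi> \<tau>_left_linear] by blast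
  have "a \<cdot> l = Q a \<cdot> l" for a
  proof (rule R.frobenius_right_nondegenerate[OF \<psi>])
    fix x
    have "\<tau> (x \<cdot> a) = \<tau> (x \<cdot> Q a)"
      by (metis L.P_P_mul L.\<kappa>_P)
    then show "\<psi> (x \<cdot> (a \<cdot> l)) = \<psi> (x \<cdot> (Q a \<cdot> l))"
      by (simp add: l flip: R.mul_assoc)
  qed
  then have "left_integral l"
    by (simp add: left_integral_def)
  then show thesis
    by (rule that) (rule l)
qed

lemma frobenius_left_integral_C:
  assumes \<psi>: "C.frobenius_system \<psi> uv"
  obtains l where "left_integral l" "\<And>a. \<psi> (a \<cdot> l) = Q a"
proof -
  obtain l where l: "\<And>a. \<psi> (a \<cdot> l) = Q a"
    using C.frobenius_represents[OF \<psi> Q_left_linear] by blast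
  have "a \<cdot> l = Q a \<cdot> l" for a
    by (rule C.frobenius_right_nondegenerate[OF \<psi>]) (simp add: l L.P_P_mul flip: R.mul_assoc)
  then have "left_integral l"
    by (simp add: left_integral_def)
  then show thesis
    by (rule that) (rule l)
qed

text \<open>Tested with \<open>\<psi> (x \<cdot> -)\<close>: the integral \<open>m\<close> turns
  \<open>x\<close> into \<open>\<tau> x\<close>, which lies in \<open>B\<close>, leaves the
  functional and equals \<open>\<psi> (x \<cdot> l)\<close>.\<close>

lemma left_integral_cyclic_B:
  assumes \<psi>: "R.frobenius_system \<psi> uv" and l: "\<And>a. \<psi> (a \<cdot> l) = \<tau> a" and m: "left_integral m"
  shows "m = l \<cdot> \<psi> m"
proof (rule R.frobenius_right_nondegenerate[OF \<psi>])
  note \<psi>' = R.frobenius_systemD(1,2)[OF \<psi>]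
  fix x
  have "\<psi> (x \<cdot> m) = \<psi> (\<tau> x \<cdot> m)"
    by (simp only: \<tau>_mul_integral[OF m])
  also have "\<dots> = \<psi> (x \<cdot> l) \<cdot> \<psi> m"
    by (simp add: R.left_linearD(3)[OF \<psi>'(2)] L.\<kappa>_in l)
  also have "\<dots> = \<psi> (x \<cdot> (l \<cdot> \<psi> m))"
    by (simp add: R.right_linearD[OF \<psi>'(1)] flip: R.mul_assoc)
  finally show "\<psi> (x \<cdot> m) = \<psi> (x \<cdot> (l \<cdot> \<psi> m))" .
qed

lemma right_conv_linear_left:
  "R.right_linear f \<Longrightarrow> R.right_linear (\<lambda>x. f (a \<cdot> x))"
  by (simp add: R.right_linear_def R.mul_add flip: R.mul_assoc)

lemma L_left_linear_\<kappa>S: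
  assumes "R.right_linear f" "R.left_linear f"
  shows "L.left_linear (\<lambda>b. \<kappa> (f (S b \<cdot> a)))"
  by (simp add: L.left_linear_def S_add R.add_mul R.right_linearD[OF assms(1)] R.left_linearD[OF assms(2)]
      R.\<kappa>_add R.\<kappa>_in S_mul S_C R.\<kappa>_mulB \<kappa>_S R.mul_assoc)

lemma left_conv_mul_C: "L.left_linear \<chi> \<Longrightarrow> c \<in> C \<Longrightarrow> left_conv \<chi> (c \<cdot> a) = c \<cdot> left_conv \<chi> a"
  using R.cop_\<kappa>_mul[OF bal_left_conv S_C, of \<chi> c a]
  by (simp add: left_conv_def \<kappa>_S R.mul_sw R.mul_assoc)

text \<open>The companion of \<open>integral_pair_1\<close> on the other side; testing with
  \<open>f (z \<cdot> -)\<close> reduces it to that identity.\<close>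

lemma frobenius_pair:
  assumes f: "right_dual_integral f" and uv: "R.frobenius_system f uv"
    and l: "left_integral l" and fl: "f l = \<one>"
  shows "sw (cR l) (\<lambda>x y. x \<cdot> f (S y \<cdot> a)) = a"
proof (rule R.frobenius_right_nondegenerate[OF uv])
  note lin = R.right_linearD[OF right_dual_integralD(1)[OF f]] R.left_linearD[OF right_dual_integralD(2)[OF f]]
  fix z
  have "f (z \<cdot> (x \<cdot> f y)) = f (f (z \<cdot> x) \<cdot> y)" for x y
    by (simp add: lin flip: R.mul_assoc)
  then have "f (z \<cdot> sw (cR l) (\<lambda>x y. x \<cdot> f (S y \<cdot> a))) = f (sw (cR l) (\<lambda>x y. f (z \<cdot> x) \<cdot> S y) \<cdot> a)"
    by (simp add: R.mul_sw R.sw_mul lin(6) R.mul_assoc)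
  then show "f (z \<cdot> sw (cR l) (\<lambda>x y. x \<cdot> f (S y \<cdot> a))) = f (z \<cdot> a)"
    by (simp add: integral_pair_1[OF f l fl])
qed

lemma left_conv_inverse_1:
  assumes f: "right_dual_integral f" and uv: "R.frobenius_system f uv"
    and l: "left_integral l" and fl: "f l = \<one>"
  shows "left_conv (\<lambda>b. \<kappa> (f (S b \<cdot> a))) l = a"
  using frobenius_pair[OF assms, of a]
  by (simp add: left_conv_def S_\<kappa> R.right_linearD(2)[OF right_dual_integralD(1)[OF f]])

text \<open>Linearity of \<open>f\<close> and \<open>\<chi>\<close> exchanges the two evaluations,
  so that \<open>integral_pair_2\<close> applies inside \<open>\<chi>\<close>. With
  \<open>left_conv_inverse_1\<close> this inverts
  \<open>\<chi> \<mapsto> left_conv \<chi> l\<close>.\<close>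

lemma left_conv_inverse_2:
  assumes f: "R.right_linear f" and l: "left_integral l" and fl: "right_conv f l = \<one>"
    and \<chi>: "L.left_linear \<chi>"
  shows "\<kappa> (f (S b \<cdot> left_conv \<chi> l)) = \<chi> b"
proof -
  note lin = R.right_linearD[OF f]
  have "\<kappa> (f (S b \<cdot> (x \<cdot> S (\<chi> y)))) = \<chi> y \<cdot> \<kappa> (f (S b \<cdot> x))" for x y
    by (simp add: lin S_C L.left_linearD[OF \<chi>] R.\<kappa>_mulB \<kappa>_S flip: R.mul_assoc)
  then have "\<kappa> (f (S b \<cdot> left_conv \<chi> l)) = sw (cR l) (\<lambda>x y. \<chi> y \<cdot> \<kappa> (f (S b \<cdot> x)))"
    by (simp add: left_conv_def R.mul_sw lin(6) sw_hom[where h = \<kappa>] R.\<kappa>_add)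
  also have "\<dots> = \<chi> (right_conv (\<lambda>x. f (S b \<cdot> x)) l)"
    by (simp add: right_conv_def L.left_linearD[OF \<chi>] R.\<kappa>_in)
  also have "\<dots> = \<chi> b"
    by (simp only: integral_pair_2[OF f l fl])
  finally show ?thesis .
qed

text \<open>A bijective \<open>S\<close> is an anti-automorphism exchanging \<open>B\<close> and
  \<open>C\<close>, so it carries a Frobenius system over \<open>B\<close> to one over
  \<open>C\<close>.\<close>

lemma frobenius_transport:
  assumes S: "bij S" and "R.frobenius"
  shows "L.frobenius"
proof -
  obtain \<psi> uv where \<psi>: "R.frobenius_system \<psi> uv"
    using assms(2) unfolding R.frobenius_def by blast
  note \<psi>' = R.frobenius_systemD[OF \<psi>]
  note lin = R.right_linearD[OF \<psi>'(1)] R.left_linearD[OF \<psi>'(2)]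
  note iS = surj_f_inv_f[OF bij_is_surj[OF S]]
  let ?uv = "map (\<lambda>(u, v). (inv S u, inv S v)) uv"
  have sw_uv: "sw ?uv h = sw uv (\<lambda>u v. h (inv S u) (inv S v))" for h :: "'a \<Rightarrow> 'a \<Rightarrow> 'a"
    by (simp add: sw_def comp_def split_def)
  have "L.frobenius_system (\<lambda>a. \<kappa> (\<psi> (S a))) ?uv"
    unfolding L.frobenius_system_def
  proof (intro conjI allI)
    show "L.right_linear (\<lambda>a. \<kappa> (\<psi> (S a)))"
      by (simp add: L.right_linear_def S_add lin R.\<kappa>_add R.\<kappa>_in S_mul S_C R.\<kappa>_mulB)
        (metis R.\<kappa>_id R.\<kappa>_mulB \<kappa>_S S_C lin(2))
    show "L.left_linear (\<lambda>a. \<kappa> (\<psi> (S a)))"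
      using L_left_linear_\<kappa>S[OF \<psi>'(1,2), of \<one>] by simp
    show "sw ?uv (\<lambda>u v. v \<cdot> \<kappa> (\<psi> (S (u \<cdot> a)))) = a" for a
    proof (rule injD[OF bij_is_inj[OF S]])
      show "S (sw ?uv (\<lambda>u v. v \<cdot> \<kappa> (\<psi> (S (u \<cdot> a))))) = S a"
        by (simp add: sw_uv S_sw S_mul S_\<kappa> lin iS \<psi>')
    qed
    show "sw ?uv (\<lambda>u v. \<kappa> (\<psi> (S (a \<cdot> v))) \<cdot> u) = a" for a
    proof (rule injD[OF bij_is_inj[OF S]])
      show "S (sw ?uv (\<lambda>u v. \<kappa> (\<psi> (S (a \<cdot> v))) \<cdot> u)) = S a"
        by (simp add: sw_uv S_sw S_mul S_\<kappa> lin iS \<psi>')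
    qed
  qed
  then show ?thesis
    unfolding L.frobenius_def by blast
qed

end

section \<open>Implications between the conditions\<close>

context internal_hopf_algebroid
begin

interpretation D: internal_hopf_algebroid "\<lambda>x y. y \<cdot> x" \<one> C B \<tau> \<kappa> cL cR Q P S
  by (rule dual)

interpretation C: base_ring mul one C
  using L.flip by simp

lemma frobenius_transport': "bij S \<Longrightarrow> L.frobenius \<Longrightarrow> R.frobenius"
  using D.frobenius_transport by simp

lemma frobenius_integralE:
  assumes "frobenius_integral f"
  obtains uv l where "right_dual_integral f" "R.frobenius_system f uv" "left_integral l" "f l = \<one>"
proof -
  obtain uv where uv: "right_dual_integral f" "R.frobenius_system f uv"
    using assms unfolding frobenius_integral_def by blast
  obtain l where "left_integral l" "\<And>a. f (a \<cdot> l) = \<tau> a"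
    using frobenius_left_integral_B[OF uv(2)] by blast
  then show thesis
    using that[OF uv] by (metis L.\<kappa>_one R.one_mul)
qed

text \<open>All inverses are explicit in \<open>f\<close>, \<open>S\<close> and the legs of
  \<open>l\<close>, and the pair identities verify them.\<close>

lemma frobenius_integral_consequences:
  assumes "frobenius_integral f"
  shows cond_extension cond_left_dual cond_integral
proof -
  obtain uv l where f: "right_dual_integral f" and uv: "R.frobenius_system f uv"
    and l: "left_integral l" and fl: "f l = \<one>"
    using frobenius_integralE[OF assms] by blast
  note f' = right_dual_integralD[OF f]
  have fl': "right_conv f l = \<one>"
    by (simp add: f' fl)
  have S: "bij S"
    by (rule bij_S[OF f l fl])
  have R: "R.frobenius"
    using uv unfolding R.frobenius_def by blast
  show cond_extension
    using R frobenius_transport[OF S R] by (simp add: cond_extension_def)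
  have bij\<chi>: "bij_betw (\<lambda>a b. \<kappa> (f (S b \<cdot> a))) UNIV {\<chi>. L.left_linear \<chi>}"
    by (rule bij_betw_byWitness[where f' = "\<lambda>\<chi>. left_conv \<chi> l"])
      (auto simp: left_conv_inverse_1[OF f uv l fl] left_conv_inverse_2[OF f'(1) l fl']
        L_left_linear_\<kappa>S[OF f'(1,2)])
  have "bij_betw (\<lambda>\<chi>. left_conv \<chi> l) {\<chi>. L.left_linear \<chi>} UNIV"
    by (rule bij_betw_byWitness[where f' = "\<lambda>a b. \<kappa> (f (S b \<cdot> a))"])
      (auto simp: left_conv_inverse_1[OF f uv l fl] left_conv_inverse_2[OF f'(1) l fl']
        L_left_linear_\<kappa>S[OF f'(1,2)])
  moreover have "bij_betw (\<lambda>g. right_conv g l) {g. R.right_linear g} UNIV"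
  proof (rule bij_betw_byWitness[where f' = "\<lambda>a b. f (S a \<cdot> b)"])
    show "\<forall>g\<in>{g. R.right_linear g}. (\<lambda>b. f (S (right_conv g l) \<cdot> b)) = g"
    proof
      fix g assume "g \<in> {g. R.right_linear g}"
      then obtain y where "g = (\<lambda>b. f (y \<cdot> b))"
        using bij_betw_imp_surj_on[OF R.frobenius_bij[OF uv]] by blast
      then show "(\<lambda>b. f (S (right_conv g l) \<cdot> b)) = g"
        using S_surj[OF f l fl, of y] by simp
    qed
    show "\<forall>a\<in>UNIV. right_conv (\<lambda>b. f (S a \<cdot> b)) l = a"
      by (simp add: integral_pair_2[OF f'(1) l fl'])
  qed (use right_conv_linear_left[OF f'(1)] in auto)
  ultimately show cond_integral
    unfolding cond_integral_def using l by blast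
  \<comment> \<open>Precomposing with \<open>S\<close> turns \<open>S b \<cdot> S a\<close> into
    \<open>S (a \<cdot> b)\<close>, so this becomes the map required in
    \<open>cond_left_dual\<close> for \<open>\<chi> = \<kappa> \<circ> f \<circ> S\<close>.\<close>
  have "bij_betw ((\<lambda>a b. \<kappa> (f (S b \<cdot> a))) \<circ> S) UNIV {\<chi>. L.left_linear \<chi>}"
    by (rule bij_betw_trans[OF S bij\<chi>])
  then have "bij_betw (\<lambda>a b. \<kappa> (f (S (a \<cdot> b)))) UNIV {\<chi>. L.left_linear \<chi>}"
    by (simp add: comp_def S_mul)
  \<comment> \<open>The basis elements are the second legs of \<open>l\<close>;
    \<open>integral_pair_2\<close> is the expansion in them.\<close>
  moreover have "L.left_dual_basis (map (\<lambda>(x, y). (y, \<lambda>a. \<kappa> (f (S a \<cdot> x)))) (cR l))"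
    using integral_pair_2[OF f'(1) l fl'] L_left_linear_\<kappa>S[OF f'(1,2)]
    by (auto simp: L.left_dual_basis_def right_conv_def sw_def comp_def split_def)
  ultimately show cond_left_dual
    unfolding cond_left_dual_def
    using S left_dual_integral_S[OF f bij_is_inj[OF S]] by blast
qed

text \<open>The integral property makes \<open>\<chi>\<close> linear over \<open>C\<close> on the
  other side as well, so it is the functional of a Frobenius system over \<open>C\<close>; the
  bijection \<open>S\<close> carries this to \<open>B\<close>.\<close>

lemma left_dual_imp_extension:
  assumes cond_left_dual shows cond_extension
proof -
  obtain xg \<chi> where S: "bij S" and xg: "L.left_dual_basis xg" and \<chi>: "left_dual_integral \<chi>"
    and bij: "bij_betw (\<lambda>a b. \<chi> (a \<cdot> b)) UNIV {\<chi>. L.left_linear \<chi>}"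
    using assms unfolding cond_left_dual_def by blast
  have lin: "L.left_linear \<chi>"
    using \<chi> by (simp add: left_dual_integral_def)
  have "L.right_linear \<chi>"
    using \<chi> left_conv_mul_C[OF lin]
    by (simp add: left_dual_integral_def L.right_linear_def L.left_linearD[OF lin])
  then have "C.frobenius"
    unfolding C.frobenius_def
    using C.frobenius_systemI[of \<chi> xg] lin bij xg by (auto simp: C_linear C_right_dual_basis)
  then show ?thesis
    using frobenius_transport'[OF S] by (simp add: cond_extension_def C_frobenius)
qed

text \<open>The integral sought is the preimage of \<open>\<one>\<close> under the first bijection.
  Its properties follow from injectivity: right linear maps with equal convolutions at
  \<open>l\<close> coincide.\<close>

lemma integral_imp_right_dual:
  assumes cond_integral shows cond_right_dual
proof -
  obtain l where l: "left_integral l"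
    and bijR: "bij_betw (\<lambda>f. right_conv f l) {f. R.right_linear f} UNIV"
    and bijL: "bij_betw (\<lambda>\<chi>. left_conv \<chi> l) {\<chi>. L.left_linear \<chi>} UNIV"
    using assms unfolding cond_integral_def by blast
  have eqR: "f = g" if "R.right_linear f" "R.right_linear g" "right_conv f l = right_conv g l" for f g
    using bij_betw_imp_inj_on[OF bijR] that by (simp add: inj_on_def)
  obtain f where f: "R.right_linear f" and fl: "right_conv f l = \<one>"
    using bij_betw_imp_surj_on[OF bijR] by (metis (mono_tags, lifting) UNIV_I imageE mem_Collect_eq)
  note fr = R.right_linearD[OF f]
  \<comment> \<open>Both sides have convolution \<open>\<kappa> b\<close> at \<open>l\<close>, the
    left one by the Takeuchi condition.\<close>
  have "f (b \<cdot> a) = b \<cdot> f a" if b: "b \<in> B" for a b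
  proof -
    have "right_conv (\<lambda>a. f (b \<cdot> a)) l = \<kappa> b \<cdot> right_conv f l"
      using R.takeuchi[OF bal_right_conv[OF f] b, of l]
      by (simp add: right_conv_def R.mul_sw R.mul_assoc)
    moreover have "right_conv (\<lambda>a. b \<cdot> f a) l = right_conv f l \<cdot> \<kappa> b"
      by (simp add: right_conv_def R.sw_mul R.\<kappa>_mulB fr R.mul_assoc)
    moreover have "R.right_linear (\<lambda>a. b \<cdot> f a)"
      by (simp add: R.right_linear_def fr R.mul_add R.B_mul b R.mul_assoc)
    ultimately have "(\<lambda>a. f (b \<cdot> a)) = (\<lambda>a. b \<cdot> f a)"
      using right_conv_linear_left[OF f] by (intro eqR) (simp_all add: fl)
    then show ?thesis by (rule fun_cong)
  qed
  then have f_left: "R.left_linear f"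
    by (simp add: R.left_linear_def fr)
  define g where "g x = (\<lambda>b. \<kappa> (f (S b \<cdot> x)))" for x
  have g: "L.left_linear (g x)" for x
    unfolding g_def by (rule L_left_linear_\<kappa>S[OF f f_left])
  define \<chi> where "\<chi> a = inv_into {\<chi>. L.left_linear \<chi>} (\<lambda>\<chi>. left_conv \<chi> l) a" for a
  have \<chi>: "L.left_linear (\<chi> a)" "left_conv (\<chi> a) l = a" for a
    using inv_into_into[of a "\<lambda>\<chi>. left_conv \<chi> l" "{\<chi>. L.left_linear \<chi>}"]
      f_inv_into_f[of a "\<lambda>\<chi>. left_conv \<chi> l" "{\<chi>. L.left_linear \<chi>}"]
      bij_betw_imp_surj_on[OF bijL] by (auto simp: \<chi>_def)
  have eqL: "\<chi> a = h" if "L.left_linear h" "left_conv h l = a" for a h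
    using bij_betw_imp_inj_on[OF bijL] that \<chi>[of a] by (simp add: inj_on_def)
  have \<chi>_add: "\<chi> (a + b) = (\<lambda>x. \<chi> a x + \<chi> b x)" for a b
  proof (rule eqL)
    show "L.left_linear (\<lambda>x. \<chi> a x + \<chi> b x)"
      by (simp add: L.left_linear_def L.left_linearD[OF \<chi>(1)] L.B_add R.add_mul)
    show "left_conv (\<lambda>x. \<chi> a x + \<chi> b x) l = a + b"
      using \<chi>(2)[of a] \<chi>(2)[of b] by (simp add: left_conv_def S_add R.mul_add sw_add)
  qed
  \<comment> \<open>Right multiplication by \<open>b\<close> becomes left multiplication by
    \<open>\<kappa> b\<close>, which \<open>S\<close> turns back into right multiplication by
    \<open>b\<close>. Hence \<open>a \<mapsto> S (\<chi> a y)\<close> is right linear over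
    \<open>B\<close>.\<close>
  have \<chi>_mul: "\<chi> (a \<cdot> b) = (\<lambda>x. \<kappa> b \<cdot> \<chi> a x)" if b: "b \<in> B" for a b
  proof (rule eqL)
    show "L.left_linear (\<lambda>x. \<kappa> b \<cdot> \<chi> a x)"
      by (simp add: L.left_linear_def L.left_linearD[OF \<chi>(1)] L.B_mul R.\<kappa>_in R.mul_add R.mul_assoc)
    show "left_conv (\<lambda>x. \<kappa> b \<cdot> \<chi> a x) l = a \<cdot> b"
      using arg_cong[OF \<chi>(2)[of a], of "\<lambda>a. a \<cdot> b"]
      by (simp add: left_conv_def S_mul S_\<kappa> b R.sw_mul R.mul_assoc)
  qed
  \<comment> \<open>\<open>(\<ell>\<^sup>(\<^sup>2\<^sup>), \<lambda>(S(-) \<ell>\<^sup>(\<^sup>1\<^sup>)))\<close> is a dual basis over \<open>C\<close>; the bijection with the left dual turns it into one over \<open>B\<close>.\<close>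
  have expand: "sw (cR l) (\<lambda>x y. left_conv (g x) l \<cdot> S (\<chi> a y)) = a" for a
  proof -
    have expand_\<chi>: "\<chi> a b = sw (cR l) (\<lambda>x y. \<chi> a y \<cdot> g x b)" for b
    proof -
      have "\<chi> a b = \<chi> a (right_conv (\<lambda>x. f (S b \<cdot> x)) l)"
        by (simp only: integral_pair_2[OF f l fl])
      then show ?thesis
        by (simp add: right_conv_def L.left_linearD[OF \<chi>(1)] R.\<kappa>_in g_def)
    qed
    have "a = left_conv (\<chi> a) l"
      by (simp only: \<chi>(2))
    also have "\<dots> = left_conv (\<lambda>b. sw (cR l) (\<lambda>x y. \<chi> a y \<cdot> g x b)) l"
      by (rule arg_cong[where f = "\<lambda>h. left_conv h l"]) (rule ext, rule expand_\<chi>)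
    also have "\<dots> = sw (cR l) (\<lambda>x y. left_conv (g x) l \<cdot> S (\<chi> a y))"
      unfolding left_conv_def S_sw R.mul_sw R.sw_mul S_mul R.mul_assoc by (rule sw_swap)
    finally show ?thesis by simp
  qed
  let ?xg = "map (\<lambda>(x, y). (left_conv (g x) l, \<lambda>a. S (\<chi> a y))) (cR l)"
  have basis: "R.right_dual_basis ?xg"
    unfolding R.right_dual_basis_def
  proof (intro conjI ballI allI)
    have "R.right_linear (\<lambda>a. S (\<chi> a y))" for y
      by (simp add: R.right_linear_def \<chi>_add \<chi>_mul S_add S_C L.left_linearD[OF \<chi>(1)] S_mul S_\<kappa>)
    then show "R.right_linear (snd p)" if "p \<in> set ?xg" for p
      using that by auto
    show "sw ?xg (\<lambda>x g. x \<cdot> g a) = a" for a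
      using expand[of a] by (simp add: sw_def comp_def split_def)
  qed
  \<comment> \<open>The functionals of the dual basis separate points, so the integral property can
    be tested with right linear maps \<open>\<theta>\<close>.\<close>
  have separate: "a = 0" if "\<And>\<theta>. R.right_linear \<theta> \<Longrightarrow> \<theta> a = 0" for a
  proof -
    have "S (\<chi> a y) = 0" for y
      by (rule that) (simp add: R.right_linear_def \<chi>_add \<chi>_mul S_add S_C L.left_linearD[OF \<chi>(1)] S_mul S_\<kappa>)
    then show ?thesis
      using expand[of a] by simp
  qed
  have "right_conv f a = f a" for a
  proof -
    have "right_conv f a - f a = 0"
    proof (rule separate)
      fix \<theta> assume \<theta>: "R.right_linear \<theta>"
      note \<theta>' = R.right_linearD[OF \<theta>]
      have "R.right_linear (\<lambda>a. \<theta> (right_conv f a))" "R.right_linear (\<lambda>a. \<theta> (f a))"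
        by (simp_all add: R.right_linear_def \<theta>' fr right_conv_add[OF f] right_conv_B[OF f])
      \<comment> \<open>Both convolutions equal \<open>\<kappa> (\<theta> \<one>)\<close>, by
        coassociativity and \<open>right_conv f l = \<one>\<close>.\<close>
      moreover have "right_conv (\<lambda>a. \<theta> (right_conv f a)) l = right_conv (\<lambda>a. \<theta> (f a)) l"
      proof -
        let ?F = "\<lambda>x y z. z \<cdot> \<kappa> (\<theta> (y \<cdot> \<kappa> (f x)))"
        have \<kappa>B: "b \<cdot> \<kappa> x = \<kappa> x \<cdot> b" if "b \<in> B" for b x
          using that R.BC_comm R.\<kappa>_in by blast
        have "right_conv (\<lambda>a. \<theta> (right_conv f a)) l = sw (cR l) (\<lambda>p z. sw (cR p) (\<lambda>x y. ?F x y z))"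
          by (simp add: right_conv_def \<theta>' sw_hom[where h = \<kappa>] R.\<kappa>_add R.mul_sw)
        also have "\<dots> = sw (cR l) (\<lambda>x q. sw (cR q) (?F x))"
        proof (rule R.coassoc)
          show "R.bal (\<lambda>x y. ?F x y z)" for z
            by (rule R.balI) (simp_all add: R.add_mul R.mul_add fr \<theta>' R.\<kappa>_add R.\<kappa>_mulB R.mul_assoc)
          show "R.bal (?F x)" for x
          proof (rule R.balI)
            show "z \<cdot> \<kappa> (\<theta> (y \<cdot> b \<cdot> \<kappa> (f x))) = z \<cdot> \<kappa> b \<cdot> \<kappa> (\<theta> (y \<cdot> \<kappa> (f x)))" if "b \<in> B" for b y z
            proof -
              have "y \<cdot> b \<cdot> \<kappa> (f x) = y \<cdot> \<kappa> (f x) \<cdot> b"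
                by (simp add: R.mul_assoc \<kappa>B[OF that])
              then have "\<kappa> (\<theta> (y \<cdot> b \<cdot> \<kappa> (f x))) = \<kappa> b \<cdot> \<kappa> (\<theta> (y \<cdot> \<kappa> (f x)))"
                by (simp only: \<theta>' that R.\<kappa>_mulB)
              then show ?thesis
                by (simp only: R.mul_assoc)
            qed
          qed (simp_all add: R.add_mul R.mul_add \<theta>' R.\<kappa>_add)
        qed
        also have "\<dots> = sw (cR l) (\<lambda>x q. right_conv \<theta> (q \<cdot> \<kappa> (f x)))"
          by (simp add: right_conv_def R.cop_mul\<kappa>[OF bal_right_conv[OF \<theta>]] fr)
        also have "\<dots> = right_conv \<theta> (right_conv f l)"
          by (simp add: right_conv_def[of f] sw_hom[where h = "right_conv \<theta>"] right_conv_add[OF \<theta>])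
        also have "\<dots> = \<kappa> (\<theta> \<one>)"
          unfolding fl by (simp add: right_conv_def R.cop_one[OF bal_right_conv[OF \<theta>]])
        also have "\<dots> = right_conv f l \<cdot> \<kappa> (\<theta> \<one>)"
          by (simp add: fl)
        also have "\<dots> = right_conv (\<lambda>a. \<theta> (f a)) l"
          using \<theta>'(3)[of _ \<one>] by (simp add: right_conv_def R.sw_mul R.mul_assoc fr R.\<kappa>_mulB)
        finally show ?thesis .
      qed
      ultimately have "(\<lambda>a. \<theta> (right_conv f a)) = (\<lambda>a. \<theta> (f a))"
        by (rule eqR)
      then show "\<theta> (right_conv f a - f a) = 0"
        by (simp add: \<theta>' fun_eq_iff)
    qed
    then show ?thesis by simp
  qed
  then have int: "right_dual_integral f"
    using f by (simp add: right_dual_integral_def)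
  have "f l = \<one>"
    using fl right_dual_integralD(3)[OF int] by simp
  note surj = S_surj[OF int l this]
  have "bij_betw (\<lambda>a b. f (a \<cdot> b)) UNIV {f. R.right_linear f}"
  proof (rule bij_betw_byWitness[where f' = "\<lambda>g. S (right_conv g l)"])
    show "\<forall>h\<in>{f. R.right_linear f}. (\<lambda>b. f (S (right_conv h l) \<cdot> b)) = h"
      using eqR right_conv_linear_left[OF f] integral_pair_2[OF f l fl] by blast
  qed (use surj right_conv_linear_left[OF f] in auto)
  then show ?thesis
    unfolding cond_right_dual_def using basis int by blast
qed

end


section \<open>Existence of integrals on Frobenius Hopf algebroids\<close>

context internal_hopf_algebroid
begin

interpretation D: internal_hopf_algebroid "\<lambda>x y. y \<cdot> x" \<one> C B \<tau> \<kappa> cL cR Q P S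
  by (rule dual)

interpretation C: base_ring mul one C
  using L.flip by simp

lemma cop_C_mul: "R.bal f \<Longrightarrow> c \<in> C \<Longrightarrow> sw (cR (c \<cdot> a)) f = sw (cR a) (\<lambda>x y. f (c \<cdot> x) y)"
  using R.cop_\<kappa>_mul[OF _ S_C, of f c a] by (simp add: \<kappa>_S)

lemma takeuchi_C: "R.bal f \<Longrightarrow> c \<in> C \<Longrightarrow> sw (cR a) (\<lambda>x y. f x (c \<cdot> y)) = sw (cR a) (\<lambda>x y. f (S c \<cdot> x) y)"
  using R.takeuchi[OF _ S_C, of f c a] by (simp add: \<kappa>_S)

lemma P_C_mul: "c \<in> C \<Longrightarrow> P (c \<cdot> x) = P (S c \<cdot> x)"
  using R.P_\<kappa>_mul[of "S c" x] by (simp add: \<kappa>_S)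

lemma Q_B_mul: "b \<in> B \<Longrightarrow> Q (b \<cdot> x) = Q x \<cdot> S b"
  using L.P_mul\<kappa>[OF S_B, of b x] by (simp add: \<tau>_S)

text \<open>The right linear endomorphisms of \<open>A\<close> as a right comodule of the right
  bialgebroid, with coaction \<open>cR\<close>.\<close>

definition colinear :: "('a \<Rightarrow> 'a) \<Rightarrow> bool"
  where "colinear T \<longleftrightarrow> (\<forall>x y. T (x + y) = T x + T y) \<and> (\<forall>b\<in>B. \<forall>x. T (x \<cdot> b) = T x \<cdot> b) \<and>
    (\<forall>g. R.bal g \<longrightarrow> (\<forall>a. sw (cR (T a)) g = sw (cR a) (\<lambda>x y. g (T x) y)))"

lemma colinearD:
  assumes "colinear T"
  shows "T (x + y) = T x + T y" "b \<in> B \<Longrightarrow> T (x \<cdot> b) = T x \<cdot> b"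
    "R.bal g \<Longrightarrow> sw (cR (T a)) g = sw (cR a) (\<lambda>x y. g (T x) y)"
  using assms by (auto simp: colinear_def)

lemma colinear_sw: "colinear T \<Longrightarrow> T (sw xs g) = sw xs (\<lambda>u v. T (g u v))"
  by (rule sw_hom) (rule colinearD)

lemma bal_counit1: "R.bal (\<lambda>x y. y \<cdot> \<kappa> x)"
  by (rule R.balI) (simp_all add: R.add_mul R.mul_add R.\<kappa>_add R.\<kappa>_mulB R.mul_assoc)

lemma bal_colinear: "colinear T \<Longrightarrow> R.bal g \<Longrightarrow> R.bal (\<lambda>x y. g (T x) y)"
  by (rule R.balI) (simp_all add: colinearD R.bal_add1 R.bal_add2 R.balD)

lemma colinear_comp:
  assumes T: "colinear T" and U: "colinear U"
  shows "colinear (\<lambda>x. T (U x))"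
  by (simp add: colinear_def colinearD[OF T] colinearD[OF U] bal_colinear[OF T])

text \<open>The counit identity for \<open>T a\<close>, with colinearity placing \<open>T\<close> on
  the first leg. It makes \<open>T\<close> left linear over \<open>B\<close> as well.\<close>

lemma colinear_counit:
  assumes T: "colinear T"
  shows "sw (cR a) (\<lambda>x y. y \<cdot> \<kappa> (T x)) = T a"
  using colinearD(3)[OF T bal_counit1, of a] by (simp add: R.counit1)

lemma colinear_B_mul:
  assumes T: "colinear T" and b: "b \<in> B"
  shows "T (b \<cdot> a) = b \<cdot> T a"
  using colinear_counit[OF T, of "b \<cdot> a"] colinear_counit[OF T, of a]
  by (simp add: R.cop_B_mul[OF bal_colinear[OF T bal_counit1] b] R.mul_assoc flip: R.mul_sw)

text \<open>By coassociativity, convolution acts on the first part of the iterated coproduct and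
  leaves the last leg alone.\<close>

lemma colinear_right_conv:
  assumes f: "R.right_linear f"
  shows "colinear (right_conv f)"
  unfolding colinear_def
proof (intro conjI allI ballI impI)
  note f' = R.right_linearD[OF f]
  fix g a assume g: "R.bal g"
  note g' = R.bal_add1[OF g] R.bal_add2[OF g] R.balD[OF g]
  let ?F = "\<lambda>x y z. g (y \<cdot> \<kappa> (f x)) z"
  have "sw (cR (right_conv f a)) g = sw (cR a) (\<lambda>x q. sw (cR q) (?F x))"
    by (simp add: right_conv_def R.cop_sw[OF g] R.cop_mul\<kappa>[OF g] f')
  also have "\<dots> = sw (cR a) (\<lambda>p z. sw (cR p) (\<lambda>x y. ?F x y z))"
  proof (rule R.coassoc[symmetric])
    show "R.bal (\<lambda>x y. ?F x y z)" for z
      by (rule R.balI) (simp_all add: R.add_mul R.mul_add f' g' R.\<kappa>_add R.\<kappa>_mulB R.mul_assoc)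
    show "R.bal (?F x)" for x
    proof (rule R.balI)
      fix b y z assume b: "b \<in> B"
      have "y \<cdot> b \<cdot> \<kappa> (f x) = y \<cdot> \<kappa> (f x) \<cdot> b"
        by (simp add: R.mul_assoc R.BC_comm[OF b R.\<kappa>_in])
      then show "g (y \<cdot> b \<cdot> \<kappa> (f x)) z = g (y \<cdot> \<kappa> (f x)) (z \<cdot> \<kappa> b)"
        by (simp only: g'(3)[OF b])
    qed (simp_all add: R.add_mul g')
  qed
  also have "\<dots> = sw (cR a) (\<lambda>x y. g (right_conv f x) y)"
    by (simp add: right_conv_def sw_hom[where h = "\<lambda>x. g x _"] g')
  finally show "sw (cR (right_conv f a)) g = sw (cR a) (\<lambda>x y. g (right_conv f x) y)" .
qed (simp_all add: right_conv_add[OF f] right_conv_B[OF f])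

text \<open>The convolution over the left bialgebroid with a functional of
  \<open>\<A>\<^sub>*\<close>; on \<open>B\<close> the antipode is
  \<open>t\<^sub>L(l) \<mapsto> s\<^sub>L(l)\<close>.\<close>

definition \<Gamma> :: "('a \<Rightarrow> 'a) \<Rightarrow> 'a \<Rightarrow> 'a"
  where "\<Gamma> h a = sw (cL a) (\<lambda>y x. S (h x) \<cdot> y)"

lemma bal_\<Gamma>: "R.left_linear h \<Longrightarrow> L.bal (\<lambda>y x. S (h x) \<cdot> y)"
  by (rule L.balI)
    (simp_all add: R.add_mul R.mul_add R.left_linearD S_add S_mul S_\<tau> L.\<kappa>_in R.mul_assoc)

lemma \<Gamma>_add: "R.left_linear h \<Longrightarrow> \<Gamma> h (x + y) = \<Gamma> h x + \<Gamma> h y"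
  unfolding \<Gamma>_def by (rule L.cop_add) (rule bal_\<Gamma>)

text \<open>The mixed law \<open>LR\<close> takes the part that coassociativity has in
  \<open>colinear_right_conv\<close>.\<close>

lemma colinear_\<Gamma>:
  assumes h: "R.left_linear h"
  shows "colinear (\<Gamma> h)"
  unfolding colinear_def
proof (intro conjI allI ballI impI)
  note h' = R.left_linearD[OF h]
  show "\<Gamma> h (x \<cdot> b) = \<Gamma> h x \<cdot> b" if "b \<in> B" for b x
    using L.cop_\<kappa>_mul[OF bal_\<Gamma>[OF h] S_B[OF that], of x]
    by (simp add: \<Gamma>_def \<tau>_S that R.sw_mul R.mul_assoc)
  fix g a assume g: "R.bal g"
  note g' = R.bal_add1[OF g] R.bal_add2[OF g] R.balD[OF g]
  let ?F = "\<lambda>x y z. g (S (h x) \<cdot> y) z"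
  have "sw (cR (\<Gamma> h a)) g = sw (cL a) (\<lambda>q x. sw (cR q) (?F x))"
    by (simp add: \<Gamma>_def R.cop_sw[OF g] cop_C_mul[OF g] S_B h')
  also have "\<dots> = sw (cR a) (\<lambda>p z. sw (cL p) (\<lambda>y x. ?F x y z))"
  proof (rule LR[symmetric])
    show "L.bal (\<lambda>y x. ?F x y z)" for z
      using bal_\<Gamma>[OF h] by (auto simp: balanced_def g')
    show "R.bal (?F x)" for x
      by (rule R.balI) (simp_all add: R.mul_add g' flip: R.mul_assoc)
  qed
  also have "\<dots> = sw (cR a) (\<lambda>x y. g (\<Gamma> h x) y)"
    by (simp add: \<Gamma>_def sw_hom[where h = "\<lambda>x. g x _"] g')
  finally show "sw (cR (\<Gamma> h a)) g = sw (cR a) (\<lambda>x y. g (\<Gamma> h x) y)" .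
qed (simp add: \<Gamma>_add[OF h])

text \<open>The antipode axiom for \<open>\<Gamma> h a\<close>; by coassociativity its left
  coproduct is that of \<open>a\<close> with \<open>\<Gamma> h\<close> applied to the first
  factor.\<close>

lemma antipode_\<Gamma>:
  assumes h: "R.left_linear h"
  shows "sw (cL a) (\<lambda>y x. S (\<Gamma> h x) \<cdot> y) = P (\<Gamma> h a)"
proof -
  note h' = R.left_linearD[OF h]
  let ?g = "\<lambda>y x. S x \<cdot> y"
  have g: "L.bal ?g"
    by (rule L.balI) (simp_all add: R.mul_add R.add_mul S_add S_B_mul L.\<kappa>_in S_\<tau> R.mul_assoc)
  have "P (\<Gamma> h a) = sw (cL (\<Gamma> h a)) ?g"
    by (simp add: antipode_L)
  also have "\<dots> = sw (cL a) (\<lambda>p z. sw (cL p) (\<lambda>y x. ?g y (S (h z) \<cdot> x)))"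
    by (simp add: \<Gamma>_def L.cop_sw[OF g] L.cop_mulB[OF g] S_B h')
  also have "\<dots> = sw (cL a) (\<lambda>y q. sw (cL q) (\<lambda>x z. ?g y (S (h z) \<cdot> x)))"
  proof (rule L.coassoc)
    show "L.bal (\<lambda>y x. ?g y (S (h z) \<cdot> x))" for z
    proof (rule L.balI)
      fix c y x assume c: "c \<in> C"
      have "S (h z) \<cdot> (\<tau> c \<cdot> x) = \<tau> c \<cdot> (S (h z) \<cdot> x)"
        using R.BC_comm[OF L.\<kappa>_in S_B[OF h'(2)]] by (simp flip: R.mul_assoc)
      then show "S (S (h z) \<cdot> x) \<cdot> (c \<cdot> y) = S (S (h z) \<cdot> (\<tau> c \<cdot> x)) \<cdot> y"
        by (simp add: S_B_mul[OF L.\<kappa>_in] S_\<tau> c R.mul_assoc)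
    qed (simp_all add: R.mul_add R.add_mul S_add)
    show "L.bal (\<lambda>x z. ?g y (S (h z) \<cdot> x))" for y
      using bal_\<Gamma>[OF h] by (auto simp: balanced_def S_add R.add_mul)
  qed
  also have "\<dots> = sw (cL a) (\<lambda>y x. S (\<Gamma> h x) \<cdot> y)"
    by (simp add: \<Gamma>_def S_sw R.sw_mul)
  finally show ?thesis by simp
qed

text \<open>\<open>W z\<close> is the left-hand side with \<open>z\<close> for \<open>S d\<close>.
  The counit identity for \<open>T (S y \<cdot> a)\<close>, with the coproduct of \<open>S y\<close>
  taken from \<open>cop_S\<close>, expresses the right-hand side through \<open>W\<close>, and the
  antipode contracts the other legs.\<close>

lemma colinear_conv_S:
  assumes T: "colinear T"
  shows "sw (cR a) (\<lambda>x y. y \<cdot> \<kappa> (T (S d \<cdot> x))) = sw (cR d) (\<lambda>x y. x \<cdot> T (S y \<cdot> a))"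
proof -
  note T' = colinearD(1,2)[OF T] colinear_B_mul[OF T]
  define W where "W z = sw (cR a) (\<lambda>x y. y \<cdot> \<kappa> (T (z \<cdot> x)))" for z
  have Tz: "T (z \<cdot> (x \<cdot> b)) = T (z \<cdot> x) \<cdot> b" if "b \<in> B" for z x b
    using T'(2)[OF that, of "z \<cdot> x"] by (simp only: R.mul_assoc)
  have bal: "R.bal (\<lambda>x y. y \<cdot> \<kappa> (T (z \<cdot> x)))" for z
    by (rule R.balI) (simp_all add: R.mul_add R.add_mul T' Tz R.\<kappa>_add R.\<kappa>_mulB R.mul_assoc)
  have W_add: "W (z + z') = W z + W z'" for z z'
    by (simp add: W_def R.add_mul R.mul_add T' R.\<kappa>_add sw_add)
  have W_C: "c \<cdot> W z = W (z \<cdot> S c)" if "c \<in> C" for c z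
    using takeuchi_C[OF bal that, of a z] by (simp add: W_def R.mul_sw R.mul_assoc)
  have balS: "R.bal (\<lambda>x y. sw (cR a) (\<lambda>u v. y \<cdot> v \<cdot> \<kappa> (T (x \<cdot> u))))"
    using R.bal_cop_mult[OF bal[of \<one>], of a] by simp
  have TS: "T (S y \<cdot> a) = sw (cL y) (\<lambda>z p. S p \<cdot> W (S z))" for y
  proof -
    have "T (S y \<cdot> a) = sw (cR (S y)) (\<lambda>s t. sw (cR a) (\<lambda>u v. t \<cdot> v \<cdot> \<kappa> (T (s \<cdot> u))))"
      using R.cop_mult[OF bal[of \<one>], of "S y" a] by (simp add: colinear_counit[OF T])
    also have "\<dots> = sw (cL y) (\<lambda>z p. sw (cR a) (\<lambda>u v. S p \<cdot> v \<cdot> \<kappa> (T (S z \<cdot> u))))"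
      by (rule cop_S[OF balS])
    finally show ?thesis
      by (simp add: W_def R.mul_sw R.mul_assoc)
  qed
  let ?F = "\<lambda>x y z. x \<cdot> (S y \<cdot> W (S z))"
  have "sw (cR d) (\<lambda>x y. x \<cdot> T (S y \<cdot> a)) = sw (cR d) (\<lambda>x q. sw (cL q) (\<lambda>z y. ?F x y z))"
    by (simp add: TS R.mul_sw)
  also have "\<dots> = sw (cL d) (\<lambda>z p. sw (cR p) (\<lambda>x y. ?F x y z))"
  proof (rule RL[symmetric])
    show "R.bal (\<lambda>x y. ?F x y z)" for z
      by (rule R.balI) (simp_all add: R.mul_add R.add_mul S_add S_mul_\<kappa> R.mul_assoc)
    show "L.bal (\<lambda>z y. ?F x y z)" for x
      by (rule L.balI) (simp_all add: R.mul_add R.add_mul S_add S_mul S_\<tau> W_add R.mul_assoc flip: W_C)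
  qed
  also have "\<dots> = W (S (sw (cL d) (\<lambda>z p. Q p \<cdot> z)))"
    by (simp add: antipode_R_mul W_C L.P_in S_sw sw_hom[where h = W] W_add S_mul)
  also have "\<dots> = W (S d)"
    by (simp add: L.counit2)
  finally show ?thesis
    by (simp add: W_def)
qed

end

section \<open>Integrals obtained from a Frobenius functional\<close>

locale frobenius_hopf_algebroid = internal_hopf_algebroid mul one B C \<kappa> \<tau> cR cL P Q S
  for mul :: "'a::ab_group_add \<Rightarrow> 'a \<Rightarrow> 'a"  (infixl \<open>\<cdot>\<close> 70)
    and one :: 'a  (\<open>\<one>\<close>)
    and B C :: "'a set" and \<kappa> \<tau> :: "'a \<Rightarrow> 'a" and cR cL :: "'a \<Rightarrow> ('a \<times> 'a) list" and P Q :: "'a \<Rightarrow> 'a"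
    and S :: "'a \<Rightarrow> 'a" +
  fixes \<psi> :: "'a \<Rightarrow> 'a" and uv :: "('a \<times> 'a) list"
  assumes system: "R.frobenius_system \<psi> uv"
begin

lemmas \<psi>_right = R.frobenius_systemD(1)[OF system]
  and \<psi>_left = R.frobenius_systemD(2)[OF system]
  and expand_left = R.frobenius_systemD(3)[OF system]
  and expand_right = R.frobenius_systemD(4)[OF system]

lemmas \<psi>_simps = R.right_linearD[OF \<psi>_right] R.left_linearD(3)[OF \<psi>_left]

definition G :: "'a \<Rightarrow> 'a \<Rightarrow> 'a"
  where "G u = \<Gamma> (\<lambda>z. \<psi> (z \<cdot> u))"

lemma \<psi>_mul_left: "R.left_linear (\<lambda>z. \<psi> (z \<cdot> u))"
  by (simp add: R.left_linear_def \<psi>_simps R.add_mul R.mul_assoc)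

lemmas colinear_G = colinear_\<Gamma>[OF \<psi>_mul_left, folded G_def]

text \<open>The projection of \<open>\<A>\<^sup>*\<close> onto its coinvariants \<open>\<L>(\<A>\<^sup>*)\<close>, written \<open>S(\<phi>\<^sub>(\<^sub>-\<^sub>1\<^sub>)) \<cdot> \<phi>\<^sub>(\<^sub>0\<^sub>)\<close> in the theory of Hopf
  modules; the Frobenius system provides the dual basis that replaces the coaction.\<close>

definition E :: "('a \<Rightarrow> 'a) \<Rightarrow> 'a \<Rightarrow> 'a"
  where "E \<phi> a = sw uv (\<lambda>u v. P (G u (right_conv \<phi> (S (S v) \<cdot> a))))"

text \<open>The Frobenius expansion reassembles the leg \<open>x\<close> inside \<open>G u'\<close>,
  leaving the sum in \<open>antipode_\<Gamma>\<close>.\<close>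

lemma sum_S_G: "sw uv (\<lambda>u v. S (G u' v) \<cdot> G u z) = P (G u' z)"
proof -
  note G' = colinear_B_mul[OF colinear_G] colinear_sw[OF colinear_G]
  have "S (G u' v) \<cdot> G u z = sw (cL z) (\<lambda>y x. S (G u' (\<psi> (x \<cdot> u) \<cdot> v)) \<cdot> y)" for u v
    by (simp add: G_def[of u] \<Gamma>_def G' \<psi>_simps S_mul R.mul_sw R.mul_assoc)
  then have "sw uv (\<lambda>u v. S (G u' v) \<cdot> G u z) =
      sw (cL z) (\<lambda>y x. S (G u' (sw uv (\<lambda>u v. \<psi> (x \<cdot> u) \<cdot> v))) \<cdot> y)"
    by (simp add: sw_swap[of uv] G' S_sw R.sw_mul)
  also have "\<dots> = P (G u' z)"
    unfolding expand_left G_def by (rule antipode_\<Gamma>[OF \<psi>_mul_left])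
  finally show ?thesis .
qed

text \<open>\<open>colinear_conv_S\<close> and \<open>cop_S\<close> turn the convolution into a sum
  over the left coproduct of \<open>v\<close>. Expanding its leg \<open>x\<close> by the Frobenius
  system gives sums of \<open>S (G u' v) \<cdot> G u z\<close>, which \<open>sum_S_G\<close>
  evaluates.\<close>

lemma E_integral:
  assumes \<phi>: "R.right_linear \<phi>"
  shows "right_dual_integral (E \<phi>)"
  unfolding right_dual_integral_def
proof (intro conjI allI)
  let ?X = "right_conv \<phi>"
  have T: "colinear (\<lambda>x. G u (?X x))" for u
    by (rule colinear_comp[OF colinear_G colinear_right_conv[OF \<phi>]])
  note T' = colinearD(1,2)[OF T] colinear_B_mul[OF T] colinear_sw[OF T]
  show "R.right_linear (E \<phi>)"
    by (simp add: R.right_linear_def E_def R.mul_add T' R.P_add sw_add R.P_in R.B_sw R.P_mulB R.sw_mul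
        flip: R.mul_assoc)
  fix a
  have bal: "R.bal (\<lambda>x y. x \<cdot> G u (?X (S y \<cdot> a)))" for u
    by (rule R.balI) (simp_all add: R.add_mul R.mul_add T' S_add S_mul_\<kappa> R.mul_assoc)
  have "right_conv (E \<phi>) a = sw uv (\<lambda>u v. sw (cR a) (\<lambda>x y. y \<cdot> \<kappa> (G u (?X (S (S v) \<cdot> x)))))"
    by (simp add: right_conv_def[of "E \<phi>"] E_def sw_hom[where h = \<kappa>] R.\<kappa>_add R.\<kappa>_P R.mul_sw sw_swap[of uv])
  also have "\<dots> = sw uv (\<lambda>u v. sw (cL v) (\<lambda>y x. S y \<cdot> G u (?X (S (S x) \<cdot> a))))"
    by (simp add: colinear_conv_S[OF T] cop_S[OF bal])
  also have "\<dots> = sw uv (\<lambda>u v. sw uv (\<lambda>u' v'. S (G u' v) \<cdot> G u (?X (S (S v') \<cdot> a))))"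
  proof -
    have "sw (cL v) (\<lambda>y x. S y \<cdot> G u (?X (S (S x) \<cdot> a))) =
      sw uv (\<lambda>u' v'. S (G u' v) \<cdot> G u (?X (S (S v') \<cdot> a)))" for u v
    proof -
      have eq: "S y \<cdot> G u (?X (S (S x) \<cdot> a)) =
          sw uv (\<lambda>u' v'. S (S (\<psi> (x \<cdot> u')) \<cdot> y) \<cdot> G u (?X (S (S v') \<cdot> a)))" for x y
      proof -
        have "S y \<cdot> G u (?X (S (S x) \<cdot> a)) =
          S y \<cdot> G u (?X (S (S (sw uv (\<lambda>u' v'. \<psi> (x \<cdot> u') \<cdot> v'))) \<cdot> a))"
          by (simp only: expand_left)
        also have "\<dots> = sw uv (\<lambda>u' v'. S (S (\<psi> (x \<cdot> u')) \<cdot> y) \<cdot> G u (?X (S (S v') \<cdot> a)))"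
          by (simp add: S_sw S_mul R.sw_mul R.mul_sw T' S_B S_C \<psi>_simps R.mul_assoc)
        finally show ?thesis .
      qed
      have "sw (cL v) (\<lambda>y x. S y \<cdot> G u (?X (S (S x) \<cdot> a))) =
        sw uv (\<lambda>u' v'. sw (cL v) (\<lambda>y x. S (S (\<psi> (x \<cdot> u')) \<cdot> y) \<cdot> G u (?X (S (S v') \<cdot> a))))"
        by (rule trans[OF sw_cong sw_swap]) (rule eq)
      also have "\<dots> = sw uv (\<lambda>u' v'. S (G u' v) \<cdot> G u (?X (S (S v') \<cdot> a)))"
        by (simp only: G_def \<Gamma>_def S_sw R.sw_mul)
      finally show ?thesis .
    qed
    then show ?thesis by simp
  qed
  also have "\<dots> = sw uv (\<lambda>u' v'. sw uv (\<lambda>u v. S (G u' v) \<cdot> G u (?X (S (S v') \<cdot> a))))"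
    by (rule sw_swap)
  also have "\<dots> = E \<phi> a"
    by (simp add: E_def sum_S_G)
  finally show "right_conv (E \<phi>) a = E \<phi> a" .
qed

definition Y :: "'a \<Rightarrow> 'a \<Rightarrow> 'a"
  where "Y v = right_conv (\<lambda>b. \<psi> (v \<cdot> b))"

lemma colinear_Y: "colinear (Y v)"
  unfolding Y_def by (rule colinear_right_conv) (rule right_conv_linear_left[OF \<psi>_right])

text \<open>By \<open>RL\<close> the two convolutions act on different legs, which puts
  \<open>Y v\<close> inside the functional; the Frobenius expansion of the leg \<open>p\<close> then
  splits off \<open>G u\<close>.\<close>

lemma G_Y: "G u' (Y v a) = sw uv (\<lambda>u w. S (\<psi> (Y v w \<cdot> u')) \<cdot> G u a)"
proof -
  note Y' = colinear_B_mul[OF colinear_Y] colinear_sw[OF colinear_Y]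
  let ?h = "\<lambda>z. \<psi> (z \<cdot> u')"
  note h = R.left_linearD[OF \<psi>_mul_left[of u']]
  let ?F = "\<lambda>x y z. S (?h (y \<cdot> \<kappa> (\<psi> (v \<cdot> x)))) \<cdot> z"
  have bal: "L.bal (\<lambda>y x. S (?h x) \<cdot> y)"
    by (rule bal_\<Gamma>[OF \<psi>_mul_left])
  have "G u' (Y v a) = sw (cR a) (\<lambda>x q. sw (cL q) (\<lambda>z y. ?F x y z))"
    by (simp add: G_def \<Gamma>_def Y_def right_conv_def L.cop_sw[OF bal] L.cop_B_mul[OF bal] R.\<kappa>_in)
  also have "\<dots> = sw (cL a) (\<lambda>z p. sw (cR p) (\<lambda>x y. ?F x y z))"
  proof (rule RL[symmetric])
    show "R.bal (\<lambda>x y. ?F x y z)" for z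
    proof (rule R.balI)
      fix b x y assume b: "b \<in> B"
      have "\<kappa> (\<psi> (v \<cdot> (x \<cdot> b))) = \<kappa> b \<cdot> \<kappa> (\<psi> (v \<cdot> x))"
        using \<psi>_simps(3)[OF b, of "v \<cdot> x"] by (simp add: R.\<kappa>_mulB b R.mul_assoc)
      then show "?F (x \<cdot> b) y z = ?F x (y \<cdot> \<kappa> b) z"
        by (simp add: R.mul_assoc)
    qed (simp_all add: R.mul_add R.add_mul \<psi>_simps R.\<kappa>_add S_add)
    show "L.bal (\<lambda>z y. ?F x y z)" for x
      by (rule L.balI)
        (simp_all add: R.mul_add R.add_mul \<psi>_simps S_add S_mul S_\<tau> L.\<kappa>_in R.mul_assoc)
  qed
  also have "\<dots> = sw (cL a) (\<lambda>z p. S (?h (Y v p)) \<cdot> z)"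
    by (simp add: Y_def right_conv_def R.sw_mul \<psi>_simps S_sw)
  also have "\<dots> = sw (cL a) (\<lambda>z p. sw uv (\<lambda>u w. S (?h (Y v w)) \<cdot> (S (\<psi> (p \<cdot> u)) \<cdot> z)))"
  proof -
    have eq: "S (?h (Y v p)) = sw uv (\<lambda>u w. S (?h (Y v w)) \<cdot> S (\<psi> (p \<cdot> u)))" for p
    proof -
      have "S (?h (Y v p)) = S (?h (Y v (sw uv (\<lambda>u w. \<psi> (p \<cdot> u) \<cdot> w))))"
        by (simp only: expand_left)
      also have "\<dots> = sw uv (\<lambda>u w. S (?h (Y v w)) \<cdot> S (\<psi> (p \<cdot> u)))"
        by (simp add: Y' R.sw_mul \<psi>_simps S_sw S_mul R.mul_assoc)
      finally show ?thesis .
    qed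
    show ?thesis
      by (rule sw_cong, rule trans[OF arg_cong[OF eq, of "\<lambda>s. s \<cdot> _"]]) (simp only: R.sw_mul R.mul_assoc)
  qed
  also have "\<dots> = sw uv (\<lambda>u w. S (\<psi> (Y v w \<cdot> u')) \<cdot> G u a)"
    by (subst sw_swap) (simp only: G_def \<Gamma>_def R.mul_sw)
  finally show ?thesis .
qed

text \<open>The Frobenius expansion takes place inside the right coproduct of \<open>w\<close> and
  leaves \<open>antipode_R\<close>.\<close>

lemma sum_S_Y: "sw uv (\<lambda>u v. u \<cdot> S (Y v w)) = Q w"
proof -
  have "sw uv (\<lambda>u v. u \<cdot> S (Y v w)) = sw (cR w) (\<lambda>x y. sw uv (\<lambda>u v. u \<cdot> \<psi> (v \<cdot> x)) \<cdot> S y)"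
    by (simp add: Y_def right_conv_def S_sw S_mul S_\<kappa> \<psi>_simps R.mul_sw R.sw_mul R.mul_assoc sw_swap[of uv])
  then show ?thesis
    by (simp add: expand_right antipode_R)
qed

text \<open>The coefficient \<open>S (\<psi> x)\<close> is absorbed into \<open>Q\<close>, where the
  Frobenius expansion leaves the left counit identity.\<close>

lemma sum_Q_G: "sw uv (\<lambda>u v. Q v \<cdot> G u a) = a"
proof -
  have "Q v \<cdot> (S (\<psi> x) \<cdot> y) = Q (\<psi> x \<cdot> v) \<cdot> y" for v x y
    by (simp add: Q_B_mul \<psi>_simps R.mul_assoc)
  then have "sw uv (\<lambda>u v. Q v \<cdot> G u a) = sw (cL a) (\<lambda>y x. Q (sw uv (\<lambda>u v. \<psi> (x \<cdot> u) \<cdot> v)) \<cdot> y)"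
    by (simp add: G_def \<Gamma>_def R.mul_sw R.sw_mul sw_hom[where h = Q] L.P_add sw_swap[of uv])
  then show ?thesis
    by (simp add: expand_left L.counit2)
qed

lemma right_linear_\<psi>X: "R.right_linear (\<lambda>b. \<psi> (v \<cdot> right_conv \<psi> b))"
  by (simp add: R.right_linear_def \<psi>_simps R.mul_add right_conv_add[OF \<psi>_right] right_conv_B[OF \<psi>_right]
      flip: R.mul_assoc)

text \<open>The Hopf module decomposition of \<open>\<psi>\<close>: every summand is an integral
  evaluated at a translate of \<open>a\<close>. After \<open>G_Y\<close>, the inner sums collapse to
  \<open>Q w\<close> by \<open>sum_S_Y\<close> and the outer one by \<open>sum_Q_G\<close>.\<close>

lemma reconstruction:
  "sw uv (\<lambda>u v. E (\<lambda>b. \<psi> (v \<cdot> right_conv \<psi> b)) (S u \<cdot> a)) = \<psi> a"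
proof -
  let ?X = "right_conv \<psi>"
  have T: "colinear (\<lambda>x. G u (?X x))" for u
    by (rule colinear_comp[OF colinear_G colinear_right_conv[OF \<psi>_right]])
  note T' = colinearD(1,2)[OF T] colinear_B_mul[OF T] colinear_sw[OF T]
  have PT_sw: "P (G u (?X (sw xs g))) = sw xs (\<lambda>x y. P (G u (?X (g x y))))" for u xs and g :: "'a \<Rightarrow> 'a \<Rightarrow> 'a"
    by (simp add: T' sw_hom[where h = P] R.P_add)
  have X\<phi>: "right_conv (\<lambda>b. \<psi> (v \<cdot> ?X b)) b = Y v (?X b)" for v b
    unfolding Y_def right_conv_def[of "\<lambda>b. \<psi> (v \<cdot> ?X b)"] right_conv_def[of "\<lambda>b. \<psi> (v \<cdot> b)"]
    by (rule colinearD(3)[OF colinear_right_conv[OF \<psi>_right]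
          bal_right_conv[OF right_conv_linear_left[OF \<psi>_right]], symmetric])
  \<comment> \<open>Under \<open>P\<close> the coefficient from \<open>C\<close> may be replaced by
    its image in \<open>B\<close> under \<open>S\<close>, which passes through the colinear map into
    the argument.\<close>
  have "P (S (\<psi> (Y v w \<cdot> u')) \<cdot> G u2 (?X (S (S v') \<cdot> (S u \<cdot> a)))) =
    P (G u2 (?X (S (u \<cdot> S (\<psi> (Y v w \<cdot> u') \<cdot> v')) \<cdot> a)))" for u v u' v' u2 w
    by (simp add: P_C_mul S_B S_C \<psi>_simps S_mul R.mul_assoc flip: T')
  then have "sw uv (\<lambda>u v. E (\<lambda>b. \<psi> (v \<cdot> ?X b)) (S u \<cdot> a)) =
    sw uv (\<lambda>u v. sw uv (\<lambda>u' v'. sw uv (\<lambda>u2 w. P (G u2 (?X (S (u \<cdot> S (\<psi> (Y v w \<cdot> u') \<cdot> v')) \<cdot> a))))))"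
    by (simp add: E_def X\<phi> G_Y sw_hom[where h = P] R.P_add)
  also have "\<dots> = sw uv (\<lambda>u2 w. sw uv (\<lambda>u v. sw uv (\<lambda>u' v'. P (G u2 (?X (S (u \<cdot> S (\<psi> (Y v w \<cdot> u') \<cdot> v')) \<cdot> a))))))"
    by (subst (2) sw_swap) (rule sw_swap)
  also have "\<dots> = sw uv (\<lambda>u2 w. P (G u2 (?X (S (sw uv (\<lambda>u v. u \<cdot> S (sw uv (\<lambda>u' v'. \<psi> (Y v w \<cdot> u') \<cdot> v')))) \<cdot> a))))"
    by (simp only: PT_sw S_sw R.mul_sw R.sw_mul)
  also have "\<dots> = sw uv (\<lambda>u w. P (G u (?X (S (Q w) \<cdot> a))))"
    by (simp only: expand_left sum_S_Y)
  also have "\<dots> = P (sw uv (\<lambda>u w. Q w \<cdot> G u (?X a)))"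
    by (simp add: sw_hom[where h = P] R.P_add T' S_C L.P_in P_C_mul)
  also have "\<dots> = P (?X a)"
    by (simp only: sum_Q_G)
  \<comment> \<open>\<open>P_mul\<kappa>\<close> produces \<open>\<psi> x \<cdot> P y\<close>, and
    linearity draws the factor \<open>P y\<close> into \<open>\<psi>\<close>.\<close>
  also have "\<dots> = \<psi> (sw (cR a) (\<lambda>x y. x \<cdot> P y))"
    by (simp add: right_conv_def sw_hom[where h = P] R.P_add R.P_mul\<kappa> \<psi>_simps R.P_in)
  finally show ?thesis
    by (simp add: R.counit2)
qed

text \<open>A left factor from \<open>C\<close> enters the right coproduct on its first leg, just
  where the functional is evaluated.\<close>

lemma right_dual_integral_C:
  assumes f: "right_dual_integral f" and c: "c \<in> C"
  shows "right_dual_integral (\<lambda>a. f (c \<cdot> a))"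
proof -
  note f' = right_dual_integralD[OF f]
  have "right_conv (\<lambda>a. f (c \<cdot> a)) a = right_conv f (c \<cdot> a)" for a
    unfolding right_conv_def by (rule cop_C_mul[OF bal_right_conv[OF f'(1)] c, symmetric])
  then show ?thesis
    unfolding right_dual_integral_def using right_conv_linear_left[OF f'(1)] by (simp add: f'(3))
qed

lemma right_dual_integral_sw:
  assumes "\<And>u v. right_dual_integral (h u v)"
  shows "right_dual_integral (\<lambda>a. sw xs (\<lambda>u v. h u v a))"
proof -
  note h = right_dual_integralD[OF assms]
  note h' = R.right_linearD[OF h(1)]
  have "right_conv (\<lambda>a. sw xs (\<lambda>u v. h u v a)) a = sw xs (\<lambda>u v. right_conv (h u v) a)" for a
    by (simp add: right_conv_def sw_hom[where h = \<kappa>] R.\<kappa>_add R.mul_sw sw_swap[of "cR a"])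
  then show ?thesis
    by (simp add: right_dual_integral_def R.right_linear_def h' h(3) sw_add R.B_sw R.sw_mul)
qed

lemma exists_integral_pair:
  obtains f l where "right_dual_integral f" "left_integral l" "f l = \<one>" "\<And>a. \<psi> (a \<cdot> l) = \<tau> a"
proof -
  obtain l where l: "left_integral l" and \<psi>l: "\<And>a. \<psi> (a \<cdot> l) = \<tau> a"
    using frobenius_left_integral_B[OF system] by blast
  \<comment> \<open>The reconstruction of \<open>\<psi>\<close> with \<open>S u\<close> replaced by
    \<open>Q (S u)\<close>. At \<open>l\<close> both have the same value, and factors from
    \<open>C\<close> preserve the integral property.\<close>
  let ?f = "\<lambda>a. sw uv (\<lambda>u v. E (\<lambda>b. \<psi> (v \<cdot> right_conv \<psi> b)) (Q (S u) \<cdot> a))"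
  have "right_dual_integral ?f"
    by (intro right_dual_integral_sw right_dual_integral_C E_integral right_linear_\<psi>X L.P_in)
  moreover have "Q (S u) \<cdot> l = S u \<cdot> l" for u
    using l by (simp add: left_integral_def)
  then have "?f l = \<psi> (\<one> \<cdot> l)"
    by (simp add: reconstruction)
  then have "?f l = \<one>"
    unfolding \<psi>l by simp
  ultimately show thesis
    using that l \<psi>l by blast
qed

end

section \<open>From Frobenius extensions to a Frobenius integral, and the equivalence\<close>

context internal_hopf_algebroid
begin

interpretation C: base_ring mul one C
  using L.flip by simp

lemma extension_imp_frobenius_integral:
  assumes cond_extension
  shows "\<exists>f. frobenius_integral f"
proof -
  obtain \<psi> uv where \<psi>: "R.frobenius_system \<psi> uv"
    using assms unfolding cond_extension_def R.frobenius_def by blast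
  interpret frobenius_hopf_algebroid mul one B C \<kappa> \<tau> cR cL P Q S \<psi> uv
    by unfold_locales (rule \<psi>)
  obtain f l where f: "right_dual_integral f" and l: "left_integral l" and fl: "f l = \<one>"
    and \<psi>l: "\<And>a. \<psi> (a \<cdot> l) = \<tau> a"
    using exists_integral_pair by blast
  note f' = right_dual_integralD[OF f]
  note lin = R.right_linearD[OF f'(1)] R.left_linearD(3)[OF f'(2)]
  \<comment> \<open>The Casimir element of \<open>l\<close> with \<open>f\<close> applied to its
    second leg. Once \<open>c = \<one>\<close>, it completes \<open>f\<close> to a Frobenius
    system.\<close>
  define c where "c = sw (cR l) (\<lambda>x y. x \<cdot> f (S y))"
  have casimir: "sw (cR l) (\<lambda>x y. x \<cdot> f (S y \<cdot> a)) = a \<cdot> c" for a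
  proof -
    have "balanced (\<lambda>b x. x \<cdot> b) (\<lambda>b x. b \<cdot> x) B (\<lambda>x y. x \<cdot> f y)"
      by (simp add: balanced_def R.add_mul R.mul_add lin R.mul_assoc)
    from cop_integral_left[OF l this, of a] show ?thesis
      by (simp add: c_def R.mul_sw R.mul_assoc)
  qed
  have "f (z \<cdot> (x \<cdot> f y)) = f (f (z \<cdot> x) \<cdot> y)" for x y z
    by (simp add: lin flip: R.mul_assoc)
  then have "f (z \<cdot> sw (cR l) (\<lambda>x y. x \<cdot> f (S y \<cdot> \<one>))) = f (sw (cR l) (\<lambda>x y. f (z \<cdot> x) \<cdot> S y))" for z
    by (simp add: R.mul_sw lin)
  then have f_c: "f (z \<cdot> c) = f z" for z
    unfolding integral_pair_1[OF f l fl] casimir by simp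
  \<comment> \<open>\<open>\<kappa> \<circ> f \<circ> S\<close> is an integral of the left dual,
    which places \<open>c\<close> in \<open>C\<close>.\<close>
  have "left_conv (\<lambda>a. \<kappa> (f (S a))) l = \<kappa> (f (S l))"
    using left_dual_integral_S[OF f bij_is_inj[OF bij_S[OF f l fl]]] by (simp add: left_dual_integral_def)
  then have c: "c = \<kappa> (f (S l))"
    by (simp add: left_conv_def S_\<kappa> lin c_def)
  define e where "e = \<one> - c"
  have e: "e \<in> C"
    by (simp add: e_def c L.B_diff L.B_one R.\<kappa>_in)
  \<comment> \<open>\<open>l \<cdot> e\<close> is again a left integral, hence a multiple of
    \<open>l\<close> by an element of \<open>B\<close>; it vanishes because \<open>f\<close> kills
    it and \<open>f l = \<one>\<close>.\<close>
  have le: "l \<cdot> e = l \<cdot> \<psi> (l \<cdot> e)"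
  proof (rule left_integral_cyclic_B[OF \<psi> \<psi>l])
    show "left_integral (l \<cdot> e)"
      using l unfolding left_integral_def by (metis R.mul_assoc)
  qed
  have "f (l \<cdot> e) = 0"
    by (simp add: e_def R.mul_diff lin f_c)
  moreover have "f (l \<cdot> \<psi> (l \<cdot> e)) = \<psi> (l \<cdot> e)"
    by (simp add: lin \<psi>_simps fl)
  ultimately have "\<psi> (l \<cdot> e) = 0"
    using le by simp
  then have le0: "l \<cdot> e = 0"
    using le by simp
  \<comment> \<open>The Frobenius functional over \<open>C\<close> gives an integral
    \<open>l'\<close> with \<open>\<psi>' l' = \<one>\<close>. It is a multiple of \<open>l\<close>
    by an element of \<open>B\<close>, which commutes with \<open>e\<close>; so
    \<open>l' \<cdot> e = 0\<close>, and applying \<open>\<psi>'\<close> yields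
    \<open>e = 0\<close>.\<close>
  obtain \<psi>' uv' where \<psi>': "C.frobenius_system \<psi>' uv'"
    using assms unfolding cond_extension_def C_frobenius[symmetric] C.frobenius_def by blast
  obtain l' where l': "left_integral l'" and \<psi>l': "\<And>a. \<psi>' (a \<cdot> l') = Q a"
    using frobenius_left_integral_C[OF \<psi>'] by blast
  have "l' = l \<cdot> \<psi> l'"
    by (rule left_integral_cyclic_B[OF \<psi> \<psi>l l'])
  then have "l' \<cdot> e = l \<cdot> (\<psi> l' \<cdot> e)"
    by (metis R.mul_assoc)
  also have "\<dots> = l \<cdot> e \<cdot> \<psi> l'"
    by (simp add: R.BC_comm[OF \<psi>_simps(2) e] R.mul_assoc)
  also have "\<dots> = 0"
    by (simp add: le0)
  finally have "\<psi>' (l' \<cdot> e) = 0"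
    by (simp add: C.right_linearD(4)[OF C.frobenius_systemD(1)[OF \<psi>']])
  moreover have "\<psi>' (l' \<cdot> e) = Q \<one> \<cdot> e"
    using C.right_linearD(3)[OF C.frobenius_systemD(1)[OF \<psi>'] e, of l'] \<psi>l'[of \<one>] by simp
  ultimately have "c = \<one>"
    by (simp add: e_def)
  then have "R.frobenius_system f (map (\<lambda>(x, y). (x, S y)) (cR l))"
    using casimir integral_pair_1[OF f l fl] f'
    by (simp add: R.frobenius_system_def sw_def comp_def split_def)
  then show ?thesis
    using f unfolding frobenius_integral_def by blast
qed

definition conditions :: bool
  where "conditions \<longleftrightarrow> cond_extension \<and> cond_right_dual \<and> cond_left_dual \<and> cond_integral"

lemma conditions_equivalent:
  "cond_extension = conditions" "cond_right_dual = conditions"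
  "cond_left_dual = conditions" "cond_integral = conditions"
proof -
  have "conditions" if "frobenius_integral f" for f
    using frobenius_integral_consequences[OF that] frobenius_integral_iff that
    unfolding conditions_def by blast
  moreover have "\<exists>f. frobenius_integral f"
    if "cond_extension \<or> cond_right_dual \<or> cond_left_dual \<or> cond_integral"
    using that frobenius_integral_iff extension_imp_frobenius_integral left_dual_imp_extension
      integral_imp_right_dual by blast
  ultimately show "cond_extension = conditions" "cond_right_dual = conditions"
    "cond_left_dual = conditions" "cond_integral = conditions"
    unfolding conditions_def by blast+
qed

end


section \<open>Tensors as lists of pairs\<close>

lemma int_times_diff: "int_times (int a - int b) x = (\<Sum>i<a. x) - (\<Sum>i<b. x)"
proof -
  have *: "(\<Sum>i<m + n. x) = (\<Sum>i<m. x) + (\<Sum>i<n. x)" for m n :: nat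
    by (induction n) (simp_all add: add_ac)
  show ?thesis
  proof (cases "b \<le> a")
    case True
    then show ?thesis
      using *[of b "a - b"] by (simp add: int_times_def nat_diff_distrib')
  next
    case False
    then show ?thesis
      using *[of a "b - a"] by (simp add: int_times_def nat_diff_distrib')
  qed
qed

lemma int_times_add: "int_times (m + n) x = int_times m x + int_times n x"
proof -
  obtain a b c d where "m = int a - int b" "n = int c - int d"
    by (meson int_diff_cases)
  moreover have "(\<Sum>i<a + c. x) = (\<Sum>i<a. x) + (\<Sum>i<c. x)" for a c :: nat
    by (induction c) (simp_all add: add_ac)
  moreover have "int a - int b + (int c - int d) = int (a + c) - int (b + d)"
    by simp
  ultimately show ?thesis
    by (simp only: int_times_diff) (simp add: algebra_simps)
qed

text \<open>The homomorphism on the free abelian group that extends \<open>f\<close>; at a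
  representative of a tensor it gives \<open>sweedler\<close>.\<close>

definition frag_eval :: "('x \<Rightarrow> 'b::ab_group_add) \<Rightarrow> ('x \<Rightarrow>\<^sub>0 int) \<Rightarrow> 'b"
  where "frag_eval f x = (\<Sum>p\<in>Poly_Mapping.keys x. int_times (Poly_Mapping.lookup x p) (f p))"

lemma int_times_0 [simp]: "int_times 0 x = 0" and int_times_1 [simp]: "int_times 1 x = x"
  by (simp_all add: int_times_def)

lemma frag_eval_superset:
  assumes "finite K" "Poly_Mapping.keys x \<subseteq> K"
  shows "frag_eval f x = (\<Sum>p\<in>K. int_times (Poly_Mapping.lookup x p) (f p))"
  unfolding frag_eval_def
  by (rule sum.mono_neutral_left) (use assms in \<open>auto simp: in_keys_iff\<close>)

lemma frag_eval_add: "frag_eval f (x + y) = frag_eval f x + frag_eval f y"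
proof -
  let ?K = "Poly_Mapping.keys x \<union> Poly_Mapping.keys y"
  have "frag_eval f z = (\<Sum>p\<in>?K. int_times (Poly_Mapping.lookup z p) (f p))" if "z \<in> {x, y, x + y}" for z
    by (rule frag_eval_superset) (use that Poly_Mapping.keys_add[of x y] in auto)
  then show ?thesis
    by (simp add: lookup_add int_times_add sum.distrib)
qed

lemma frag_eval_of [simp]: "frag_eval f (frag_of p) = f p"
  by (simp add: frag_eval_def)

lemma frag_eval_0 [simp]: "frag_eval f 0 = 0"
  by (simp add: frag_eval_def)

lemma frag_eval_diff: "frag_eval f (x - y) = frag_eval f x - frag_eval f y"
  by (rule additive_diff) (rule frag_eval_add)

lemma frag_eval_extend: "frag_eval f (frag_extend g x) = frag_eval (\<lambda>p. frag_eval f (g p)) x"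
  by (induction x rule: frag_induction[OF subset_UNIV])
    (simp_all add: frag_extend_diff frag_eval_diff)

lemma frag_eval_cmul:
  assumes "frag_eval f x = 0"
  shows "frag_eval f (frag_cmul c x) = 0"
proof (induction c rule: int_induct[where k = 0])
  case (step1 i)
  then show ?case
    using assms by (simp add: frag_cmul_distrib frag_eval_add)
next
  case (step2 i)
  have "frag_cmul (i - 1) x = frag_cmul i x - x"
    using frag_cmul_distrib[of "i - 1" 1 x] by simp
  then show ?case
    using assms step2 by (simp add: frag_eval_diff)
qed simp

lemma frag_eval_span:
  assumes "x \<in> module.span frag_cmul X" and "\<And>y. y \<in> X \<Longrightarrow> frag_eval f y = 0"
  shows "frag_eval f x = 0"
proof -
  interpret Z: module "frag_cmul :: int \<Rightarrow> ('x \<Rightarrow>\<^sub>0 int) \<Rightarrow> ('x \<Rightarrow>\<^sub>0 int)"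
    by unfold_locales (simp_all add: frag_cmul_distrib frag_cmul_distrib2)
  show ?thesis
    by (rule Z.span_induct[OF assms(1)])
      (use assms(2) in \<open>auto simp: Z.subspace_def frag_eval_add frag_eval_cmul\<close>)
qed

lemma zero_in_span: "0 \<in> module.span frag_cmul (X :: ('x \<Rightarrow>\<^sub>0 int) set)"
proof -
  interpret Z: module "frag_cmul :: int \<Rightarrow> ('x \<Rightarrow>\<^sub>0 int) \<Rightarrow> ('x \<Rightarrow>\<^sub>0 int)"
    by unfold_locales (simp_all add: frag_cmul_distrib frag_cmul_distrib2)
  show ?thesis by (rule Z.span_zero)
qed

lemma frag_eval_tensor_null:
  assumes "balanced \<rho> \<mu> UNIV f" and "x \<in> tensor_null \<rho> \<mu>"
  shows "frag_eval (\<lambda>(x, y). f x y) x = 0"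
  using assms(2) unfolding tensor_null_def
  by (rule frag_eval_span) (use assms(1) in \<open>auto simp: balanced_def frag_eval_diff\<close>)

lemma frag_eval_tensor_null3:
  assumes "\<And>z. balanced \<rho> \<mu> UNIV (\<lambda>x y. F x y z)" and "\<And>x. balanced \<rho>' \<mu>' UNIV (F x)"
    and "x \<in> tensor_null3 \<rho> \<mu> \<rho>' \<mu>'"
  shows "frag_eval (\<lambda>(x, y, z). F x y z) x = 0"
  using assms(3) unfolding tensor_null3_def
  by (rule frag_eval_span) (use assms(1,2) in \<open>auto simp: balanced_def frag_eval_diff\<close>)

lemma frag_eval_coset_eq:
  assumes "x +o N = y +o N" "0 \<in> N" "\<And>n. n \<in> N \<Longrightarrow> frag_eval f n = 0"
  shows "frag_eval f x = frag_eval f y"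
proof -
  have "x \<in> y +o N"
    using assms(1,2) by (auto simp: elt_set_plus_def)
  then show ?thesis
    using assms(3) by (auto simp: elt_set_plus_def frag_eval_add)
qed

lemma frag_eval_coset:
  assumes "balanced \<rho> \<mu> UNIV f" "x +o tensor_null \<rho> \<mu> = y +o tensor_null \<rho> \<mu>"
  shows "frag_eval (\<lambda>(x, y). f x y) x = frag_eval (\<lambda>(x, y). f x y) y"
  by (rule frag_eval_coset_eq[OF assms(2)])
    (use frag_eval_tensor_null[OF assms(1)] zero_in_span in \<open>auto simp: tensor_null_def\<close>)

lemma frag_eval_coset3:
  assumes "\<And>z. balanced \<rho> \<mu> UNIV (\<lambda>x y. F x y z)" and "\<And>x. balanced \<rho>' \<mu>' UNIV (F x)"
    and "x +o tensor_null3 \<rho> \<mu> \<rho>' \<mu>' = y +o tensor_null3 \<rho> \<mu> \<rho>' \<mu>'"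
  shows "frag_eval (\<lambda>(x, y, z). F x y z) x = frag_eval (\<lambda>(x, y, z). F x y z) y"
  by (rule frag_eval_coset_eq[OF assms(3)])
    (use frag_eval_tensor_null3[OF assms(1,2)] zero_in_span in \<open>auto simp: tensor_null3_def\<close>)

text \<open>With the empty set of scalars, balancedness reduces to additivity in both arguments; the
  type \<open>unit\<close> is a dummy.\<close>

abbreviation biadditive :: "('a::ab_group_add \<Rightarrow> 'a \<Rightarrow> 'a) \<Rightarrow> bool"
  where "biadditive \<equiv> balanced (\<lambda>(_ :: unit) x. x) (\<lambda>_ x. x) {}"

lemma biadditiveI: "balanced \<rho> \<mu> D f \<Longrightarrow> biadditive f"
  by (simp add: balanced_def)

text \<open>Signs are absorbed by negating first entries and multiplicities by repeating
  pairs.\<close>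

lemma ex_tensor_list:
  "\<exists>xs. \<forall>f :: 'a::ab_group_add \<Rightarrow> 'a \<Rightarrow> 'a. biadditive f \<longrightarrow> sw xs f = frag_eval (\<lambda>(x, y). f x y) X"
  (is "\<exists>xs. ?P xs X")
proof (induction X rule: frag_induction[OF subset_UNIV])
  show "\<exists>xs. ?P xs 0"
    by (rule exI[of _ "[]"]) simp
  show "\<exists>xs. ?P xs (frag_of p)" for p
    by (rule exI[of _ "[p]"]) (simp add: split_def)
  show "\<exists>xs. ?P xs (X - Y)" if XY: "\<exists>xs. ?P xs X" "\<exists>ys. ?P ys Y" for X Y
  proof -
    from XY obtain xs ys where xs: "?P xs X" and ys: "?P ys Y"
      by blast
    have "sw (map (\<lambda>(x, y). (- x, y)) ys) f = - sw ys f" if "biadditive f" for f :: "'a \<Rightarrow> 'a \<Rightarrow> 'a"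
    proof -
      have "f (- x) y = - f x y" for x y
        using additive_diff[of "\<lambda>x. f x y" 0 x] additive_0[of "\<lambda>x. f x y"] that
        by (simp add: balanced_def)
      then show ?thesis
        by (induction ys) (auto simp: split_def)
    qed
    with xs ys have "?P (xs @ map (\<lambda>(x, y). (- x, y)) ys) (X - Y)"
      by (simp add: frag_eval_diff)
    then show ?thesis by blast
  qed
qed

definition tensor_list :: "('a::ab_group_add \<times> 'a \<Rightarrow>\<^sub>0 int) set \<Rightarrow> ('a \<times> 'a) list"
  where "tensor_list X = (SOME xs. \<forall>f :: 'a \<Rightarrow> 'a \<Rightarrow> 'a. biadditive f \<longrightarrow>
    sw xs f = frag_eval (\<lambda>(x, y). f x y) (rep X))"

lemma sw_tensor_list: "biadditive f \<Longrightarrow> sw (tensor_list X) f = frag_eval (\<lambda>(x, y). f x y) (rep X)"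
  using someI_ex[OF ex_tensor_list, of "rep X"] unfolding tensor_list_def by blast

lemma sw_tensor_list_sweedler: "biadditive f \<Longrightarrow> sw (tensor_list X) f = sweedler X f"
  by (simp add: sw_tensor_list sweedler_def frag_eval_def split_def)

section \<open>Coproducts with values in a tensor product\<close>

locale tensor_coproduct =
  fixes \<rho> \<mu> :: "'b \<Rightarrow> 'a::unital_ring \<Rightarrow> 'a" and \<gamma> :: "'a \<Rightarrow> ('a \<times> 'a \<Rightarrow>\<^sub>0 int) set"
  assumes coset: "\<gamma> a \<in> range (\<lambda>x. x +o tensor_null \<rho> \<mu>)"
    and coset_add: "\<gamma> (a + a') = \<gamma> a + \<gamma> a'"
begin

lemma rep_in: "rep (\<gamma> a) \<in> \<gamma> a"
proof -
  obtain x where "\<gamma> a = x +o tensor_null \<rho> \<mu>"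
    using coset by blast
  then have "x \<in> \<gamma> a"
    using zero_in_span by (force simp: elt_set_plus_def tensor_null_def)
  then show ?thesis
    unfolding rep_def by (rule someI)
qed

lemma frag_eval_in:
  fixes f :: "'a \<Rightarrow> 'a \<Rightarrow> 'a"
  assumes f: "balanced \<rho> \<mu> UNIV f" and "x \<in> \<gamma> a" "y \<in> \<gamma> a"
  shows "frag_eval (\<lambda>(x, y). f x y) x = frag_eval (\<lambda>(x, y). f x y) y"
proof -
  obtain z where "\<gamma> a = z +o tensor_null \<rho> \<mu>"
    using coset by blast
  then show ?thesis
    using assms frag_eval_tensor_null[OF f] by (auto simp: elt_set_plus_def frag_eval_add)
qed

lemma sw_in:
  fixes f :: "'a \<Rightarrow> 'a \<Rightarrow> 'a"
  assumes f: "balanced \<rho> \<mu> UNIV f" and "x \<in> \<gamma> a"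
  shows "sw (tensor_list (\<gamma> a)) f = frag_eval (\<lambda>(x, y). f x y) x"
  using frag_eval_in[OF f rep_in assms(2)] sw_tensor_list[OF biadditiveI[OF f]] by simp

lemma sw_coset:
  fixes f :: "'a \<Rightarrow> 'a \<Rightarrow> 'a"
  assumes f: "balanced \<rho> \<mu> UNIV f" and "\<gamma> a = x +o tensor_null \<rho> \<mu>"
  shows "sw (tensor_list (\<gamma> a)) f = frag_eval (\<lambda>(x, y). f x y) x"
  by (rule sw_in[OF f]) (use assms(2) zero_in_span in \<open>force simp: elt_set_plus_def tensor_null_def\<close>)

lemma sw_add_arg:
  fixes f :: "'a \<Rightarrow> 'a \<Rightarrow> 'a"
  assumes f: "balanced \<rho> \<mu> UNIV f"
  shows "sw (tensor_list (\<gamma> (a + a'))) f = sw (tensor_list (\<gamma> a)) f + sw (tensor_list (\<gamma> a')) f"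
proof -
  have "rep (\<gamma> a) + rep (\<gamma> a') \<in> \<gamma> (a + a')"
    unfolding coset_add by (rule set_plus_intro) (rule rep_in)+
  from sw_in[OF f this] show ?thesis
    by (simp add: frag_eval_add sw_tensor_list[OF biadditiveI[OF f]])
qed

lemma frag_eval_tensor_map:
  fixes f :: "'a \<Rightarrow> 'a \<Rightarrow> 'a"
  assumes "biadditive (\<lambda>x y. f (g x) (h y))"
  shows "frag_eval (\<lambda>(x, y). f x y) (tensor_map g h X) = sw (tensor_list X) (\<lambda>x y. f (g x) (h y))"
  by (simp add: sw_tensor_list[OF assms] tensor_map_def frag_eval_extend split_def)

lemma sw_map:
  fixes f :: "'a \<Rightarrow> 'a \<Rightarrow> 'a"
  assumes f: "balanced \<rho> \<mu> UNIV f" and "\<gamma> a = tensor_map g h (\<gamma> b) +o tensor_null \<rho> \<mu>"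
    and "biadditive (\<lambda>x y. f (g x) (h y))"
  shows "sw (tensor_list (\<gamma> a)) f = sw (tensor_list (\<gamma> b)) (\<lambda>x y. f (g x) (h y))"
  using sw_coset[OF f assms(2)] frag_eval_tensor_map[where f = f and g = g and h = h, OF assms(3)] by simp

lemma sw_map_eq:
  fixes f :: "'a \<Rightarrow> 'a \<Rightarrow> 'a"
  assumes f: "balanced \<rho> \<mu> UNIV f"
    and "tensor_map g h (\<gamma> b) +o tensor_null \<rho> \<mu> = tensor_map g' h' (\<gamma> b) +o tensor_null \<rho> \<mu>"
    and "biadditive (\<lambda>x y. f (g x) (h y))" "biadditive (\<lambda>x y. f (g' x) (h' y))"
  shows "sw (tensor_list (\<gamma> b)) (\<lambda>x y. f (g x) (h y)) = sw (tensor_list (\<gamma> b)) (\<lambda>x y. f (g' x) (h' y))"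
  using frag_eval_coset[OF f assms(2)]
    frag_eval_tensor_map[where f = f and g = g and h = h, OF assms(3)]
    frag_eval_tensor_map[where f = f and g = g' and h = h', OF assms(4)]
  by simp

lemma sw_mult:
  fixes f :: "'a \<Rightarrow> 'a \<Rightarrow> 'a"
  assumes f: "balanced \<rho> \<mu> UNIV f" and eq: "\<gamma> (a * a') = tensor_mult (\<gamma> a) (\<gamma> a') +o tensor_null \<rho> \<mu>"
  shows "sw (tensor_list (\<gamma> (a * a'))) f =
    sw (tensor_list (\<gamma> a)) (\<lambda>x y. sw (tensor_list (\<gamma> a')) (\<lambda>x' y'. f (x * x') (y * y')))"
proof -
  have bi: "biadditive (\<lambda>x' y'. f (x * x') (y * y'))" for x y
    using f by (simp add: balanced_def distrib_left)
  have bi': "biadditive (\<lambda>x y. sw (tensor_list (\<gamma> a')) (\<lambda>x' y'. f (x * x') (y * y')))"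
    using f by (simp add: balanced_def distrib_right sw_add)
  show ?thesis
    unfolding sw_coset[OF f eq] sw_tensor_list[OF bi']
    by (simp add: sw_tensor_list[OF bi] tensor_mult_def frag_eval_extend split_def)
qed

end

lemma frag_eval_apply_first:
  fixes F :: "'a::unital_ring \<Rightarrow> 'a \<Rightarrow> 'a \<Rightarrow> 'a"
  assumes "tensor_coproduct \<rho> \<mu> \<gamma>"
    and F: "\<And>z. balanced \<rho> \<mu> UNIV (\<lambda>x y. F x y z)" "\<And>x y. Modules.additive (F x y)"
  shows "frag_eval (\<lambda>(x, y, z). F x y z) (apply_first \<gamma> X) =
    sw (tensor_list X) (\<lambda>p z. sw (tensor_list (\<gamma> p)) (\<lambda>x y. F x y z))"
proof -
  interpret tensor_coproduct \<rho> \<mu> \<gamma> by fact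
  have bi: "biadditive (\<lambda>p z. sw (tensor_list (\<gamma> p)) (\<lambda>x y. F x y z))"
    using sw_add_arg[OF F(1)] additive.add[OF F(2)] by (simp add: balanced_def sw_add)
  show ?thesis
    unfolding sw_tensor_list[OF bi]
    by (simp add: sw_tensor_list[OF biadditiveI[OF F(1)]] apply_first_def frag_eval_extend split_def)
qed

lemma frag_eval_apply_second:
  fixes F :: "'a::unital_ring \<Rightarrow> 'a \<Rightarrow> 'a \<Rightarrow> 'a"
  assumes "tensor_coproduct \<rho> \<mu> \<gamma>"
    and F: "\<And>x. balanced \<rho> \<mu> UNIV (F x)" "\<And>y z. Modules.additive (\<lambda>x. F x y z)"
  shows "frag_eval (\<lambda>(x, y, z). F x y z) (apply_second \<gamma> X) =
    sw (tensor_list X) (\<lambda>x q. sw (tensor_list (\<gamma> q)) (F x))"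
proof -
  interpret tensor_coproduct \<rho> \<mu> \<gamma> by fact
  have "F (x + x') = (\<lambda>y z. F x y z + F x' y z)" for x x'
    by (intro ext) (rule additive.add[OF F(2)])
  then have bi: "biadditive (\<lambda>x q. sw (tensor_list (\<gamma> q)) (F x))"
    using sw_add_arg[OF F(1)] by (simp add: balanced_def sw_add)
  show ?thesis
    unfolding sw_tensor_list[OF bi]
    by (simp add: sw_tensor_list[OF biadditiveI[OF F(1)]] apply_second_def frag_eval_extend split_def)
qed

text \<open>Two coproducts are allowed to differ here, so that coassociativity and the mixed laws
  are covered alike.\<close>

lemma sw_coassoc:
  fixes F :: "'a::unital_ring \<Rightarrow> 'a \<Rightarrow> 'a \<Rightarrow> 'a"
  assumes 1: "tensor_coproduct \<rho> \<mu> \<gamma>" and 2: "tensor_coproduct \<rho>' \<mu>' \<gamma>'"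
    and F1: "\<And>z. balanced \<rho> \<mu> UNIV (\<lambda>x y. F x y z)" and F2: "\<And>x. balanced \<rho>' \<mu>' UNIV (F x)"
    and eq: "apply_first \<gamma> X +o tensor_null3 \<rho> \<mu> \<rho>' \<mu>' = apply_second \<gamma>' Y +o tensor_null3 \<rho> \<mu> \<rho>' \<mu>'"
  shows "sw (tensor_list X) (\<lambda>p z. sw (tensor_list (\<gamma> p)) (\<lambda>x y. F x y z)) =
    sw (tensor_list Y) (\<lambda>x q. sw (tensor_list (\<gamma>' q)) (F x))"
proof -
  have "Modules.additive (F x y)" "Modules.additive (\<lambda>x. F x y z)" for x y z
    using F1 F2 by (auto simp: balanced_def additive_def)
  then show ?thesis
    using frag_eval_coset3[OF F1 F2 eq] frag_eval_apply_first[where X = X, OF 1 F1]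
      frag_eval_apply_second[where X = Y, OF 2 F2] by simp
qed


section \<open>From the given structures to the internal ones\<close>

lemma algebra_homD:
  assumes "algebra_hom scB scA s"
  shows "s (x + y) = s x + s y" "s 1 = 1" "s (x * y) = s x * s y" "s 0 = 0" "s (x - y) = s x - s y"
  using assms by (auto simp: algebra_hom_def additive.add additive.zero additive.diff)

lemma algebra_hom_oppD:
  assumes "algebra_hom (opp_scale scB) scA (t \<circ> unopp)"
  shows "t (x + y) = t x + t y" "t 1 = 1" "t (x * y) = t y * t x" "t 0 = 0" "t (x - y) = t x - t y"
  using algebra_homD(1,5)[OF assms, of "Opp x" "Opp y"] algebra_homD(3)[OF assms, of "Opp y" "Opp x"]
    algebra_homD(2,4)[OF assms]
  by (simp_all add: plus_opp_def one_opp_def times_opp_def zero_opp_def minus_opp_def)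

context right_bialgebroid
begin

lemmas src_simps = algebra_homD[OF src_hom] and tgt_simps = algebra_hom_oppD[OF tgt_hom]

lemma cou_mult_src: "cou BR (a * src BR r) = cou BR a * r"
  and cou_mult_tgt: "cou BR (a * tgt BR r) = r * cou BR a"
  using cou_bimodule[of a r 1] cou_bimodule[of a 1 r] by (simp_all add: src_simps tgt_simps)

lemma cou_src_id: "cou BR (src BR r) = r" and cou_tgt_id: "cou BR (tgt BR r) = r"
  using cou_mult_src[of 1 r] cou_mult_tgt[of 1 r] by (simp_all add: cou_one)

sublocale T: tensor_coproduct "\<lambda>r a. a * src BR r" "\<lambda>r a. a * tgt BR r" "cop BR"
  using cop_tensor cop_add by unfold_locales (simp_all add: null_R_def)

text \<open>\<open>tgt BR \<circ> cou BR\<close> sends \<open>src BR r\<close> to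
  \<open>tgt BR r\<close>, so scalars from the image act as scalars from the base do.\<close>

lemma balanced_range:
  "balanced (\<lambda>b x. x * b) (\<lambda>b x. x * tgt BR (cou BR b)) (range (src BR)) f \<longleftrightarrow>
    balanced (\<lambda>r a. a * src BR r) (\<lambda>r a. a * tgt BR r) UNIV f"
  by (simp add: balanced_def cou_src_id)

lemma internal_right_bialgebroid: "internal_right_bialgebroid (*) 1 (range (src BR)) (range (tgt BR)) (\<lambda>a. tgt BR (cou BR a))
  (\<lambda>a. tensor_list (cop BR a)) (\<lambda>a. src BR (cou BR a))"
proof (unfold_locales, unfold balanced_range)
  show "1 \<in> range (src BR)"
    by (metis src_simps(2) rangeI)
  show "x - y \<in> range (src BR)" "x * y \<in> range (src BR)" if "x \<in> range (src BR)" "y \<in> range (src BR)" for x y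
    using that by (auto simp flip: src_simps)
  fix f :: "'a \<Rightarrow> 'a \<Rightarrow> 'a" and x y b
  assume f: "balanced (\<lambda>r a. a * src BR r) (\<lambda>r a. a * tgt BR r) UNIV f"
  show "sw (tensor_list (cop BR (x + y))) f = sw (tensor_list (cop BR x)) f + sw (tensor_list (cop BR y)) f"
    by (rule T.sw_add_arg[OF f])
  show "sw (tensor_list (cop BR 1)) f = f 1 1"
    using T.sw_coset[OF f cop_one[unfolded null_R_def]] by simp
  show "sw (tensor_list (cop BR (x * y))) f = sw (tensor_list (cop BR x))
      (\<lambda>x1 x2. sw (tensor_list (cop BR y)) (\<lambda>y1 y2. f (x1 * y1) (x2 * y2)))"
    by (rule T.sw_mult[OF f cop_mult[unfolded null_R_def]])
  have bi: "biadditive f"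
    by (rule biadditiveI[OF f])
  have bi1: "biadditive (\<lambda>x y. f (x * u) (y * v))" "biadditive (\<lambda>x y. f (u * x) (v * y))"
    and bi2: "biadditive (\<lambda>x y. f x (y * v))" "biadditive (\<lambda>x y. f x (v * y))"
    and bi3: "biadditive (\<lambda>x y. f (x * u) y)" "biadditive (\<lambda>x y. f (u * x) y)" for u v
    using bi by (simp_all add: balanced_def distrib_left distrib_right)
  assume "b \<in> range (src BR)"
  then obtain r where r: "b = src BR r" by blast
  show "sw (tensor_list (cop BR (x * b))) f = sw (tensor_list (cop BR x)) (\<lambda>x1 x2. f x1 (x2 * b))"
    using T.sw_map[OF f cop_bimodule[of x r 1, unfolded null_R_def] bi1(1)]
    by (simp add: r tgt_simps)
  show "sw (tensor_list (cop BR (x * tgt BR (cou BR b)))) f =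
      sw (tensor_list (cop BR x)) (\<lambda>x1. f (x1 * tgt BR (cou BR b)))"
    using T.sw_map[OF f cop_bimodule[of x 1 r, unfolded null_R_def] bi1(1)]
    by (simp add: r src_simps cou_src_id)
  show "sw (tensor_list (cop BR x)) (\<lambda>x1. f (b * x1)) =
      sw (tensor_list (cop BR x)) (\<lambda>x1 x2. f x1 (tgt BR (cou BR b) * x2))"
    using T.sw_map_eq[OF f takeuchi[of r x, unfolded null_R_def] bi3(2) bi2(2)]
    by (simp add: r cou_src_id)
next
  fix F :: "'a \<Rightarrow> 'a \<Rightarrow> 'a \<Rightarrow> 'a" and a
  assume "\<And>z. balanced (\<lambda>r a. a * src BR r) (\<lambda>r a. a * tgt BR r) UNIV (\<lambda>x y. F x y z)"
    "\<And>x. balanced (\<lambda>r a. a * src BR r) (\<lambda>r a. a * tgt BR r) UNIV (F x)"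
  from sw_coassoc[OF T.tensor_coproduct_axioms T.tensor_coproduct_axioms this coassoc[of a, unfolded null_RR_def]]
  show "sw (tensor_list (cop BR a)) (\<lambda>p z. sw (tensor_list (cop BR p)) (\<lambda>x y. F x y z)) =
    sw (tensor_list (cop BR a)) (\<lambda>x q. sw (tensor_list (cop BR q)) (F x))" .
next
  fix a
  show "sw (tensor_list (cop BR a)) (\<lambda>x y. y * tgt BR (cou BR x)) = a"
    using counit_left[of a]
    by (subst sw_tensor_list_sweedler) (simp_all add: balanced_def distrib_left distrib_right cou_add tgt_simps)
  show "sw (tensor_list (cop BR a)) (\<lambda>x y. x * src BR (cou BR y)) = a"
    using counit_right[of a]
    by (subst sw_tensor_list_sweedler) (simp_all add: balanced_def distrib_left distrib_right cou_add src_simps)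
qed (auto simp: mult.assoc distrib_left distrib_right src_tgt_commute cou_add cou_src_id cou_tgt_id
    cou_mult_src cou_mult_tgt cou_src cou_tgt src_simps tgt_simps)

end

context left_bialgebroid
begin

lemmas src_simps = algebra_homD[OF src_hom] and tgt_simps = algebra_hom_oppD[OF tgt_hom]

lemma cou_src_mult: "cou BL (src BL l * a) = l * cou BL a"
  and cou_tgt_mult: "cou BL (tgt BL l * a) = cou BL a * l"
  using cou_bimodule[of l 1 a] cou_bimodule[of 1 l a] by (simp_all add: src_simps tgt_simps)

lemma cou_src_id: "cou BL (src BL l) = l" and cou_tgt_id: "cou BL (tgt BL l) = l"
  using cou_src_mult[of l 1] cou_tgt_mult[of l 1] by (simp_all add: cou_one)

sublocale T: tensor_coproduct "\<lambda>l a. tgt BL l * a" "\<lambda>l a. src BL l * a" "cop BL"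
  using cop_tensor cop_add by unfold_locales (simp_all add: null_L_def)

lemma sw_swap_pairs: "sw (map prod.swap xs) f = sw xs (\<lambda>x y. f y x)"
  by (simp add: sw_def comp_def)

lemma balanced_range:
  "balanced (\<lambda>b x. b * x) (\<lambda>b x. tgt BL (cou BL b) * x) (range (src BL)) f \<longleftrightarrow>
    balanced (\<lambda>l a. tgt BL l * a) (\<lambda>l a. src BL l * a) UNIV (\<lambda>x y. f y x)"
  by (auto simp: balanced_def cou_src_id)

lemma internal_right_bialgebroid: "internal_right_bialgebroid (\<lambda>x y. y * x) 1 (range (src BL)) (range (tgt BL)) (\<lambda>a. tgt BL (cou BL a))
  (\<lambda>a. map prod.swap (tensor_list (cop BL a))) (\<lambda>a. src BL (cou BL a))"
proof (unfold_locales, unfold balanced_range sw_swap_pairs)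
  show "1 \<in> range (src BL)"
    by (metis src_simps(2) rangeI)
  show "x - y \<in> range (src BL)" "y * x \<in> range (src BL)" if "x \<in> range (src BL)" "y \<in> range (src BL)" for x y
    using that by (auto simp flip: src_simps)
  fix f :: "'a \<Rightarrow> 'a \<Rightarrow> 'a" and x y b
  let ?f = "\<lambda>x y. f y x"
  assume f: "balanced (\<lambda>l a. tgt BL l * a) (\<lambda>l a. src BL l * a) UNIV ?f"
  show "sw (tensor_list (cop BL (x + y))) ?f = sw (tensor_list (cop BL x)) ?f + sw (tensor_list (cop BL y)) ?f"
    by (rule T.sw_add_arg[OF f])
  show "sw (tensor_list (cop BL 1)) ?f = f 1 1"
    using T.sw_coset[OF f cop_one[unfolded null_L_def]] by simp
  show "sw (tensor_list (cop BL (y * x))) ?f = sw (tensor_list (cop BL x))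
      (\<lambda>x2 x1. sw (tensor_list (cop BL y)) (\<lambda>y2 y1. f (y1 * x1) (y2 * x2)))"
    unfolding T.sw_mult[OF f cop_mult[unfolded null_L_def]] by (rule sw_swap)
  have bi: "biadditive ?f"
    by (rule biadditiveI[OF f])
  have bi1: "biadditive (\<lambda>x y. ?f (x * u) (y * v))" "biadditive (\<lambda>x y. ?f (u * x) (v * y))"
    and bi2: "biadditive (\<lambda>x y. ?f x (y * v))" "biadditive (\<lambda>x y. ?f x (v * y))"
    and bi3: "biadditive (\<lambda>x y. ?f (x * u) y)" "biadditive (\<lambda>x y. ?f (u * x) y)" for u v
    using bi by (simp_all add: balanced_def distrib_left distrib_right)
  assume "b \<in> range (src BL)"
  then obtain l where l: "b = src BL l" by blast
  show "sw (tensor_list (cop BL (b * x))) ?f = sw (tensor_list (cop BL x)) (\<lambda>x2 x1. f x1 (b * x2))"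
    using T.sw_map[OF f cop_bimodule[of l 1 x, unfolded null_L_def] bi1(2)]
    by (simp add: l tgt_simps)
  show "sw (tensor_list (cop BL (tgt BL (cou BL b) * x))) ?f =
      sw (tensor_list (cop BL x)) (\<lambda>x2 x1. f (tgt BL (cou BL b) * x1) x2)"
    using T.sw_map[OF f cop_bimodule[of 1 l x, unfolded null_L_def] bi1(2)]
    by (simp add: l src_simps cou_src_id)
  show "sw (tensor_list (cop BL x)) (\<lambda>x2 x1. f (x1 * b) x2) =
      sw (tensor_list (cop BL x)) (\<lambda>x2 x1. f x1 (x2 * tgt BL (cou BL b)))"
    using T.sw_map_eq[OF f takeuchi[of l x, unfolded null_L_def] bi3(1) bi2(1)]
    by (simp add: l cou_src_id)
next
  fix F :: "'a \<Rightarrow> 'a \<Rightarrow> 'a \<Rightarrow> 'a" and a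
  assume F1: "\<And>z. balanced (\<lambda>l a. tgt BL l * a) (\<lambda>l a. src BL l * a) UNIV (\<lambda>y x. F x y z)"
    and F2: "\<And>x. balanced (\<lambda>l a. tgt BL l * a) (\<lambda>l a. src BL l * a) UNIV (\<lambda>y z. F x z y)"
  show "sw (tensor_list (cop BL a)) (\<lambda>z p. sw (tensor_list (cop BL p)) (\<lambda>y x. F x y z)) =
    sw (tensor_list (cop BL a)) (\<lambda>q x. sw (tensor_list (cop BL q)) (\<lambda>z y. F x y z))"
    by (rule sw_coassoc[OF T.tensor_coproduct_axioms T.tensor_coproduct_axioms _ _
          coassoc[of a, unfolded null_LL_def], of "\<lambda>z y x. F x y z", symmetric])
      (use F1 F2 in auto)
next
  fix a
  show "sw (tensor_list (cop BL a)) (\<lambda>y x. tgt BL (cou BL x) * y) = a"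
    using counit_right[of a]
    by (subst sw_tensor_list_sweedler) (simp_all add: balanced_def distrib_left distrib_right cou_add tgt_simps)
  show "sw (tensor_list (cop BL a)) (\<lambda>y x. src BL (cou BL y) * x) = a"
    using counit_left[of a]
    by (subst sw_tensor_list_sweedler) (simp_all add: balanced_def distrib_left distrib_right cou_add src_simps)
qed (auto simp: mult.assoc distrib_left distrib_right src_tgt_commute cou_add cou_src_id cou_tgt_id
    cou_src_mult cou_tgt_mult cou_src cou_tgt src_simps tgt_simps)

end

context hopf_algebroid
begin

lemma range_eq: "range (tgt BL) = range (src BR)" "range (tgt BR) = range (src BL)"
  by (auto, metis sR_piR_tL rangeI, metis tL_piL_sR rangeI, metis sL_piL_tR rangeI, metis tR_piR_sL rangeI)

text \<open>The antipode axiom at \<open>1\<close>, whose left coproduct is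
  \<open>1 \<otimes> 1\<close>.\<close>

lemma S_one: "S 1 = 1"
proof -
  have bal: "balanced (\<lambda>l a. tgt BL l * a) (\<lambda>l a. src BL l * a) UNIV (\<lambda>x y. S x * y)"
    using S_bimodule_L[of _ _ 1]
    by (simp add: balanced_def S_add distrib_left distrib_right mult.assoc left.src_simps left.tgt_simps)
  from left.T.sw_coset[OF bal left.cop_one[unfolded null_L_def]] antipode_left[of 1] show ?thesis
    by (simp add: sw_tensor_list_sweedler[OF biadditiveI[OF bal]] right.cou_one right.src_simps)
qed

lemma S_tgt_L: "S (tgt BL l) = src BL l" and S_tgt_R: "S (tgt BR r) = src BR r"
  using S_bimodule_L[of l 1 1] S_bimodule_R[of r 1 1]
  by (simp_all add: S_one left.src_simps left.tgt_simps right.src_simps right.tgt_simps)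

lemma S_mult_tgt_L: "S (x * tgt BL l) = src BL l * S x" "S (tgt BL l * x) = S x * src BL l"
  and S_mult_tgt_R: "S (x * tgt BR r) = src BR r * S x" "S (tgt BR r * x) = S x * src BR r"
  using S_bimodule_L[of 1 x l] S_bimodule_L[of l x 1] S_bimodule_R[of 1 x r] S_bimodule_R[of r x 1]
  by (simp_all add: left.src_simps left.tgt_simps right.src_simps right.tgt_simps)

lemma internal_hopf_algebroid: "internal_hopf_algebroid (*) 1 (range (src BR)) (range (src BL)) (\<lambda>a. tgt BR (cou BR a)) (\<lambda>a. tgt BL (cou BL a))
  (\<lambda>a. tensor_list (cop BR a)) (\<lambda>a. map prod.swap (tensor_list (cop BL a)))
  (\<lambda>a. src BR (cou BR a)) (\<lambda>a. src BL (cou BL a)) S"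
proof (intro internal_hopf_algebroid.intro)
  show "internal_right_bialgebroid (*) 1 (range (src BR)) (range (src BL)) (\<lambda>a. tgt BR (cou BR a))
    (\<lambda>a. tensor_list (cop BR a)) (\<lambda>a. src BR (cou BR a))"
    using right.internal_right_bialgebroid by (simp add: range_eq)
  show "internal_right_bialgebroid (\<lambda>x y. y * x) 1 (range (src BL)) (range (src BR)) (\<lambda>a. tgt BL (cou BL a))
    (\<lambda>a. map prod.swap (tensor_list (cop BL a))) (\<lambda>a. src BL (cou BL a))"
    using left.internal_right_bialgebroid by (simp add: range_eq)
  \<comment> \<open>Every element of \<open>B\<close> is also some \<open>tgt BL l\<close>, and
    every element of \<open>C\<close> some \<open>tgt BR r\<close>; on these the bimodule axioms
    determine \<open>S\<close>.\<close>
  have B: "\<exists>l. b = tgt BL l" if "b \<in> range (src BR)" for b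
    using that range_eq by blast
  have C: "\<exists>r. c = tgt BR r" if "c \<in> range (src BL)" for c
    using that range_eq by blast
  show "internal_hopf_algebroid_axioms (*) (range (src BR)) (range (src BL)) (\<lambda>a. tgt BR (cou BR a)) (\<lambda>a. tgt BL (cou BL a))
    (\<lambda>a. tensor_list (cop BR a)) (\<lambda>a. map prod.swap (tensor_list (cop BL a)))
    (\<lambda>a. src BR (cou BR a)) (\<lambda>a. src BL (cou BL a)) S"
  proof (unfold_locales, unfold left.balanced_range right.balanced_range left.sw_swap_pairs)
    fix a
    show "sw (tensor_list (cop BL a)) (\<lambda>x y. S x * y) = src BR (cou BR a)"
      using antipode_left[of a]
      by (subst sw_tensor_list_sweedler) (simp_all add: balanced_def distrib_left distrib_right S_add)
    show "sw (tensor_list (cop BR a)) (\<lambda>x y. x * S y) = src BL (cou BL a)"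
      using antipode_right[of a]
      by (subst sw_tensor_list_sweedler) (simp_all add: balanced_def distrib_left distrib_right S_add)
  next
    fix F :: "'a \<Rightarrow> 'a \<Rightarrow> 'a \<Rightarrow> 'a" and a
    assume F: "\<And>z. balanced (\<lambda>l a. tgt BL l * a) (\<lambda>l a. src BL l * a) UNIV (\<lambda>x y. F x y z)"
      "\<And>x. balanced (\<lambda>r a. a * src BR r) (\<lambda>r a. a * tgt BR r) UNIV (F x)"
    show "sw (tensor_list (cop BR a)) (\<lambda>p z. sw (tensor_list (cop BL p)) (\<lambda>x y. F x y z)) =
      sw (tensor_list (cop BL a)) (\<lambda>x q. sw (tensor_list (cop BR q)) (F x))"
      by (rule sw_coassoc[OF left.T.tensor_coproduct_axioms right.T.tensor_coproduct_axioms F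
            cop_LR[of a, unfolded null_LR_def]])
  next
    fix F :: "'a \<Rightarrow> 'a \<Rightarrow> 'a \<Rightarrow> 'a" and a
    assume F: "\<And>z. balanced (\<lambda>r a. a * src BR r) (\<lambda>r a. a * tgt BR r) UNIV (\<lambda>x y. F x y z)"
      "\<And>x. balanced (\<lambda>l a. tgt BL l * a) (\<lambda>l a. src BL l * a) UNIV (F x)"
    show "sw (tensor_list (cop BL a)) (\<lambda>p z. sw (tensor_list (cop BR p)) (\<lambda>x y. F x y z)) =
      sw (tensor_list (cop BR a)) (\<lambda>x q. sw (tensor_list (cop BL q)) (F x))"
      by (rule sw_coassoc[OF right.T.tensor_coproduct_axioms left.T.tensor_coproduct_axioms F
            cop_RL[of a, unfolded null_RL_def]])
  qed (use B C in \<open>auto dest!: B C simp: S_add S_tgt_L S_tgt_R S_mult_tgt_L S_mult_tgt_R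
      left.cou_src_id left.cou_tgt_id right.cou_src_id right.cou_tgt_id sL_piL_tR tL_piL_sR sR_piR_tL tR_piR_sL\<close>)
qed

end


section \<open>Dual bases and Frobenius extensions\<close>

lemma sw_lookup: "Poly_Mapping.lookup (sw xs f) k = sw xs (\<lambda>x y. Poly_Mapping.lookup (f x y) k)"
  by (induction xs) (simp_all add: lookup_add)

text \<open>Several entries of the list may share their first component; their coefficients are
  collected.\<close>

lemma sw_sum_fst:
  fixes act :: "'b::comm_monoid_add \<Rightarrow> 'm \<Rightarrow> 'm::comm_monoid_add"
  assumes "finite X" "fst ` set xg \<subseteq> X" "\<And>b c x. act (b + c) x = act b x + act c x" "\<And>x. act 0 x = 0"
  shows "(\<Sum>x\<in>X. act (sw xg (\<lambda>y g. if y = x then h g else 0)) x) = sw xg (\<lambda>x g. act (h g) x)"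
  using assms(2)
proof (induction xg)
  case (Cons p xg)
  have "(\<Sum>x\<in>X. act (if fst p = x then h (snd p) else 0) x) = (\<Sum>x\<in>X. if x = fst p then act (h (snd p)) x else 0)"
    by (rule sum.cong) (auto simp: assms(4))
  also have "\<dots> = act (h (snd p)) (fst p)"
    using Cons.prems assms(1) by simp
  finally show ?case
    using Cons by (simp add: assms(3) sum.distrib)
qed (simp add: assms(4))

lemma finitely_generated_projective_iff:
  fixes act :: "'b::unital_ring \<Rightarrow> 'm::ab_group_add \<Rightarrow> 'm"
  assumes add: "\<And>b x y. act b (x + y) = act b x + act b y" "\<And>b c x. act (b + c) x = act b x + act c x"
    and mult: "\<And>b c x. act (b * c) x = act b (act c x)" and one: "\<And>x. act 1 x = x"
  shows "finitely_generated act \<and> projective act \<longleftrightarrow>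
    (\<exists>xg. (\<forall>p\<in>set xg. action_hom act (*) (snd p)) \<and> (\<forall>m. sw xg (\<lambda>x g. act (g m) x) = m))"
    (is "?L \<longleftrightarrow> (\<exists>xg. ?R xg)")
proof
  have act_0: "act 0 x = 0" "act b 0 = 0" for b x
    using add(2)[of 0 0 x] add(1)[of b 0 0] by simp_all
  have lookup_free: "Poly_Mapping.lookup (free_action b h) k = b * Poly_Mapping.lookup h k"
    for b :: 'b and h :: "'m \<Rightarrow>\<^sub>0 'b" and k
    by (simp add: free_action_def Poly_Mapping.map.rep_eq when_def)
  have free_single: "free_action b (Poly_Mapping.single x c) = Poly_Mapping.single x (b * c)" for b c :: 'b and x :: 'm
    by (rule poly_mapping_eqI) (simp add: lookup_free lookup_single when_def)
  {
    assume ?L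
    then obtain X and i :: "'m \<Rightarrow> ('m \<Rightarrow>\<^sub>0 'b)" and p where X: "finite X"
      "\<And>m. \<exists>c. m = (\<Sum>x\<in>X. act (c x) x)" and i: "action_hom act free_action i"
      and p: "action_hom free_action act p" and pi: "\<And>m. p (i m) = m"
      unfolding finitely_generated_def projective_def by blast
    have i_add: "Modules.additive i" and i_act: "\<And>b m. i (act b m) = free_action b (i m)"
      using i by (auto simp: action_hom_def)
    have p_add: "Modules.additive p" and p_act: "\<And>b m. p (free_action b m) = act b (p m)"
      using p by (auto simp: action_hom_def)
    \<comment> \<open>The basis vectors occurring in the images of the generators; they support the
      image of every element.\<close>
    define K where "K = (\<Union>x\<in>X. Poly_Mapping.keys (i x))"
    have "finite K"
      by (simp add: K_def X)
    then obtain ks where ks: "set ks = K" "distinct ks"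
      using finite_distinct_list by blast
    let ?xg = "map (\<lambda>k. (p (Poly_Mapping.single k 1), \<lambda>m. Poly_Mapping.lookup (i m) k)) ks"
    have keys: "Poly_Mapping.keys (i m) \<subseteq> K" for m
    proof
      fix k assume "k \<in> Poly_Mapping.keys (i m)"
      moreover obtain c where "m = (\<Sum>x\<in>X. act (c x) x)"
        using X(2) by blast
      then have "Poly_Mapping.lookup (i m) k = (\<Sum>x\<in>X. c x * Poly_Mapping.lookup (i x) k)"
        by (simp add: additive.sum[OF i_add] i_act lookup_sum lookup_free)
      ultimately have "(\<Sum>x\<in>X. c x * Poly_Mapping.lookup (i x) k) \<noteq> 0"
        by (simp add: in_keys_iff)
      then obtain x where "x \<in> X" "Poly_Mapping.lookup (i x) k \<noteq> 0"
        by (metis (no_types, lifting) mult_zero_right sum.neutral)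
      then show "k \<in> K"
        by (auto simp: K_def in_keys_iff)
    qed
    have "?R ?xg"
    proof (intro conjI ballI allI)
      show "action_hom act (*) (snd q)" if "q \<in> set ?xg" for q
        using that by (auto simp: action_hom_def additive_def additive.add[OF i_add] lookup_add i_act lookup_free)
      fix m
      have "i m = (\<Sum>k\<in>K. Poly_Mapping.single k (Poly_Mapping.lookup (i m) k))"
        using keys[of m] \<open>finite K\<close>
        by (intro poly_mapping_eqI) (auto simp: lookup_sum lookup_single when_def in_keys_iff)
      then have "m = p (\<Sum>k\<in>K. free_action (Poly_Mapping.lookup (i m) k) (Poly_Mapping.single k 1))"
        using pi[of m] by (simp add: free_single)
      also have "\<dots> = (\<Sum>k\<in>K. act (Poly_Mapping.lookup (i m) k) (p (Poly_Mapping.single k 1)))"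
        by (simp add: additive.sum[OF p_add] p_act)
      finally show "sw ?xg (\<lambda>x g. act (g m) x) = m"
        using ks by (simp add: sw_def comp_def sum_list_distinct_conv_sum_set)
    qed
    then show "\<exists>xg. ?R xg" by blast
  next
    assume "\<exists>xg. ?R xg"
    then obtain xg where g: "\<And>p. p \<in> set xg \<Longrightarrow> action_hom act (*) (snd p)"
      and xg: "\<And>m. sw xg (\<lambda>x g. act (g m) x) = m" by blast
    have g': "g (m + m') = g m + g m'" "g (act b m) = b * g m" if "(x, g) \<in> set xg" for x g b m m'
      using g[OF that] by (auto simp: action_hom_def additive.add)
    let ?X = "fst ` set xg"
    have "finitely_generated act"
      unfolding finitely_generated_def
    proof (intro exI conjI allI)
      show "m = (\<Sum>x\<in>?X. act ((\<lambda>x. sw xg (\<lambda>y g. if y = x then g m else 0)) x) x)" for m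
        using sw_sum_fst[of ?X xg act "\<lambda>g. g m"] xg[of m] by (simp add: add act_0)
    qed simp
    moreover have "projective act"
      unfolding projective_def
    proof (intro exI conjI allI)
      \<comment> \<open>The free module is indexed by the module itself: \<open>?i\<close> places
        the coordinates at the generators, and \<open>?p\<close> reads indices as elements.\<close>
      let ?i = "\<lambda>m. sw xg (\<lambda>x g. Poly_Mapping.single x (g m))"
      let ?p = "\<lambda>h. \<Sum>x\<in>Poly_Mapping.keys h. act (Poly_Mapping.lookup h x) x"
      have p_superset: "?p h = (\<Sum>x\<in>K. act (Poly_Mapping.lookup h x) x)"
        if "finite K" "Poly_Mapping.keys h \<subseteq> K" for h K
        by (rule sum.mono_neutral_left) (use that in \<open>auto simp: in_keys_iff act_0\<close>)
      have p_add: "?p (h + h') = ?p h + ?p h'" for h h'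
      proof -
        let ?K = "Poly_Mapping.keys h \<union> Poly_Mapping.keys h'"
        have "?p g = (\<Sum>x\<in>?K. act (Poly_Mapping.lookup g x) x)" if "g \<in> {h, h', h + h'}" for g
          by (rule p_superset) (use that keys_add[of h h'] in auto)
        then have "?p h = (\<Sum>x\<in>?K. act (Poly_Mapping.lookup h x) x)"
          "?p h' = (\<Sum>x\<in>?K. act (Poly_Mapping.lookup h' x) x)"
          "?p (h + h') = (\<Sum>x\<in>?K. act (Poly_Mapping.lookup (h + h') x) x)"
          by blast+
        then show ?thesis
          by (simp only: lookup_add add sum.distrib)
      qed
      show "action_hom act free_action ?i"
        unfolding action_hom_def
      proof (intro conjI allI)
        show "Modules.additive ?i"
          by unfold_locales (simp add: single_add g' flip: sw_add cong: sw_cong)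
        show "?i (act b m) = free_action b (?i m)" for b m
        proof (rule poly_mapping_eqI)
          fix k
          have "b * sw xg (\<lambda>x g. Poly_Mapping.lookup (Poly_Mapping.single x (g m)) k) =
            sw xg (\<lambda>x g. b * Poly_Mapping.lookup (Poly_Mapping.single x (g m)) k)"
            by (rule sw_hom) (rule distrib_left)
          then show "Poly_Mapping.lookup (?i (act b m)) k = Poly_Mapping.lookup (free_action b (?i m)) k"
            by (simp add: lookup_free sw_lookup lookup_single when_def) (rule sw_cong, simp add: g')
        qed
      qed
      show "action_hom free_action act ?p"
        unfolding action_hom_def
      proof (intro conjI allI)
        show "Modules.additive ?p"
          by unfold_locales (rule p_add)
        show "?p (free_action b h) = act b (?p h)" for b h
        proof -
          have "Poly_Mapping.keys (free_action b h) \<subseteq> Poly_Mapping.keys h"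
            by (auto simp: in_keys_iff lookup_free)
          then have "?p (free_action b h) = (\<Sum>x\<in>Poly_Mapping.keys h. act b (act (Poly_Mapping.lookup h x) x))"
            by (subst p_superset) (auto simp: lookup_free mult)
          also have "\<dots> = act b (?p h)"
            using add(1) act_0 by (simp add: additive.sum additive_def)
          finally show ?thesis .
        qed
      qed
      show "?p (?i m) = m" for m
      proof -
        have single: "?p (Poly_Mapping.single x b) = act b x" for x b
          by (cases "b = 0") (simp_all add: act_0)
        have "?p (?i m) = sw xg (\<lambda>x g. ?p (Poly_Mapping.single x (g m)))"
          by (rule sw_hom[where h = ?p]) (rule p_add)
        also have "\<dots> = m"
          by (simp only: single xg)
        finally show ?thesis .
      qed
    qed
    ultimately show ?L ..
  }
qed

text \<open>The action \<open>act\<close> on the base algebra and the product of \<open>A\<close>,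
  given or opposite, are parameters, so that one locale serves all four duals.\<close>

locale embedded_base = base_ring mul one "range e"
  for mul :: "'a::ab_group_add \<Rightarrow> 'a \<Rightarrow> 'a"  (infixl \<open>\<cdot>\<close> 70) and one :: 'a  (\<open>\<one>\<close>)
    and e :: "'b::unital_ring \<Rightarrow> 'a" +
  fixes act :: "'b \<Rightarrow> 'b \<Rightarrow> 'b"
  assumes e_add: "e (x + y) = e x + e y" and e_inj: "inj e" and e_act: "e (act b x) = e x \<cdot> e b"
begin

abbreviation dual :: "('a \<Rightarrow> 'b) set"
  where "dual \<equiv> {\<phi>. action_hom (\<lambda>b a. a \<cdot> e b) act \<phi>}"

lemma dual_iff: "\<phi> \<in> dual \<longleftrightarrow> right_linear (\<lambda>a. e (\<phi> a))"
proof -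
  have "e x = e y \<longleftrightarrow> x = y" for x y
    using e_inj by (simp add: inj_eq)
  then show ?thesis
    by (auto simp: action_hom_def right_linear_def additive_def simp flip: e_add e_act)
qed

lemma dual_bij: "bij_betw (\<lambda>\<phi> a. e (\<phi> a)) dual {f. right_linear f}"
proof (rule bij_betw_byWitness[where f' = "\<lambda>f a. inv e (f a)"])
  have inv: "e (inv e (f a)) = f a" if "right_linear f" for f a
    using right_linearD(2)[OF that] by (simp add: f_inv_into_f)
  then show "\<forall>f\<in>{f. right_linear f}. (\<lambda>a. e (inv e (f a))) = f"
    by simp
  show "(\<lambda>f a. inv e (f a)) ` {f. right_linear f} \<subseteq> dual"
    unfolding image_subset_iff dual_iff by (auto simp: inv)
  show "(\<lambda>\<phi> a. e (\<phi> a)) ` dual \<subseteq> {f. right_linear f}"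
    using dual_iff by blast
qed (simp add: inv_f_f[OF e_inj])

lemma dual_bij_iff: "bij_betw h A dual \<longleftrightarrow> bij_betw (\<lambda>a b. e (h a b)) A {f. right_linear f}"
proof (cases "h ` A \<subseteq> dual")
  case True
  from bij_betw_comp_iff2[OF dual_bij True] show ?thesis
    by (simp add: comp_def)
next
  case False
  then show ?thesis
    using dual_iff by (auto simp: bij_betw_def)
qed

lemma dual_bij_iff': "bij_betw (\<lambda>f. h (\<lambda>a. e (f a))) dual A \<longleftrightarrow> bij_betw h {f. right_linear f} A"
  using bij_betw_comp_iff[OF dual_bij, of h A] by (simp add: comp_def)

text \<open>As \<open>J\<close> implies right linearity, its maps take values in the image of
  \<open>e\<close>, and the inverse of \<open>e\<close> leads back to the base algebra.\<close>

lemma dual_ex_iff: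
  assumes "\<And>f. J f \<Longrightarrow> right_linear f"
  shows "(\<exists>\<phi>. J (\<lambda>a. e (\<phi> a)) \<and> bij_betw (\<lambda>a b. \<phi> (h a b)) A dual) \<longleftrightarrow>
    (\<exists>f. J f \<and> bij_betw (\<lambda>a b. f (h a b)) A {f. right_linear f})"
proof
  assume "\<exists>f. J f \<and> bij_betw (\<lambda>a b. f (h a b)) A {f. right_linear f}"
  then obtain f where f: "J f" "bij_betw (\<lambda>a b. f (h a b)) A {f. right_linear f}"
    by blast
  have "(\<lambda>a. e (inv e (f a))) = f"
    using right_linearD(2)[OF assms[OF f(1)]] by (simp add: f_inv_into_f)
  then show "\<exists>\<phi>. J (\<lambda>a. e (\<phi> a)) \<and> bij_betw (\<lambda>a b. \<phi> (h a b)) A dual"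
    using f by (intro exI[of _ "\<lambda>a. inv e (f a)"]) (simp add: dual_bij_iff fun_eq_iff)
qed (auto simp: dual_bij_iff)

end

text \<open>Here \<open>e\<close> reverses products, which turns a right module over the image into
  a left module over the base algebra, the form required by \<open>finitely_generated\<close> and
  \<open>projective\<close>.\<close>

locale embedded_opposite = embedded_base mul one e "(*)"
  for mul :: "'a::ab_group_add \<Rightarrow> 'a \<Rightarrow> 'a"  (infixl \<open>\<cdot>\<close> 70) and one :: 'a  (\<open>\<one>\<close>)
    and e :: "'b::unital_ring \<Rightarrow> 'a" +
  assumes e_one: "e 1 = \<one>"
begin

lemma right_dual_basis_iff:
  "finitely_generated (\<lambda>b a. a \<cdot> e b) \<and> projective (\<lambda>b a. a \<cdot> e b) \<longleftrightarrow> (\<exists>xg. right_dual_basis xg)"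
proof -
  have "finitely_generated (\<lambda>b a. a \<cdot> e b) \<and> projective (\<lambda>b a. a \<cdot> e b) \<longleftrightarrow>
    (\<exists>xg. (\<forall>p\<in>set xg. snd p \<in> dual) \<and> (\<forall>m. sw xg (\<lambda>x g. x \<cdot> e (g m)) = m))"
    by (subst finitely_generated_projective_iff)
      (simp_all add: add_mul mul_add e_add e_act e_one mul_assoc)
  also have "\<dots> \<longleftrightarrow> (\<exists>xg. right_dual_basis xg)"
  proof
    assume "\<exists>xg. (\<forall>p\<in>set xg. snd p \<in> dual) \<and> (\<forall>m. sw xg (\<lambda>x g. x \<cdot> e (g m)) = m)"
    then obtain xg where xg: "\<And>p. p \<in> set xg \<Longrightarrow> snd p \<in> dual" "\<And>m. sw xg (\<lambda>x g. x \<cdot> e (g m)) = m"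
      by blast
    have "right_dual_basis (map (\<lambda>(x, g). (x, \<lambda>a. e (g a))) xg)"
      using xg unfolding dual_iff by (force simp: right_dual_basis_def sw_def comp_def split_def)
    then show "\<exists>xg. right_dual_basis xg" by blast
  next
    assume "\<exists>xg. right_dual_basis xg"
    then obtain xg where xg: "\<And>p. p \<in> set xg \<Longrightarrow> right_linear (snd p)" "\<And>m. sw xg (\<lambda>x g. x \<cdot> g m) = m"
      by (auto simp: right_dual_basis_def)
    have inv: "e (inv e (g a)) = g a" if "(x, g) \<in> set xg" for x g a
      using right_linearD(2)[OF xg(1)[OF that]] by (simp add: f_inv_into_f)
    let ?xg = "map (\<lambda>(x, g). (x, \<lambda>a. inv e (g a))) xg"
    have "snd p \<in> dual" if "p \<in> set ?xg" for p
      using that xg(1) inv unfolding dual_iff by (fastforce simp: fun_eq_iff)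
    moreover have "sw ?xg (\<lambda>x g. x \<cdot> e (g m)) = m" for m
    proof -
      have "sw ?xg (\<lambda>x g. x \<cdot> e (g m)) = sw xg (\<lambda>x g. x \<cdot> e (inv e (g m)))"
        by (simp add: sw_def comp_def split_def)
      also have "\<dots> = sw xg (\<lambda>x g. x \<cdot> g m)"
        by (rule sw_cong) (simp add: inv)
      finally show ?thesis
        by (simp only: xg(2))
    qed
    ultimately show "\<exists>xg. (\<forall>p\<in>set xg. snd p \<in> dual) \<and> (\<forall>m. sw xg (\<lambda>x g. x \<cdot> e (g m)) = m)"
      by (intro exI[of _ ?xg] conjI ballI allI)
  qed
  finally show ?thesis .
qed

end

section \<open>Frobenius extensions as Frobenius systems\<close>

lemma base_ring_range:
  fixes s :: "'b::unital_ring \<Rightarrow> 'a::unital_ring"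
  assumes s: "algebra_hom scB scA s"
  shows "base_ring (*) 1 (range s)"
proof
  note s' = algebra_homD[OF s]
  show "1 \<in> range s"
    using s'(2) by (metis rangeI)
  show "x - y \<in> range s" "x * y \<in> range s" if "x \<in> range s" "y \<in> range s" for x y
    using that by (auto simp flip: s')
qed (simp_all add: mult.assoc distrib_left distrib_right)

text \<open>The module is a left one, hence the opposite product. A bimodule isomorphism
  \<open>\<theta>\<close> is determined by the functional \<open>\<theta> 1\<close>; conversely a
  Frobenius functional \<open>\<psi>\<close> gives, up to the embedding,
  \<open>\<theta> a = \<psi> (- * a)\<close>.\<close>

lemma frobenius_extension_iff:
  fixes s :: "'b::unital_ring \<Rightarrow> 'a::unital_ring"
  assumes s: "algebra_hom scB scA s" and inj: "inj s"
  shows "frobenius_extension scB scA s \<longleftrightarrow> base_ring.frobenius (*) (range s)"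
proof -
  note s' = algebra_homD[OF s]
  interpret A: base_ring "(*) :: 'a \<Rightarrow> 'a \<Rightarrow> 'a" 1 "range s"
    by (rule base_ring_range[OF s])
  interpret F: embedded_opposite "\<lambda>x y. y * x" "1 :: 'a" s
  proof (intro embedded_opposite.intro embedded_base.intro A.flip)
    show "embedded_base_axioms (\<lambda>x y. y * x) s (*)"
      by unfold_locales (simp_all add: s' inj)
    show "embedded_opposite_axioms 1 s"
      by unfold_locales (rule s'(2))
  qed
  let ?\<Phi> = "{\<phi>. action_hom (\<lambda>b a. s b * a) (*) \<phi>}"
  let ?iso = "\<lambda>\<theta>. bij_betw \<theta> UNIV ?\<Phi> \<and> (\<forall>a a'. \<theta> (a + a') = (\<lambda>x. \<theta> a x + \<theta> a' x)) \<and>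
    (\<forall>c a b. \<theta> (c * a * s b) = (\<lambda>x. \<theta> a (x * c) * b))"
  have "frobenius_extension scB scA s \<longleftrightarrow> (\<exists>xg. F.right_dual_basis xg) \<and> (\<exists>\<theta>. ?iso \<theta>)"
    unfolding frobenius_extension_def using s inj F.right_dual_basis_iff by blast
  also have "\<dots> \<longleftrightarrow> F.frobenius"
  proof (intro iffI conjI)
    assume "(\<exists>xg. F.right_dual_basis xg) \<and> (\<exists>\<theta>. ?iso \<theta>)"
    then obtain xg \<theta> where xg: "F.right_dual_basis xg" and bij: "bij_betw \<theta> UNIV ?\<Phi>"
      and \<theta>: "\<And>c a b. \<theta> (c * a * s b) = (\<lambda>x. \<theta> a (x * c) * b)"
      by blast
    let ?\<psi> = "\<lambda>a. s (\<theta> 1 a)"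
    have \<theta>1: "\<theta> a x = \<theta> 1 (x * a)" for a x
      using fun_cong[OF \<theta>[of a 1 1], of x] by (simp add: s')
    have bij': "bij_betw (\<lambda>a b. ?\<psi> (b * a)) UNIV {f. F.right_linear f}"
    proof -
      have "bij_betw (\<lambda>a x. \<theta> 1 (x * a)) UNIV ?\<Phi>"
        by (rule back_subst[where P = "\<lambda>t. bij_betw t UNIV ?\<Phi>", OF bij]) (intro ext, rule \<theta>1)
      then show ?thesis
        unfolding F.dual_bij_iff .
    qed
    have "\<theta> 1 \<in> ?\<Phi>"
      using bij_betw_imp_surj_on[OF bij] by blast
    then have r: "F.right_linear ?\<psi>"
      unfolding F.dual_iff .
    have "\<theta> 1 (x * s b) = \<theta> 1 x * b" for x b
      using fun_cong[OF \<theta>[of 1 1 b], of x] \<theta>1[of "s b" x] by simp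
    then have l: "F.left_linear ?\<psi>"
      using F.right_linearD(1)[OF r] by (auto simp: F.left_linear_def s')
    show "F.frobenius"
      unfolding F.frobenius_def using F.frobenius_systemI[OF r l bij' xg] by blast
  next
    assume "F.frobenius"
    then obtain \<psi> uv where \<psi>: "F.frobenius_system \<psi> uv"
      unfolding F.frobenius_def by blast
    note r = F.right_linearD[OF F.frobenius_systemD(1)[OF \<psi>]]
    note l = F.left_linearD(3)[OF F.frobenius_systemD(2)[OF \<psi>]]
    show "\<exists>xg. F.right_dual_basis xg"
      by (rule F.frobenius_dual_basis[OF \<psi>])
    have inv: "s (inv s (\<psi> a)) = \<psi> a" for a
      using r(2) by (simp add: f_inv_into_f)
    let ?\<theta> = "\<lambda>a x. inv s (\<psi> (x * a))"
    have "bij_betw ?\<theta> UNIV ?\<Phi>"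
      unfolding F.dual_bij_iff inv by (rule F.frobenius_bij[OF \<psi>])
    moreover have "?\<theta> (a + a') x = ?\<theta> a x + ?\<theta> a' x" for a a' x
      by (rule injD[OF inj], simp only: s'(1) inv) (simp add: r distrib_left)
    moreover have "?\<theta> (c * a * s b) x = ?\<theta> a (x * c) * b" for a b c x
      by (rule injD[OF inj], simp only: s'(3) inv) (use l[of "s b" "x * (c * a)"] in \<open>simp add: mult.assoc\<close>)
    ultimately show "\<exists>\<theta>. ?iso \<theta>"
      by (intro exI[of _ ?\<theta>]) (simp add: fun_eq_iff)
  qed
  also have "\<dots> \<longleftrightarrow> A.frobenius"
    by (simp add: A.frobenius_flip)
  finally show ?thesis .
qed


section \<open>Translation of the conditions\<close>

lemma range_unopp: "range (f \<circ> unopp) = range f"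
  by (auto simp: image_iff) (metis opp.sel)

lemma inj_unopp: "inj f \<Longrightarrow> inj (f \<circ> unopp)"
  by (simp add: inj_on_def opp.expand)

context hopf_algebroid
begin

interpretation H: internal_hopf_algebroid "(*)" 1 "range (src BR)" "range (src BL)" "\<lambda>a. tgt BR (cou BR a)" "\<lambda>a. tgt BL (cou BL a)"
  "\<lambda>a. tensor_list (cop BR a)" "\<lambda>a. map prod.swap (tensor_list (cop BL a))"
  "\<lambda>a. src BR (cou BR a)" "\<lambda>a. src BL (cou BL a)" S
  by (rule internal_hopf_algebroid)

interpretation D: internal_hopf_algebroid "\<lambda>x y. y * x" 1 "range (src BL)" "range (src BR)" "\<lambda>a. tgt BL (cou BL a)"
  "\<lambda>a. tgt BR (cou BR a)" "\<lambda>a. map prod.swap (tensor_list (cop BL a))" "\<lambda>a. tensor_list (cop BR a)"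
  "\<lambda>a. src BL (cou BL a)" "\<lambda>a. src BR (cou BR a)" S
  by (rule H.dual)

lemma inj: "inj (src BR)" "inj (tgt BR)" "inj (src BL)" "inj (tgt BL)"
  by (metis injI right.cou_src_id, metis injI right.cou_tgt_id, metis injI left.cou_src_id,
      metis injI left.cou_tgt_id)

lemma extension_R: "frobenius_extension scR scA (src BR) \<and>
  frobenius_extension (opp_scale scR) scA (tgt BR \<circ> unopp) \<longleftrightarrow> H.cond_extension"
  unfolding frobenius_extension_iff[OF right.src_hom inj(1)]
    frobenius_extension_iff[OF right.tgt_hom inj_unopp[OF inj(2)]] range_unopp range_eq
    H.cond_extension_def
  by (simp add: H.L.frobenius_flip)

lemma extension_L: "frobenius_extension scL scA (src BL) \<and>
  frobenius_extension (opp_scale scL) scA (tgt BL \<circ> unopp) \<longleftrightarrow> H.cond_extension"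
  unfolding frobenius_extension_iff[OF left.src_hom inj(3)]
    frobenius_extension_iff[OF left.tgt_hom inj_unopp[OF inj(4)]] range_unopp range_eq
    H.cond_extension_def
  by (auto simp: H.L.frobenius_flip)

lemma extension_dual: "D.cond_extension \<longleftrightarrow> H.cond_extension"
  unfolding D.cond_extension_def H.cond_extension_def by auto

text \<open>\<open>RR\<close>, \<open>RL\<close>, \<open>LL\<close> and \<open>LR\<close> describe
  the four duals. For the two right modules, generation and projectivity are taken over the opposite
  base algebra, which is the purpose of \<open>RR'\<close> and \<open>LR'\<close>.\<close>

interpretation RR: embedded_base "(*)" 1 "src BR" "\<lambda>r x. x * r"
  by unfold_locales (simp_all add: right.src_simps inj)

interpretation RL: embedded_opposite "(*)" 1 "tgt BR"
proof (intro embedded_opposite.intro embedded_base.intro)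
  show "base_ring (*) 1 (range (tgt BR))"
    using H.L.flip by (simp add: range_eq)
qed (unfold_locales, simp_all add: right.tgt_simps inj)

interpretation LL: embedded_opposite "\<lambda>x y. y * x" 1 "src BL"
  by unfold_locales (simp_all add: left.src_simps inj)

interpretation LR: embedded_base "\<lambda>x y. y * x" 1 "tgt BL" "\<lambda>l x. x * l"
proof (intro embedded_base.intro)
  show "base_ring (\<lambda>x y. y * x) 1 (range (tgt BL))"
    using H.R.flip by (simp add: range_eq)
qed (unfold_locales, simp_all add: left.tgt_simps inj)

interpretation RR': embedded_opposite "(*)" 1 "src BR \<circ> unopp"
proof (intro embedded_opposite.intro embedded_base.intro)
  show "base_ring (*) 1 (range (src BR \<circ> unopp))"
    using H.R.base_ring_axioms by (simp only: range_unopp)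
qed (unfold_locales, use inj_unopp[OF inj(1)] in
    \<open>simp_all add: right.src_simps plus_opp_def times_opp_def one_opp_def\<close>)

interpretation LR': embedded_opposite "\<lambda>x y. y * x" 1 "tgt BL \<circ> unopp"
proof (intro embedded_opposite.intro embedded_base.intro)
  show "base_ring (\<lambda>x y. y * x) 1 (range (tgt BL \<circ> unopp))"
    using LR.base_ring_axioms by (simp only: range_unopp)
qed (unfold_locales, use inj_unopp[OF inj(4)] in
    \<open>simp_all add: left.tgt_simps plus_opp_def times_opp_def one_opp_def\<close>)

lemma duals:
  "right_R_dual BR = RR.dual" "left_R_dual BR = RL.dual" "left_L_dual BL = LL.dual" "right_L_dual BL = LR.dual"
  by (simp_all add: right_R_dual_def left_R_dual_def left_L_dual_def right_L_dual_def)

lemma linear_maps: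
  "RL.right_linear = H.L.left_linear" "LR.right_linear = H.R.left_linear"
  using H.C_linear D.C_linear by (simp_all add: range_eq)

lemma convolutions:
  "\<phi> \<in> right_R_dual BR \<Longrightarrow> H.right_conv (\<lambda>a. src BR (\<phi> a)) a = right_R_conv BR \<phi> a"
  "\<phi> \<in> left_R_dual BR \<Longrightarrow> H.left_conv (\<lambda>a. tgt BR (\<phi> a)) a = left_R_conv BR \<phi> a"
  "\<theta> \<in> left_L_dual BL \<Longrightarrow> D.right_conv (\<lambda>a. src BL (\<theta> a)) a = left_L_conv BL \<theta> a"
  "\<theta> \<in> right_L_dual BL \<Longrightarrow> D.left_conv (\<lambda>a. tgt BL (\<theta> a)) a = right_L_conv BL \<theta> a"
proof -
  have bi: "biadditive (\<lambda>x y. y * tgt BR (\<phi> x))" "biadditive (\<lambda>x y. x * src BR (\<phi> y))"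
    if "Modules.additive \<phi>" for \<phi>
    using that by (simp_all add: balanced_def additive.add right.src_simps right.tgt_simps distrib_left distrib_right)
  have bi': "biadditive (\<lambda>x y. tgt BL (\<phi> y) * x)" "biadditive (\<lambda>x y. src BL (\<phi> x) * y)"
    if "Modules.additive \<phi>" for \<phi>
    using that by (simp_all add: balanced_def additive.add left.src_simps left.tgt_simps distrib_left distrib_right)
  show "\<phi> \<in> right_R_dual BR \<Longrightarrow> H.right_conv (\<lambda>a. src BR (\<phi> a)) a = right_R_conv BR \<phi> a"
    by (simp add: right_R_dual_def action_hom_def H.right_conv_def right_R_conv_def right.cou_src_id
        sw_tensor_list_sweedler bi)
  show "\<phi> \<in> left_R_dual BR \<Longrightarrow> H.left_conv (\<lambda>a. tgt BR (\<phi> a)) a = left_R_conv BR \<phi> a"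
    by (simp add: left_R_dual_def action_hom_def H.left_conv_def left_R_conv_def S_tgt_R
        sw_tensor_list_sweedler bi)
  show "\<theta> \<in> left_L_dual BL \<Longrightarrow> D.right_conv (\<lambda>a. src BL (\<theta> a)) a = left_L_conv BL \<theta> a"
    by (simp add: left_L_dual_def action_hom_def D.right_conv_def left_L_conv_def left.cou_src_id
        left.sw_swap_pairs sw_tensor_list_sweedler bi')
  show "\<theta> \<in> right_L_dual BL \<Longrightarrow> D.left_conv (\<lambda>a. tgt BL (\<theta> a)) a = right_L_conv BL \<theta> a"
    by (simp add: right_L_dual_def action_hom_def D.left_conv_def right_L_conv_def S_tgt_L
        left.sw_swap_pairs sw_tensor_list_sweedler bi')
qed

lemma dual_integrals:
  "\<phi> \<in> right_R_dual_integrals BR \<longleftrightarrow> H.right_dual_integral (\<lambda>a. src BR (\<phi> a))"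
  "\<phi> \<in> left_R_dual_integrals BR \<longleftrightarrow> H.left_dual_integral (\<lambda>a. tgt BR (\<phi> a))"
  "\<theta> \<in> left_L_dual_integrals BL \<longleftrightarrow> D.right_dual_integral (\<lambda>a. src BL (\<theta> a))"
  "\<theta> \<in> right_L_dual_integrals BL \<longleftrightarrow> D.left_dual_integral (\<lambda>a. tgt BL (\<theta> a))"
  using convolutions(1,2)[of \<phi>] convolutions(3,4)[of \<theta>] RR.dual_iff[of \<phi>] RL.dual_iff[of \<phi>]
    LL.dual_iff[of \<theta>] LR.dual_iff[of \<theta>]
  unfolding right_R_dual_integrals_def left_R_dual_integrals_def left_L_dual_integrals_def
    right_L_dual_integrals_def H.right_dual_integral_def H.left_dual_integral_def
    D.right_dual_integral_def D.left_dual_integral_def duals linear_maps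
  by auto

lemma integrals:
  "l \<in> left_integrals BL \<longleftrightarrow> H.left_integral l" "l \<in> right_integrals BR \<longleftrightarrow> D.left_integral l"
  by (simp_all add: left_integrals_def right_integrals_def H.left_integral_def D.left_integral_def)

section \<open>Each condition in internal form\<close>

lemma right_dual_R: "finitely_generated (\<lambda>r a. a * src BR (unopp r)) \<and>
    projective (\<lambda>r a. a * src BR (unopp r)) \<and>
    (\<exists>\<psi>\<in>right_R_dual_integrals BR. bij_betw (\<lambda>a b. \<psi> (a * b)) UNIV (right_R_dual BR)) \<longleftrightarrow>
  H.cond_right_dual"
  using RR'.right_dual_basis_iff RR.dual_ex_iff[of H.right_dual_integral "(*)" UNIV]
  by (simp add: H.cond_right_dual_def Bex_def dual_integrals duals H.right_dual_integral_def
      range_unopp[unfolded comp_def] comp_def; blast)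

lemma left_dual_R: "bij S \<and> finitely_generated (\<lambda>r a. a * tgt BR r) \<and> projective (\<lambda>r a. a * tgt BR r) \<and>
    (\<exists>\<psi>\<in>left_R_dual_integrals BR. bij_betw (\<lambda>a b. \<psi> (a * b)) UNIV (left_R_dual BR)) \<longleftrightarrow>
  H.cond_left_dual"
proof -
  have "finitely_generated (\<lambda>r a. a * tgt BR r) \<and> projective (\<lambda>r a. a * tgt BR r) \<longleftrightarrow>
    (\<exists>xg. H.L.left_dual_basis xg)"
    using RL.right_dual_basis_iff by (simp add: range_eq H.C_right_dual_basis)
  moreover have "(\<exists>\<phi>. H.left_dual_integral (\<lambda>a. tgt BR (\<phi> a)) \<and> bij_betw (\<lambda>a b. \<phi> (a * b)) UNIV RL.dual) \<longleftrightarrow>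
    (\<exists>f. H.left_dual_integral f \<and> bij_betw (\<lambda>a b. f (a * b)) UNIV {f. H.L.left_linear f})"
    unfolding linear_maps(1)[symmetric] by (rule RL.dual_ex_iff) (simp add: H.left_dual_integral_def linear_maps)
  ultimately show ?thesis
    unfolding H.cond_left_dual_def Bex_def dual_integrals duals by blast
qed

lemma left_dual_L: "finitely_generated (\<lambda>l a. src BL l * a) \<and> projective (\<lambda>l a. src BL l * a) \<and>
    (\<exists>\<rho>\<in>left_L_dual_integrals BL. bij_betw (\<lambda>a b. \<rho> (b * a)) UNIV (left_L_dual BL)) \<longleftrightarrow>
  D.cond_right_dual"
proof -
  have "finitely_generated (\<lambda>l a. src BL l * a) \<and> projective (\<lambda>l a. src BL l * a) \<longleftrightarrow>
    (\<exists>xg. H.L.right_dual_basis xg)"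
    by (rule LL.right_dual_basis_iff)
  moreover have "(\<exists>\<phi>. D.right_dual_integral (\<lambda>a. src BL (\<phi> a)) \<and> bij_betw (\<lambda>a b. \<phi> (b * a)) UNIV LL.dual) \<longleftrightarrow>
    (\<exists>f. D.right_dual_integral f \<and> bij_betw (\<lambda>a b. f (b * a)) UNIV {f. H.L.right_linear f})"
    by (rule LL.dual_ex_iff) (simp add: D.right_dual_integral_def linear_maps)
  ultimately show ?thesis
    unfolding D.cond_right_dual_def Bex_def dual_integrals duals by blast
qed

lemma right_dual_L: "bij S \<and> finitely_generated (\<lambda>l a. tgt BL (unopp l) * a) \<and>
    projective (\<lambda>l a. tgt BL (unopp l) * a) \<and>
    (\<exists>\<rho>\<in>right_L_dual_integrals BL. bij_betw (\<lambda>a b. \<rho> (b * a)) UNIV (right_L_dual BL)) \<longleftrightarrow>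
  D.cond_left_dual"
proof -
  have "finitely_generated (\<lambda>l a. tgt BL (unopp l) * a) \<and> projective (\<lambda>l a. tgt BL (unopp l) * a) \<longleftrightarrow>
    (\<exists>xg. H.R.left_dual_basis xg)"
    using LR'.right_dual_basis_iff
    by (simp add: range_unopp[unfolded comp_def] range_eq D.C_right_dual_basis comp_def)
  moreover have "(\<exists>\<phi>. D.left_dual_integral (\<lambda>a. tgt BL (\<phi> a)) \<and> bij_betw (\<lambda>a b. \<phi> (b * a)) UNIV LR.dual) \<longleftrightarrow>
    (\<exists>f. D.left_dual_integral f \<and> bij_betw (\<lambda>a b. f (b * a)) UNIV {f. H.R.left_linear f})"
    unfolding linear_maps(2)[symmetric] by (rule LR.dual_ex_iff) (simp add: D.left_dual_integral_def linear_maps)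
  ultimately show ?thesis
    unfolding D.cond_left_dual_def Bex_def dual_integrals duals by blast
qed

lemma integral_R: "(\<exists>l\<in>left_integrals BL.
      bij_betw (\<lambda>\<phi>. right_R_conv BR \<phi> l) (right_R_dual BR) UNIV \<and>
      bij_betw (\<lambda>\<phi>. left_R_conv BR \<phi> l) (left_R_dual BR) UNIV) \<longleftrightarrow> H.cond_integral"
proof -
  have "bij_betw (\<lambda>\<phi>. right_R_conv BR \<phi> l) (right_R_dual BR) UNIV \<longleftrightarrow>
    bij_betw (\<lambda>f. H.right_conv f l) {f. H.R.right_linear f} UNIV" for l
    unfolding RR.dual_bij_iff'[symmetric] duals
    by (rule bij_betw_cong) (simp add: convolutions duals)
  moreover have "bij_betw (\<lambda>\<phi>. left_R_conv BR \<phi> l) (left_R_dual BR) UNIV \<longleftrightarrow>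
    bij_betw (\<lambda>f. H.left_conv f l) {f. H.L.left_linear f} UNIV" for l
    unfolding linear_maps(1)[symmetric] RL.dual_bij_iff'[symmetric] duals
    by (rule bij_betw_cong) (simp add: convolutions duals)
  ultimately show ?thesis
    by (simp add: H.cond_integral_def Bex_def integrals)
qed

lemma integral_L: "(\<exists>p\<in>right_integrals BR.
      bij_betw (\<lambda>\<phi>. left_L_conv BL \<phi> p) (left_L_dual BL) UNIV \<and>
      bij_betw (\<lambda>\<phi>. right_L_conv BL \<phi> p) (right_L_dual BL) UNIV) \<longleftrightarrow> D.cond_integral"
proof -
  have "bij_betw (\<lambda>\<phi>. left_L_conv BL \<phi> p) (left_L_dual BL) UNIV \<longleftrightarrow>
    bij_betw (\<lambda>f. D.right_conv f p) {f. H.L.right_linear f} UNIV" for p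
    unfolding LL.dual_bij_iff'[symmetric] duals
    by (rule bij_betw_cong) (simp add: convolutions duals)
  moreover have "bij_betw (\<lambda>\<phi>. right_L_conv BL \<phi> p) (right_L_dual BL) UNIV \<longleftrightarrow>
    bij_betw (\<lambda>f. D.left_conv f p) {f. H.R.left_linear f} UNIV" for p
    unfolding linear_maps(2)[symmetric] LR.dual_bij_iff'[symmetric] duals
    by (rule bij_betw_cong) (simp add: convolutions duals)
  ultimately show ?thesis
    by (simp add: D.cond_integral_def Bex_def integrals)
qed

lemmas equivalences = H.conditions_equivalent D.conditions_equivalent extension_dual

text \<open>The internal form of 1.a is its own dual, which links the conditions of the dual to
  those of the original.\<close>

lemma conditions_eq: "D.conditions = H.conditions"
  using equivalences by metis

lemmas conditions = extension_R[unfolded H.conditions_equivalent] extension_L[unfolded H.conditions_equivalent]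
  right_dual_R[unfolded H.conditions_equivalent] left_dual_R[unfolded H.conditions_equivalent]
  left_dual_L[unfolded D.conditions_equivalent conditions_eq] right_dual_L[unfolded D.conditions_equivalent conditions_eq]
  integral_R[unfolded H.conditions_equivalent] integral_L[unfolded D.conditions_equivalent conditions_eq]

end

theorem corollary4p8:
  fixes scA :: "'k::comm_unital_ring \<Rightarrow> 'a::unital_ring \<Rightarrow> 'a"
    and scL :: "'k \<Rightarrow> 'l::unital_ring \<Rightarrow> 'l"
    and scR :: "'k \<Rightarrow> 'r::unital_ring \<Rightarrow> 'r"
    and BL :: "('a, 'l) bialgebroid"
    and BR :: "('a, 'r) bialgebroid"
    and S :: "'a \<Rightarrow> 'a"
  assumes "hopf_algebroid scA scL scR BL BR S"
  shows "all_equivalent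
   [\<comment> \<open>1.a\<close>
    frobenius_extension scR scA (src BR) \<and>
    frobenius_extension (opp_scale scR) scA (tgt BR \<circ> unopp),
    \<comment> \<open>1.b\<close>
    frobenius_extension scL scA (src BL) \<and>
    frobenius_extension (opp_scale scL) scA (tgt BL \<circ> unopp),
    \<comment> \<open>2.a\<close>
    finitely_generated (\<lambda>r a. a * src BR (unopp r)) \<and>
    projective (\<lambda>r a. a * src BR (unopp r)) \<and>
    (\<exists>\<psi>\<in>right_R_dual_integrals BR. bij_betw (\<lambda>a b. \<psi> (a * b)) UNIV (right_R_dual BR)),
    \<comment> \<open>2.b\<close>
    bij S \<and>
    finitely_generated (\<lambda>r a. a * tgt BR r) \<and>
    projective (\<lambda>r a. a * tgt BR r) \<and>
    (\<exists>\<psi>\<in>left_R_dual_integrals BR. bij_betw (\<lambda>a b. \<psi> (a * b)) UNIV (left_R_dual BR)),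
    \<comment> \<open>2.c\<close>
    finitely_generated (\<lambda>l a. src BL l * a) \<and>
    projective (\<lambda>l a. src BL l * a) \<and>
    (\<exists>\<rho>\<in>left_L_dual_integrals BL. bij_betw (\<lambda>a b. \<rho> (b * a)) UNIV (left_L_dual BL)),
    \<comment> \<open>2.d\<close>
    bij S \<and>
    finitely_generated (\<lambda>l a. tgt BL (unopp l) * a) \<and>
    projective (\<lambda>l a. tgt BL (unopp l) * a) \<and>
    (\<exists>\<rho>\<in>right_L_dual_integrals BL. bij_betw (\<lambda>a b. \<rho> (b * a)) UNIV (right_L_dual BL)),
    \<comment> \<open>3.a\<close>
    \<exists>l\<in>left_integrals BL.
      bij_betw (\<lambda>\<phi>. right_R_conv BR \<phi> l) (right_R_dual BR) UNIV \<and>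
      bij_betw (\<lambda>\<phi>. left_R_conv BR \<phi> l) (left_R_dual BR) UNIV,
    \<comment> \<open>3.b\<close>
    \<exists>p\<in>right_integrals BR.
      bij_betw (\<lambda>\<phi>. left_L_conv BL \<phi> p) (left_L_dual BL) UNIV \<and>
      bij_betw (\<lambda>\<phi>. right_L_conv BL \<phi> p) (right_L_dual BL) UNIV]"
proof -
  interpret hopf_algebroid scA scL scR BL BR S
    by fact
  show ?thesis
    unfolding all_equivalent_def conditions by simp
qed

end
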